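(* Let $d \geq 2$ and let $k$ be a field whose characteristic is $0$ or greater than $d$. Then, for all sufficiently large $n$, the map $$\Lambda_{1} \times \cdots \times \Lambda_{n}: \mathrm{M}_{d} \to \mathbb{A}^{K_{1} + \cdots + K_{n}}$$ over $k$ is finite-to-one outside a proper closed subset of $\mathrm{M}_{d}$.
   Context: $\mathrm{Rat}_{d}$ is the space of rational functions $\varphi:\mathbb{P}^1\to\mathbb{P}^1$ of degree $d$, $\mathrm{PGL}_2$ acts on it by conjugation (coordinate change) $\varphi\mapsto A\varphi A^{-1}$, and $\mathrm{M}_{d} = \mathrm{Rat}_{d}/\mathrm{PGL}_{2}$ is the moduli space of rational maps of degree $d$ modulo conjugation. Powers of maps denote iteration. The multiplier of $\varphi$ at a finite fixed point $z$ is $\varphi'(z)$; it is conjugation-invariant, and the multiplier at $\infty$ is defined by conjugating $\infty$ to a finite point. The multiplier at a period-$n$ point $z$ is $(\varphi^{n})'(z)$. The collection of multipliers at the period-$n$ points (the fixed points of $\varphi^n$, counted with multiplicity) is the period-$n$ multiplier spectrum. $K_n$ denotes the number of period-$n$ points, and $\Lambda_{n}: \mathrm{M}_{d} \to \mathbb{A}^{K_{n}}$ is the regular map whose coordinates are the elementary symmetric functions of the $K_n$ period-$n$ multipliers. *)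

theory Defs
  imports
    "HOL-Computational_Algebra.Computational_Algebra"
    "HOL-Algebra.Algebraic_Closure_Type"
    "HOL-Library.Poly_Mapping"
begin

text \<open>
  Varieties over a field \<open>k\<close> (the type \<open>'k\<close>) are represented by their points over the algebraic
  closure \<open>'k alg_closure\<close>, together with the Zariski topology whose closed sets are cut out by
  polynomials with coefficients in \<open>k\<close>.
\<close>

instance alg_closure :: (field) field_gcd ..


section \<open>Rational functions\<close>

text \<open>
  A rational function over a field \<open>K\<close> is an element of \<open>K(X)\<close>, i.e. of \<open>'a poly fract\<close>.
  The pair of \<open>rf_num\<close> and \<open>rf_den\<close> is its representation in lowest terms with monic denominator.
\<close>

definition rf_num :: "'a::field_gcd poly fract \<Rightarrow> 'a poly" where
  "rf_num \<phi> = fst (quot_of_fract \<phi>)"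

definition rf_den :: "'a::field_gcd poly fract \<Rightarrow> 'a poly" where
  "rf_den \<phi> = snd (quot_of_fract \<phi>)"

definition rf_degree :: "'a::field_gcd poly fract \<Rightarrow> nat" where
  "rf_degree \<phi> = max (degree (rf_num \<phi>)) (degree (rf_den \<phi>))"

text \<open>
  For \<open>d \<ge> 1\<close> these are all morphisms of degree \<open>d\<close> from the projective line to itself.
  (The constant map with value \<open>\<infinity>\<close>, of degree \<open>0\<close>, is the only one that is not in \<open>K(X)\<close>.)
\<close>

definition Rat :: "nat \<Rightarrow> 'a::field_gcd poly fract set" where
  "Rat d = {\<phi>. rf_degree \<phi> = d}"

definition rf_X :: "'a::field_gcd poly fract" where
  "rf_X = to_fract [:0, 1:]"

definition rf_subst :: "'a::field_gcd poly \<Rightarrow> 'a poly fract \<Rightarrow> 'a poly fract" where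
  "rf_subst p \<psi> = poly (map_poly (\<lambda>c. to_fract [:c:]) p) \<psi>"

text \<open>
  The composition \<open>\<phi> \<circ> \<psi>\<close>. It is only used for non-constant \<open>\<psi>\<close>; such a \<open>\<psi>\<close> is
  transcendental over \<open>K\<close>, so that the denominator does not vanish.
\<close>

definition rf_comp :: "'a::field_gcd poly fract \<Rightarrow> 'a poly fract \<Rightarrow> 'a poly fract" where
  "rf_comp \<phi> \<psi> = rf_subst (rf_num \<phi>) \<psi> / rf_subst (rf_den \<phi>) \<psi>"

definition rf_iter :: "nat \<Rightarrow> 'a::field_gcd poly fract \<Rightarrow> 'a poly fract" where
  "rf_iter n \<phi> = (rf_comp \<phi> ^^ n) rf_X"


section \<open>Conjugation and the moduli space\<close>

text \<open>The transformation \<open>(a X + b) / (c X + e)\<close>.\<close>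

definition moebius :: "'a::field_gcd \<Rightarrow> 'a \<Rightarrow> 'a \<Rightarrow> 'a \<Rightarrow> 'a poly fract" where
  "moebius a b c e = Fract [:b, a:] [:e, c:]"

text \<open>
  Conjugation by the class in \<open>PGL\<^sub>2\<close> of the matrix with rows \<open>(a, b)\<close> and \<open>(c, e)\<close>; the adjugate
  matrix represents the inverse class.
\<close>

definition rf_conj :: "'a::field_gcd \<Rightarrow> 'a \<Rightarrow> 'a \<Rightarrow> 'a \<Rightarrow> 'a poly fract \<Rightarrow> 'a poly fract" where
  "rf_conj a b c e \<phi> = rf_comp (moebius a b c e) (rf_comp \<phi> (moebius e (- b) (- c) a))"

definition conj_rel :: "nat \<Rightarrow> ('a::field_gcd poly fract \<times> 'a poly fract) set" where
  "conj_rel d = {(\<phi>, \<psi>). \<phi> \<in> Rat d \<and> \<psi> \<in> Rat d \<and>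
     (\<exists>a b c e. a * e - b * c \<noteq> 0 \<and> \<psi> = rf_conj a b c e \<phi>)}"

definition Moduli :: "nat \<Rightarrow> 'a::field_gcd poly fract set set" where
  "Moduli d = Rat d // conj_rel d"


section \<open>Zariski topology\<close>

text \<open>
  Polynomials over \<open>k\<close> in the variables \<open>x\<^sub>0, x\<^sub>1, \<dots>\<close> are finitely supported maps from monomials
  (exponent vectors) to coefficients.
\<close>

definition mpoly_homogeneous :: "nat \<Rightarrow> ((nat \<Rightarrow>\<^sub>0 nat) \<Rightarrow>\<^sub>0 'k::zero) \<Rightarrow> bool" where
  "mpoly_homogeneous D f \<longleftrightarrow>
     (\<forall>m \<in> Poly_Mapping.keys f. (\<Sum>i\<in>Poly_Mapping.keys m. Poly_Mapping.lookup m i) = D)"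

definition mpoly_vars :: "((nat \<Rightarrow>\<^sub>0 nat) \<Rightarrow>\<^sub>0 'k::zero) \<Rightarrow> nat set" where
  "mpoly_vars f = (\<Union>m\<in>Poly_Mapping.keys f. Poly_Mapping.keys m)"

definition mpoly_eval :: "((nat \<Rightarrow>\<^sub>0 nat) \<Rightarrow>\<^sub>0 'k::field) \<Rightarrow> (nat \<Rightarrow> 'k alg_closure) \<Rightarrow> 'k alg_closure"
  where
  "mpoly_eval f x = (\<Sum>m\<in>Poly_Mapping.keys f. to_ac (Poly_Mapping.lookup f m) *
     (\<Prod>i\<in>Poly_Mapping.keys m. x i ^ Poly_Mapping.lookup m i))"

text \<open>
  \<open>Rat d\<close> is an open subset of the projective space of dimension \<open>2 d + 1\<close>, in which a map
  \<open>p / q\<close> has the homogeneous coordinates \<open>(p\<^sub>0 : \<dots> : p\<^sub>d : q\<^sub>0 : \<dots> : q\<^sub>d)\<close>. It carries the subspace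
  topology.
\<close>

definition rf_coords :: "nat \<Rightarrow> 'a::field_gcd poly fract \<Rightarrow> nat \<Rightarrow> 'a" where
  "rf_coords d \<phi> i =
     (if i \<le> d then coeff (rf_num \<phi>) i else coeff (rf_den \<phi>) (i - (d + 1)))"

definition Rat_closed :: "nat \<Rightarrow> 'k::field alg_closure poly fract set \<Rightarrow> bool" where
  "Rat_closed d Y \<longleftrightarrow>
     (\<exists>F :: ((nat \<Rightarrow>\<^sub>0 nat) \<Rightarrow>\<^sub>0 'k) set.
        (\<forall>f\<in>F. mpoly_vars f \<subseteq> {..2 * d + 1} \<and> (\<exists>D. mpoly_homogeneous D f)) \<and>
        Y = {\<phi> \<in> Rat d. \<forall>f\<in>F. mpoly_eval f (rf_coords d \<phi>) = 0})"

text \<open>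
  The moduli space is a geometric quotient, so it has the quotient topology; \<open>\<Union>Z\<close> is the preimage
  of \<open>Z\<close> in \<open>Rat d\<close>.
\<close>

definition Moduli_closed :: "nat \<Rightarrow> 'k::field alg_closure poly fract set set \<Rightarrow> bool" where
  "Moduli_closed d Z \<longleftrightarrow> Z \<subseteq> Moduli d \<and> Rat_closed d (\<Union>Z)"


section \<open>Fixed points and multipliers\<close>

text \<open>
  The points of the projective line are \<open>Some z\<close> for \<open>z\<close> in the field, and \<open>None\<close> for \<open>\<infinity>\<close>.
  Everything at \<open>\<infinity>\<close> is defined by moving \<open>\<infinity>\<close> to \<open>0\<close> through conjugation with \<open>1 / X\<close>.
\<close>

definition rf_flip :: "'a::field_gcd poly fract \<Rightarrow> 'a poly fract" where
  "rf_flip \<phi> = rf_conj 0 1 1 0 \<phi>"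

definition fixpoint_poly :: "'a::field_gcd poly fract \<Rightarrow> 'a poly" where
  "fixpoint_poly \<phi> = rf_num \<phi> - [:0, 1:] * rf_den \<phi>"

text \<open>
  The fixed points, with their multiplicities. The multiplicity of \<open>\<infinity>\<close> is \<open>0\<close> if \<open>\<infinity>\<close> is not fixed.
\<close>

definition fixpoints :: "'a::field_gcd poly fract \<Rightarrow> 'a option multiset" where
  "fixpoints \<phi> = image_mset Some (proots (fixpoint_poly \<phi>)) +
     replicate_mset (order 0 (fixpoint_poly (rf_flip \<phi>))) None"

text \<open>The value at \<open>z\<close> of the derivative of \<open>\<phi>\<close>, by the quotient rule.\<close>

definition rf_deriv_at :: "'a::field_gcd poly fract \<Rightarrow> 'a \<Rightarrow> 'a" where
  "rf_deriv_at \<phi> z =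
     (let p = rf_num \<phi>; q = rf_den \<phi>
      in (poly (pderiv p) z * poly q z - poly p z * poly (pderiv q) z) / (poly q z)\<^sup>2)"

definition multiplier :: "'a::field_gcd poly fract \<Rightarrow> 'a option \<Rightarrow> 'a" where
  "multiplier \<phi> x =
     (case x of Some z \<Rightarrow> rf_deriv_at \<phi> z | None \<Rightarrow> rf_deriv_at (rf_flip \<phi>) 0)"

definition period_multipliers :: "nat \<Rightarrow> 'a::field_gcd poly fract \<Rightarrow> 'a multiset" where
  "period_multipliers n \<phi> = image_mset (multiplier (rf_iter n \<phi>)) (fixpoints (rf_iter n \<phi>))"


section \<open>The multiplier spectrum maps\<close>

text \<open>
  The \<open>j\<close>-th elementary symmetric function of the members of \<open>A\<close>, where the copies of an element
  \<open>x\<close> are distinguished as \<open>(x, 0), (x, 1), \<dots>\<close>.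
\<close>

definition elem_sym :: "nat \<Rightarrow> 'a::comm_semiring_1 multiset \<Rightarrow> 'a" where
  "elem_sym j A =
     (\<Sum>S | S \<subseteq> (SIGMA x:set_mset A. {..<count A x}) \<and> card S = j. \<Prod>(x, i)\<in>S. x)"

text \<open>
  The number of period-\<open>n\<close> points of a map of degree \<open>d\<close>, that is, of fixed points of a map of
  degree \<open>d ^ n\<close>.
\<close>

definition num_period_points :: "nat \<Rightarrow> nat \<Rightarrow> nat" where
  "num_period_points d n = d ^ n + 1"

definition Lambda_rf :: "nat \<Rightarrow> nat \<Rightarrow> 'a::field_gcd poly fract \<Rightarrow> 'a list" where
  "Lambda_rf d n \<phi> =
     map (\<lambda>j. elem_sym j (period_multipliers n \<phi>)) [1..<num_period_points d n + 1]"

text \<open>The multipliers are invariant under conjugation, so \<open>Lambda_rf\<close> descends to the moduli space.\<close>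

definition Lambda :: "nat \<Rightarrow> nat \<Rightarrow> 'a::field_gcd poly fract set \<Rightarrow> 'a list" where
  "Lambda d n c = the_elem (Lambda_rf d n ` c)"

text \<open>
  The product \<open>\<Lambda>\<^sub>1 \<times> \<dots> \<times> \<Lambda>\<^sub>n\<close>; points of affine \<open>N\<close>-space are lists of length \<open>N\<close>.
\<close>

definition Lambda_prod :: "nat \<Rightarrow> nat \<Rightarrow> 'a::field_gcd poly fract set \<Rightarrow> 'a list" where
  "Lambda_prod d n c = concat (map (\<lambda>m. Lambda d m c) [1..<n + 1])"

end

theory Submission
  imports Defs "Jordan_Normal_Form.Char_Poly" "HOL-Library.Function_Algebras"
begin

text \<open>
  The slice consists of the maps
  \<open>(X\<^sup>d + a\<^bsub>d-1\<^esub> X\<^bsup>d-1\<^esup> + \<dots> + a\<^sub>1 X) / (b\<^bsub>d-1\<^esub> X\<^bsup>d-1\<^esup> + \<dots> + b\<^sub>1 X + 1)\<close>. It has \<open>2 d - 2\<close> coordinates,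
  the dimension of the moduli space, and a map without period-\<open>n\<close> multiplier \<open>1\<close> is conjugate to a
  point of it: its fixed points are distinct, and two of them can be moved to \<open>0\<close> and \<open>\<infinity>\<close>
  (\<open>slice_normal_form\<close>). Finiteness of the fibres therefore follows if every slice coordinate is a
  root of a polynomial whose coefficients depend only on the elementary symmetric functions of the
  period-\<open>n\<close> multipliers, for one fixed \<open>n\<close>; the exceptional set is where a chosen coefficient of one
  of these polynomials vanishes or \<open>1\<close> is a multiplier. This set serves all larger \<open>n\<close> as well,
  since a fibre of \<open>\<Lambda>\<^sub>1 \<times> \<dots> \<times> \<Lambda>\<^sub>N\<close> lies in a fibre of \<open>\<Lambda>\<^sub>n\<close> for \<open>n \<le> N\<close>.

  It remains to see that the symmetric functions of the multipliers have full transcendence degree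
  on the slice. This can be tested near the power map \<open>X\<^sup>d\<close>. Along the line \<open>\<epsilon> h\<close> through it, with \<open>h\<close> a
  vector of slice coordinates, each solution of \<open>z\<^bsup>N\<^esup> = 1\<close>, \<open>N = d\<^sup>n - 1\<close>, continues by Hensel's lemma
  to a period-\<open>n\<close> point over the power series in \<open>\<epsilon>\<close>, because \<open>N\<close> is invertible in the field. The first
  order term of its multiplier is \<open>- d\<^bsup>n-1\<^esup> \<Sum>\<^sub>l \<Sum>\<^sub>i w\<^sub>i h\<^sub>i z\<^bsup>e(i,l)\<^esup>\<close> with \<open>l < n\<close> and weights
  \<open>0 < w\<^sub>i < d\<close> (\<open>multiplier_expansion\<close>). For \<open>n \<ge> 3\<close> the exponent \<open>e(i,0)\<close> differs modulo \<open>N\<close> from all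
  other exponents, so orthogonality of the characters of the group of \<open>N\<close>-th roots of unity isolates
  \<open>h\<^sub>i\<close>: a fixed linear combination \<open>\<nu>\<^sub>i\<close> of the multipliers has the expansion \<open>h\<^sub>i \<epsilon> + \<dots>\<close>
  (\<open>slice_dual_basis\<close>). The assumption on the characteristic makes \<open>d\<close> and the weights invertible, and
  it allows a choice of \<open>n\<close>, either \<open>3\<close> or \<open>4\<close>, for which \<open>N\<close> is invertible.

  Instead of transcendence degrees the proof counts dimensions. The monomials in the \<open>\<nu>\<^sub>i\<close> are linearly
  independent, and the multipliers are integral over the symmetric functions; hence the forms of degree
  \<open>w\<close> in the symmetric functions span a space whose dimension grows at least like \<open>w\<^bsup>2d-2\<^esup>\<close>
  (\<open>growth_bound\<close>). Multiplying them by powers of a slice coordinate would produce too many independent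
  polynomials of bounded degree in \<open>2 d - 2\<close> variables, so there is a relation
  (\<open>algebraic_relation_from_growth\<close>).

  For this argument, and for the closedness of the exceptional set, the symmetric functions are
  written as ratios of forms, with coefficients in the base field, in the homogeneous coordinates of a
  map. A product over the fixed points is computed as a determinant (\<open>norm_det_roots\<close>), after moving a
  point \<open>t\<close> to \<open>\<infinity>\<close> so that no fixed point lies there; the parameter \<open>t\<close> is an indeterminate, and the
  forms are the coefficients of its powers (\<open>mult_coeff_regular\<close>).
\<close>

section \<open>Homogeneous substitution\<close>

definition hom_eval :: "nat \<Rightarrow> 'a::comm_ring_1 poly \<Rightarrow> 'a \<Rightarrow> 'a \<Rightarrow> 'a" where
  "hom_eval d p a b = (\<Sum>i\<le>d. coeff p i * (a ^ i * b ^ (d - i)))"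

text \<open>
  The form \<open>B\<^sup>d p(A / B)\<close>, for \<open>p\<close> regarded as a polynomial of degree \<open>d\<close>.
\<close>

definition hom_subst :: "nat \<Rightarrow> 'a::comm_ring_1 poly \<Rightarrow> 'a poly \<Rightarrow> 'a poly \<Rightarrow> 'a poly" where
  "hom_subst d p A B = (\<Sum>i\<le>d. smult (coeff p i) (A ^ i * B ^ (d - i)))"

lemma smult_sum_right': "smult c (sum f S) = (\<Sum>s\<in>S. smult c (f s))"
  by (induction S rule: infinite_finite_induct) (simp_all add: smult_add_right)

lemma poly_eq_sum_of_degree_le:
  fixes p :: "'a::comm_ring_1 poly"
  assumes "degree p \<le> d"
  shows "poly p x = (\<Sum>i\<le>d. coeff p i * x ^ i)"
  unfolding poly_altdef using assms
  by (intro sum.mono_neutral_left) (auto simp: coeff_eq_0)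

lemma poly_hom_subst: "poly (hom_subst d p A B) x = hom_eval d p (poly A x) (poly B x)"
  by (simp add: hom_subst_def hom_eval_def poly_sum)

lemma hom_subst_add: "hom_subst d (p + q) A B = hom_subst d p A B + hom_subst d q A B"
  by (simp add: hom_subst_def smult_add_left sum.distrib)

lemma hom_subst_diff: "hom_subst d (p - q) A B = hom_subst d p A B - hom_subst d q A B"
  by (simp add: hom_subst_def smult_diff_left sum_subtractf)

lemma hom_subst_smult: "hom_subst d (smult c p) A B = smult c (hom_subst d p A B)"
  by (simp add: hom_subst_def smult_sum_right')

lemma hom_subst_sum: "hom_subst d (sum f S) A B = (\<Sum>s\<in>S. hom_subst d (f s) A B)"
proof (induction S rule: infinite_finite_induct)
  case (insert x F)
  then show ?case by (simp add: hom_subst_add)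
qed (simp_all add: hom_subst_def)

lemma hom_subst_monom:
  assumes "i \<le> d"
  shows "hom_subst d (monom c i) A B = smult c (A ^ i * B ^ (d - i))"
proof -
  have "hom_subst d (monom c i) A B = (\<Sum>j\<le>d. if j = i then smult c (A ^ i * B ^ (d - i)) else 0)"
    unfolding hom_subst_def by (intro sum.cong) auto
  also have "\<dots> = smult c (A ^ i * B ^ (d - i))"
    using assms by simp
  finally show ?thesis .
qed

lemma hom_subst_mult:
  assumes "degree f \<le> m" "degree g \<le> n"
  shows "hom_subst (m + n) (f * g) A B = hom_subst m f A B * hom_subst n g A B"
proof -
  have f: "f = (\<Sum>i\<le>m. monom (coeff f i) i)" and g: "g = (\<Sum>j\<le>n. monom (coeff g j) j)"
    using assms by (simp_all add: poly_as_sum_of_monoms')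
  have "f * g = (\<Sum>i\<le>m. \<Sum>j\<le>n. monom (coeff f i * coeff g j) (i + j))"
    by (subst f, subst g) (simp add: sum_product mult_monom)
  hence "hom_subst (m + n) (f * g) A B =
      (\<Sum>i\<le>m. \<Sum>j\<le>n. smult (coeff f i * coeff g j) (A ^ (i + j) * B ^ (m + n - (i + j))))"
    by (simp add: hom_subst_sum hom_subst_monom)
  also have "\<dots> = (\<Sum>i\<le>m. \<Sum>j\<le>n. smult (coeff f i) (A ^ i * B ^ (m - i)) *
      smult (coeff g j) (A ^ j * B ^ (n - j)))"
  proof (intro sum.cong refl)
    fix i j assume "i \<in> {..m}" "j \<in> {..n}"
    hence "m + n - (i + j) = (m - i) + (n - j)" by auto
    then show "smult (coeff f i * coeff g j) (A ^ (i + j) * B ^ (m + n - (i + j))) =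
        smult (coeff f i) (A ^ i * B ^ (m - i)) * smult (coeff g j) (A ^ j * B ^ (n - j))"
      by (simp add: power_add mult_ac)
  qed
  also have "\<dots> = hom_subst m f A B * hom_subst n g A B"
    by (simp add: hom_subst_def sum_product)
  finally show ?thesis .
qed

lemma hom_subst_0_one: "hom_subst 0 1 A B = 1"
  by (simp add: hom_subst_def)

lemma degree_power_le': "degree f \<le> m \<Longrightarrow> degree (f ^ k) \<le> k * m"
  for f :: "'a::comm_ring_1 poly"
  by (metis degree_power_le mult.commute mult_le_mono2 order_trans)

lemma hom_subst_power:
  assumes "degree f \<le> m"
  shows "hom_subst (k * m) (f ^ k) A B = hom_subst m f A B ^ k"
proof (induction k)
  case (Suc k)
  have "hom_subst (Suc k * m) (f ^ Suc k) A B = hom_subst (m + k * m) (f * f ^ k) A B"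
    by simp
  also have "\<dots> = hom_subst m f A B * hom_subst (k * m) (f ^ k) A B"
    using assms by (intro hom_subst_mult degree_power_le')
  finally show ?case using Suc by simp
qed (simp add: hom_subst_0_one)

lemma hom_subst_assoc:
  assumes "degree A \<le> e" "degree B \<le> e"
  shows "hom_subst (d * e) (hom_subst d p A B) C E = hom_subst d p (hom_subst e A C E) (hom_subst e B C E)"
proof -
  have "hom_subst (d * e) (A ^ i * B ^ (d - i)) C E = hom_subst e A C E ^ i * hom_subst e B C E ^ (d - i)"
    if "i \<le> d" for i
  proof -
    have "d * e = i * e + (d - i) * e"
      using that by (metis add_mult_distrib le_add_diff_inverse)
    then show ?thesis
      using assms by (simp add: hom_subst_mult degree_power_le' hom_subst_power)
  qed
  then show ?thesis
    by (simp add: hom_subst_def[of d p A B] hom_subst_def[of d p "hom_subst e A C E"]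
        hom_subst_sum hom_subst_smult)
qed

lemma degree_hom_subst:
  assumes "degree A \<le> e" "degree B \<le> e"
  shows "degree (hom_subst d p A B) \<le> d * e"
  unfolding hom_subst_def
proof (rule degree_sum_le)
  fix i assume "i \<in> {..d}"
  hence "d * e = i * e + (d - i) * e"
    by (metis add_mult_distrib le_add_diff_inverse atMost_iff)
  moreover have "degree (smult (coeff p i) (A ^ i * B ^ (d - i))) \<le> i * e + (d - i) * e"
    by (meson add_mono assms degree_mult_le degree_power_le' degree_smult_le order_trans)
  ultimately show "degree (smult (coeff p i) (A ^ i * B ^ (d - i))) \<le> d * e" by simp
qed simp

lemma coeff_mult_top:
  fixes A B :: "'a::comm_ring_1 poly"
  assumes "degree A \<le> m" "degree B \<le> n"
  shows "coeff (A * B) (m + n) = coeff A m * coeff B n"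
proof -
  have "coeff (A * B) (m + n) = (\<Sum>i\<le>m + n. if i = m then coeff A m * coeff B n else 0)"
    unfolding coeff_mult
  proof (intro sum.cong refl)
    fix i assume "i \<in> {..m + n}"
    consider "i = m" | "i > m" | "i < m" by linarith
    then show "coeff A i * coeff B (m + n - i) = (if i = m then coeff A m * coeff B n else 0)"
    proof cases
      case 2
      then show ?thesis using assms by (simp add: coeff_eq_0)
    next
      case 3
      hence "m + n - i > n" by simp
      then show ?thesis using 3 assms by (simp add: coeff_eq_0)
    qed simp
  qed
  then show ?thesis by simp
qed

lemma coeff_power_top:
  fixes A :: "'a::comm_ring_1 poly"
  assumes "degree A \<le> m"
  shows "coeff (A ^ k) (k * m) = coeff A m ^ k"
proof (induction k)
  case (Suc k)
  have "coeff (A ^ Suc k) (Suc k * m) = coeff (A * A ^ k) (m + k * m)" by simp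
  also have "\<dots> = coeff A m * coeff (A ^ k) (k * m)"
    using assms by (intro coeff_mult_top degree_power_le')
  finally show ?case using Suc by simp
qed simp

lemma coeff_hom_subst_top:
  assumes "degree A \<le> e" "degree B \<le> e"
  shows "coeff (hom_subst d p A B) (d * e) = hom_eval d p (coeff A e) (coeff B e)"
  unfolding hom_subst_def hom_eval_def coeff_sum
proof (intro sum.cong refl)
  fix i assume "i \<in> {..d}"
  hence "d * e = i * e + (d - i) * e"
    by (metis add_mult_distrib le_add_diff_inverse atMost_iff)
  then show "coeff (smult (coeff p i) (A ^ i * B ^ (d - i))) (d * e) =
      coeff p i * (coeff A e ^ i * coeff B e ^ (d - i))"
    using assms by (simp add: coeff_mult_top coeff_power_top degree_power_le')
qed

lemma hom_eval_unit:
  assumes "degree p \<le> d"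
  shows "hom_eval d p (x * b) b = b ^ d * poly p x"
proof -
  have "hom_eval d p (x * b) b = (\<Sum>i\<le>d. b ^ d * (coeff p i * x ^ i))"
    unfolding hom_eval_def
  proof (intro sum.cong refl)
    fix i assume "i \<in> {..d}"
    hence "b ^ d = b ^ i * b ^ (d - i)" by (simp flip: power_add)
    then show "coeff p i * ((x * b) ^ i * b ^ (d - i)) = b ^ d * (coeff p i * x ^ i)"
      by (simp add: power_mult_distrib mult_ac)
  qed
  also have "\<dots> = b ^ d * poly p x"
    using assms by (simp add: poly_eq_sum_of_degree_le sum_distrib_left)
  finally show ?thesis .
qed

lemma hom_eval_infinity: "hom_eval d p a 0 = coeff p d * a ^ d"
proof -
  have "hom_eval d p a 0 = (\<Sum>i\<le>d. if i = d then coeff p d * a ^ d else 0)"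
    unfolding hom_eval_def by (intro sum.cong) (auto simp: zero_power)
  then show ?thesis by simp
qed

lemma hom_eval_zero: "d \<ge> 1 \<Longrightarrow> hom_eval d p 0 0 = 0"
  by (simp add: hom_eval_infinity zero_power)

lemma hom_subst_X_one:
  assumes "degree p \<le> d"
  shows "hom_subst d p [:0, 1:] 1 = p"
proof -
  have "hom_subst d p [:0, 1:] 1 = (\<Sum>i\<le>d. monom (coeff p i) i)"
    unfolding hom_subst_def by (simp add: monom_altdef)
  then show ?thesis using assms by (simp add: poly_as_sum_of_monoms')
qed

lemma hom_subst_linear: "hom_subst 1 [:b, a:] A B = smult a A + smult b B"
  by (simp add: hom_subst_def)

lemma hom_subst_Suc:
  assumes "degree p \<le> d"
  shows "hom_subst (Suc d) p A B = B * hom_subst d p A B"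
proof -
  have "hom_subst (Suc d) p A B = hom_subst (1 + d) ([:1, 0:] * p) A B" by simp
  also have "\<dots> = hom_subst 1 [:1, 0:] A B * hom_subst d p A B"
    using assms by (intro hom_subst_mult) auto
  finally show ?thesis by (simp add: hom_subst_linear del: pCons_0_0 One_nat_def)
qed

lemma hom_subst_pCons_0:
  assumes "degree p \<le> d"
  shows "hom_subst (Suc d) (pCons 0 p) A B = A * hom_subst d p A B"
proof -
  have "hom_subst (Suc d) (pCons 0 p) A B = hom_subst (1 + d) ([:0, 1:] * p) A B" by simp
  also have "\<dots> = hom_subst 1 [:0, 1:] A B * hom_subst d p A B"
    using assms by (intro hom_subst_mult) auto
  finally show ?thesis by (simp add: hom_subst_linear del: One_nat_def)
qed


section \<open>Iteration and conjugation of pairs of polynomials\<close>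

fun iter_pair :: "nat \<Rightarrow> 'a::comm_ring_1 poly \<Rightarrow> 'a poly \<Rightarrow> nat \<Rightarrow> 'a poly \<times> 'a poly" where
  "iter_pair d p q 0 = ([:0, 1:], 1)"
| "iter_pair d p q (Suc n) = (hom_subst d p (fst (iter_pair d p q n)) (snd (iter_pair d p q n)),
     hom_subst d q (fst (iter_pair d p q n)) (snd (iter_pair d p q n)))"

abbreviation "iter_num d p q n \<equiv> fst (iter_pair d p q n)"
abbreviation "iter_den d p q n \<equiv> snd (iter_pair d p q n)"

text \<open>
  Conjugation of \<open>p / q\<close> by \<open>(a X + b) / (c X + e)\<close>. The adjugate matrix takes the place of the
  inverse one, which multiplies the pair by the \<open>d\<close>-th power of the determinant; for determinant \<open>1\<close>
  there is no such factor.
\<close>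

definition conj_num :: "'a::comm_ring_1 \<Rightarrow> 'a \<Rightarrow> 'a \<Rightarrow> 'a \<Rightarrow> nat \<Rightarrow> 'a poly \<Rightarrow> 'a poly \<Rightarrow> 'a poly" where
  "conj_num a b c e d p q =
     smult a (hom_subst d p [:- b, e:] [:a, - c:]) + smult b (hom_subst d q [:- b, e:] [:a, - c:])"

definition conj_den :: "'a::comm_ring_1 \<Rightarrow> 'a \<Rightarrow> 'a \<Rightarrow> 'a \<Rightarrow> nat \<Rightarrow> 'a poly \<Rightarrow> 'a poly \<Rightarrow> 'a poly" where
  "conj_den a b c e d p q =
     smult c (hom_subst d p [:- b, e:] [:a, - c:]) + smult e (hom_subst d q [:- b, e:] [:a, - c:])"

definition fix_poly :: "'a::comm_ring_1 poly \<Rightarrow> 'a poly \<Rightarrow> 'a poly" where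
  "fix_poly p q = p - pCons 0 q"

lemma degree_iter:
  shows "degree (iter_num d p q n) \<le> d ^ n" and "degree (iter_den d p q n) \<le> d ^ n"
proof (induction n)
  case (Suc n)
  { case 1 show ?case using degree_hom_subst[OF Suc] by simp }
  { case 2 show ?case using degree_hom_subst[OF Suc] by simp }
qed simp_all

lemma degree_conj:
  shows "degree (conj_num a b c e d p q) \<le> d" and "degree (conj_den a b c e d p q) \<le> d"
proof -
  have "degree (hom_subst d f [:- b, e:] [:a, - c:]) \<le> d" for f
    using degree_hom_subst[of "[:- b, e:]" 1 "[:a, - c:]" d f] by simp
  then show "degree (conj_num a b c e d p q) \<le> d" "degree (conj_den a b c e d p q) \<le> d"
    unfolding conj_num_def conj_den_def by (meson degree_add_le degree_smult_le order_trans)+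
qed

lemma degree_fix_poly: "degree p \<le> d \<Longrightarrow> degree q \<le> d \<Longrightarrow> degree (fix_poly p q) \<le> Suc d"
  unfolding fix_poly_def by (intro degree_diff_le) (auto simp: degree_pCons_eq_if)

lemma hom_subst_conj:
  fixes a b c e :: "'a::comm_ring_1"
  assumes "a * e - b * c = 1"
  defines "L \<equiv> [:- b, e:]" and "M \<equiv> [:a, - c:]"
  shows "hom_subst d (hom_subst d p L M) (smult a U + smult b V) (smult c U + smult e V) = hom_subst d p U V"
proof -
  have "hom_subst (d * 1) (hom_subst d p L M) (smult a U + smult b V) (smult c U + smult e V) =
      hom_subst d p (hom_subst 1 L (smult a U + smult b V) (smult c U + smult e V))
        (hom_subst 1 M (smult a U + smult b V) (smult c U + smult e V))"
    by (rule hom_subst_assoc) (auto simp: L_def M_def)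
  also have "hom_subst 1 L (smult a U + smult b V) (smult c U + smult e V) = smult (a * e - b * c) U"
    unfolding L_def hom_subst_linear by (simp add: smult_add_right algebra_simps smult_diff_left)
  also have "hom_subst 1 M (smult a U + smult b V) (smult c U + smult e V) = smult (a * e - b * c) V"
    unfolding M_def hom_subst_linear by (simp add: smult_add_right algebra_simps smult_diff_left)
  finally show ?thesis using assms by simp
qed

text \<open>
  For determinant \<open>1\<close> the two inner linear substitutions cancel exactly, so that conjugation
  commutes with iteration on the level of pairs and not only up to a common factor.
\<close>

lemma iter_pair_conj:
  fixes a b c e :: "'a::comm_ring_1"
  assumes det: "a * e - b * c = 1"
  shows "iter_pair d (conj_num a b c e d p q) (conj_den a b c e d p q) n =
    (conj_num a b c e (d ^ n) (iter_num d p q n) (iter_den d p q n),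
     conj_den a b c e (d ^ n) (iter_num d p q n) (iter_den d p q n))"
proof (induction n)
  case 0
  have "smult a [:- b, e:] + smult b [:a, - c:] = [:0, a * e - b * c:]"
    by (simp add: algebra_simps)
  moreover have "smult c [:- b, e:] + smult e [:a, - c:] = [:a * e - b * c:]"
    by (simp add: algebra_simps)
  moreover have "hom_subst (Suc 0) 1 A B = B" for A B :: "'a poly"
    using hom_subst_linear[of 1 0 A B] by (simp add: one_pCons)
  moreover have "hom_subst (Suc 0) [:0, 1:] A B = A" for A B :: "'a poly"
    using hom_subst_linear[of 0 1 A B] by simp
  ultimately show ?case using det by (simp add: conj_num_def conj_den_def one_pCons)
next
  case (Suc n)
  define A where "A = iter_num d p q n"
  define B where "B = iter_den d p q n"
  have AB: "degree A \<le> d ^ n" "degree B \<le> d ^ n"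
    by (simp_all add: A_def B_def degree_iter)
  have *: "hom_subst d (hom_subst d f [:- b, e:] [:a, - c:]) (conj_num a b c e (d ^ n) A B) (conj_den a b c e (d ^ n) A B)
     = hom_subst (d * d ^ n) (hom_subst d f A B) [:- b, e:] [:a, - c:]" for f
    unfolding hom_subst_assoc[OF AB]
    unfolding conj_num_def conj_den_def by (rule hom_subst_conj[OF det])
  show ?case
    using Suc unfolding iter_pair.simps fst_conv snd_conv A_def[symmetric] B_def[symmetric]
    by (simp add: conj_num_def[of a b c e d] conj_den_def[of a b c e d] hom_subst_add hom_subst_smult *)
       (simp add: conj_num_def conj_den_def)
qed

lemma conj_conj:
  fixes a b c e :: "'a::comm_ring_1"
  shows "conj_num a' b' c' e' d (conj_num a b c e d p q) (conj_den a b c e d p q) =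
      conj_num (a' * a + b' * c) (a' * b + b' * e) (c' * a + e' * c) (c' * b + e' * e) d p q" (is ?num)
    and "conj_den a' b' c' e' d (conj_num a b c e d p q) (conj_den a b c e d p q) =
      conj_den (a' * a + b' * c) (a' * b + b' * e) (c' * a + e' * c) (c' * b + e' * e) d p q" (is ?den)
proof -
  have *: "hom_subst d (hom_subst d f [:- b, e:] [:a, - c:]) [:- b', e':] [:a', - c':] =
      hom_subst d f [:- (a' * b + b' * e), c' * b + e' * e:] [:a' * a + b' * c, - (c' * a + e' * c):]" for f
  proof -
    have "hom_subst (d * 1) (hom_subst d f [:- b, e:] [:a, - c:]) [:- b', e':] [:a', - c':] =
      hom_subst d f (hom_subst 1 [:- b, e:] [:- b', e':] [:a', - c':]) (hom_subst 1 [:a, - c:] [:- b', e':] [:a', - c':])"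
      by (rule hom_subst_assoc) auto
    then show ?thesis unfolding hom_subst_linear by (simp add: algebra_simps)
  qed
  show ?num ?den
    unfolding conj_num_def[of a' b' c' e' d] conj_den_def[of a' b' c' e' d]
    by (simp_all add: conj_num_def[of a b c e d p q] conj_den_def[of a b c e d p q] hom_subst_add hom_subst_smult * conj_num_def conj_den_def
        smult_add_right smult_add_left algebra_simps)
qed

lemma fix_poly_conj:
  fixes a b c e :: "'a::comm_ring_1"
  assumes "degree p \<le> d" "degree q \<le> d"
  shows "fix_poly (conj_num a b c e d p q) (conj_den a b c e d p q) =
    hom_subst (Suc d) (fix_poly p q) [:- b, e:] [:a, - c:]"
proof -
  define P where "P = hom_subst d p [:- b, e:] [:a, - c:]"
  define Q where "Q = hom_subst d q [:- b, e:] [:a, - c:]"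
  have "hom_subst (Suc d) (fix_poly p q) [:- b, e:] [:a, - c:] = [:a, - c:] * P - [:- b, e:] * Q"
    unfolding fix_poly_def hom_subst_diff P_def Q_def
    using assms by (simp only: hom_subst_Suc hom_subst_pCons_0)
  also have "\<dots> = fix_poly (conj_num a b c e d p q) (conj_den a b c e d p q)"
    unfolding fix_poly_def conj_num_def conj_den_def P_def[symmetric] Q_def[symmetric]
    by (simp add: algebra_simps smult_add_right)
  finally show ?thesis by simp
qed

text \<open>
  If \<open>w\<close> is the image of the fixed point \<open>x\<close>, then the denominator and the derivative of the fixed
  point polynomial get the same factor \<open>s\<close>. The multiplier is determined by their quotient, and hence
  is invariant. The equations hold over a domain, without division.
\<close>

lemma conj_at_fixed_point:
  fixes a b c e x w :: "'a::idom"
  assumes deg: "degree p \<le> d" "degree q \<le> d"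
    and det: "a * e - b * c = 1"
    and x: "poly (fix_poly p q) x = 0"
    and w: "(c * x + e) * w = a * x + b"
  defines "p' \<equiv> conj_num a b c e d p q" and "q' \<equiv> conj_den a b c e d p q"
    and "s \<equiv> (c * x + e) * (a - c * w) ^ d"
  shows "poly (fix_poly p' q') w = 0" and "poly q' w = s * poly q x"
    and "poly (pderiv (fix_poly p' q')) w = s * poly (pderiv (fix_poly p q)) x"
    and "(a - c * w) * (c * x + e) = 1"
proof -
  define f where "f = fix_poly p q"
  define g where "g = synthetic_div f x"
  define l where "l = a - c * w"
  have "l * (c * x + e) = a * (c * x + e) - c * ((c * x + e) * w)"
    by (simp add: l_def algebra_simps)
  also have "\<dots> = a * e - b * c" unfolding w by (simp add: algebra_simps)
  finally show u: "(a - c * w) * (c * x + e) = 1" using det by (simp add: l_def)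
  hence u': "l * (c * x + e) = 1" by (simp add: l_def)
  have "(e * w - b) * (c * x + e) = e * ((c * x + e) * w) - b * (c * x + e)"
    by (simp add: algebra_simps)
  also have "\<dots> = x * (a * e - b * c)" unfolding w by (simp add: algebra_simps)
  finally have "(e * w - b) * (c * x + e) = x" using det by simp
  hence L1: "e * w - b = x * l"
    using u' by (metis mult.assoc mult.commute mult.right_neutral)
  have ev: "hom_eval m h (e * w - b) l = l ^ m * poly h x" if "degree h \<le> m" for m h
    unfolding L1 by (rule hom_eval_unit[OF that])
  have lin: "poly [:- b, e:] w = e * w - b" "poly [:a, - c:] w = l"
    by (simp_all add: l_def algebra_simps)
  have f: "f = [:- x, 1:] * g"
    using synthetic_div_correct'[of x f] x by (simp add: g_def f_def)
  have "degree f \<le> Suc d" unfolding f_def by (rule degree_fix_poly[OF deg])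
  hence dg: "degree g \<le> d" by (simp add: g_def degree_synthetic_div)
  have "pderiv f = pderiv [:- x, 1:] * g + [:- x, 1:] * pderiv g"
    unfolding f pderiv_mult by (simp add: algebra_simps)
  hence fx: "poly (pderiv f) x = poly g x" by (simp add: pderiv_pCons)
  have F': "fix_poly p' q' = hom_subst (1 + d) ([:- x, 1:] * g) [:- b, e:] [:a, - c:]"
    unfolding p'_def q'_def fix_poly_conj[OF deg] f[symmetric] by (simp add: f_def)
  also have "\<dots> = hom_subst 1 [:- x, 1:] [:- b, e:] [:a, - c:] * hom_subst d g [:- b, e:] [:a, - c:]"
    using dg by (intro hom_subst_mult) auto
  finally have F: "fix_poly p' q' = [:- b - x * a, e + x * c:] * hom_subst d g [:- b, e:] [:a, - c:]"
    unfolding hom_subst_linear by simp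
  have z: "poly [:- b - x * a, e + x * c:] w = 0"
    using w by (simp add: algebra_simps)
  show "poly (fix_poly p' q') w = 0"
    unfolding F poly_mult z by simp
  have "poly (pderiv (fix_poly p' q')) w = (e + x * c) * (l ^ d * poly g x)"
    unfolding F pderiv_mult poly_add poly_mult z poly_hom_subst lin ev[OF dg]
    by (simp add: pderiv_pCons)
  then show "poly (pderiv (fix_poly p' q')) w = s * poly (pderiv (fix_poly p q)) x"
    by (simp add: fx[unfolded f_def] s_def l_def algebra_simps)
  have px: "poly p x = x * poly q x" using x by (simp add: fix_poly_def)
  have "poly q' w = c * (l ^ d * poly p x) + e * (l ^ d * poly q x)"
    unfolding q'_def conj_den_def poly_add poly_smult poly_hom_subst lin ev[OF deg(1)] ev[OF deg(2)] ..
  then show "poly q' w = s * poly q x"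
    by (simp add: s_def l_def px algebra_simps)
qed

section \<open>Norms of polynomial expressions in the roots of a polynomial\<close>

text \<open>
  The companion matrix of \<open>f\<close>, multiplied by the leading coefficient \<open>coeff f m\<close> so that no
  division occurs. It is the matrix of multiplication by \<open>coeff f m \<cdot> X\<close> modulo \<open>f\<close>.
\<close>

definition scaled_companion :: "nat \<Rightarrow> 'a::comm_ring_1 poly \<Rightarrow> 'a mat" where
  "scaled_companion m f =
     mat m m (\<lambda>(i, j). if Suc j < m then (if i = Suc j then coeff f m else 0) else - coeff f i)"

text \<open>
  The Horner scheme for \<open>l\<^sup>E g(C / l)\<close> at a matrix \<open>C\<close>; the value is reached after \<open>E + 1\<close> steps.
\<close>

fun horner_mat :: "'a::comm_ring_1 mat \<Rightarrow> 'a \<Rightarrow> nat \<Rightarrow> nat \<Rightarrow> 'a poly \<Rightarrow> nat \<Rightarrow> 'a mat" where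
  "horner_mat C l m E g 0 = 0\<^sub>m m m"
| "horner_mat C l m E g (Suc k) = C * horner_mat C l m E g k + (l ^ k * coeff g (E - k)) \<cdot>\<^sub>m 1\<^sub>m m"

text \<open>
  The resultant of \<open>f\<close> and \<open>g\<close>, up to a power of the leading coefficient of \<open>f\<close>. It is a polynomial
  in the coefficients and is therefore compatible with ring homomorphisms.
\<close>

definition norm_det :: "nat \<Rightarrow> 'a::comm_ring_1 poly \<Rightarrow> nat \<Rightarrow> 'a poly \<Rightarrow> 'a" where
  "norm_det m f E g = det (horner_mat (scaled_companion m f) (coeff f m) m E g (Suc E))"

lemma scaled_companion_carrier [simp]: "scaled_companion m f \<in> carrier_mat m m"
  by (simp add: scaled_companion_def)

lemma horner_mat_carrier [simp]:
  assumes "C \<in> carrier_mat m m"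
  shows "horner_mat C l m E g k \<in> carrier_mat m m"
  using assms by (induction k) auto

lemma horner_mat_intertwine:
  assumes "C \<in> carrier_mat m m" "B \<in> carrier_mat m m" "N \<in> carrier_mat m m"
    and CN: "C * N = N * B"
  shows "horner_mat C l m E g k * N = N * horner_mat B l m E g k"
proof (induction k)
  case (Suc k)
  let ?H = "horner_mat C l m E g k" and ?H' = "horner_mat B l m E g k"
  let ?s = "l ^ k * coeff g (E - k)"
  have H: "?H \<in> carrier_mat m m" "?H' \<in> carrier_mat m m" using assms by auto
  have "horner_mat C l m E g (Suc k) * N = C * ?H * N + (?s \<cdot>\<^sub>m 1\<^sub>m m) * N"
    using assms H by (simp add: add_mult_distrib_mat[where nr = m and n = m and nc = m])
  also have "C * ?H * N = C * (N * ?H')"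
    using assms H Suc by (simp add: assoc_mult_mat[where n\<^sub>1 = m and n\<^sub>2 = m and n\<^sub>3 = m and n\<^sub>4 = m])
  also have "\<dots> = N * (B * ?H')"
    using assms H by (simp add: assoc_mult_mat[where n\<^sub>1 = m and n\<^sub>2 = m and n\<^sub>3 = m and n\<^sub>4 = m, symmetric] CN)
  also have "(?s \<cdot>\<^sub>m 1\<^sub>m m) * N = N * (?s \<cdot>\<^sub>m 1\<^sub>m m)"
    using assms by (simp add: mult_smult_distrib[where nr = m and n = m and nc = m]
        mult_smult_assoc_mat[where nr = m and n = m and nc = m])
  also have "N * (B * ?H') + N * (?s \<cdot>\<^sub>m 1\<^sub>m m) = N * horner_mat B l m E g (Suc k)"
    using assms H by (simp add: mult_add_distrib_mat[where nr = m and n = m and nc = m])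
  finally show ?case .
qed (use assms in auto)

text \<open>
  In the basis of these polynomials, multiplication by \<open>X\<close> modulo \<open>newton_poly w m\<close> is triangular.
\<close>

definition newton_poly :: "(nat \<Rightarrow> 'a::comm_ring_1) \<Rightarrow> nat \<Rightarrow> 'a poly" where
  "newton_poly w j = (\<Prod>i<j. [:- w i, 1:])"

lemma newton_poly_Suc: "newton_poly w (Suc j) = newton_poly w j * [:- w j, 1:]"
  by (simp add: newton_poly_def)

lemma coeff_newton_poly_Suc:
  "coeff (newton_poly w (Suc j)) i =
     (if i = 0 then 0 else coeff (newton_poly w j) (i - 1)) - w j * coeff (newton_poly w j) i"
  unfolding newton_poly_Suc by (cases i) (auto simp: algebra_simps)

lemma newton_poly_monic: "coeff (newton_poly w j) j = 1 \<and> (\<forall>i>j. coeff (newton_poly w j) i = 0)"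
proof (induction j)
  case 0
  then show ?case by (simp add: newton_poly_def)
next
  case (Suc j)
  then show ?case by (auto simp: coeff_newton_poly_Suc)
qed

text \<open>
  The matrix \<open>N\<close> of the Newton basis is unitriangular and transforms the companion matrix \<open>C\<close> to the
  lower bidiagonal matrix \<open>B\<close> with diagonal entries \<open>l w\<^sub>i\<close>. The determinant can be read off from the
  diagonal of the Horner scheme at \<open>B\<close>. Unlike a diagonalisation, this works for multiple roots.
\<close>

lemma norm_det_roots:
  fixes f g :: "'a::idom poly"
  assumes m: "m > 0" and f: "f = smult l (\<Prod>i<m. [:- w i, 1:])" and g: "degree g \<le> E"
  shows "norm_det m f E g = l ^ (E * m) * (\<Prod>i<m. poly g (w i))"
proof -
  let ?N = "\<lambda>j. newton_poly w j"
  have fN: "coeff f i = l * coeff (?N m) i" for i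
    by (simp add: f newton_poly_def)
  have lc: "coeff f m = l" using newton_poly_monic[of w m] by (simp add: fN)
  define C where "C = scaled_companion m f"
  define N where "N = mat m m (\<lambda>(i, j). coeff (?N j) i)"
  define B where "B = mat m m (\<lambda>(i, j). if i = j then l * w j else if i = Suc j then l else 0)"
  have C: "C \<in> carrier_mat m m" and N: "N \<in> carrier_mat m m" and B: "B \<in> carrier_mat m m"
    by (simp_all add: C_def N_def B_def)
  have CN: "C * N = N * B"
  proof (rule eq_matI)
    show "dim_row (C * N) = dim_row (N * B)" "dim_col (C * N) = dim_col (N * B)" using C N B by auto
    fix i j assume "i < dim_row (N * B)" "j < dim_col (N * B)"
    hence ij: "i < m" "j < m" using N B by auto
    have "(C * N) $$ (i, j) = (\<Sum>k<m. C $$ (i, k) * coeff (?N j) k)"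
      using ij C by (simp add: N_def scalar_prod_def lessThan_atLeast0)
    also have "\<dots> = (\<Sum>k\<in>insert (m - 1) {..<m - 1}. C $$ (i, k) * coeff (?N j) k)"
      using m by (intro sum.cong) auto
    also have "\<dots> = - coeff f i * coeff (?N j) (m - 1) + (\<Sum>k<m - 1. C $$ (i, k) * coeff (?N j) k)"
      using m ij by (simp add: C_def scaled_companion_def)
    also have "(\<Sum>k<m - 1. C $$ (i, k) * coeff (?N j) k) =
        (\<Sum>k<m - 1. if k = i - 1 then (if i = 0 then 0 else l * coeff (?N j) (i - 1)) else 0)"
      using ij by (intro sum.cong) (auto simp: C_def scaled_companion_def lc)
    also have "\<dots> = (if i = 0 then 0 else l * coeff (?N j) (i - 1))"
      using ij by (auto simp: sum.delta)
    finally have L: "(C * N) $$ (i, j) =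
      - coeff f i * coeff (?N j) (m - 1) + (if i = 0 then 0 else l * coeff (?N j) (i - 1))" .
    have "(N * B) $$ (i, j) = (\<Sum>k<m. coeff (?N k) i * B $$ (k, j))"
      using ij B by (simp add: N_def scalar_prod_def lessThan_atLeast0)
    also have "\<dots> = (\<Sum>k<m. (if k = j then coeff (?N j) i * (l * w j) else 0) +
        (if k = Suc j then coeff (?N (Suc j)) i * l else 0))"
      using ij by (intro sum.cong) (auto simp: B_def)
    also have "\<dots> = coeff (?N j) i * (l * w j) + (if Suc j < m then coeff (?N (Suc j)) i * l else 0)"
      using ij by (simp add: sum.distrib)
    finally have R: "(N * B) $$ (i, j) =
      coeff (?N j) i * (l * w j) + (if Suc j < m then coeff (?N (Suc j)) i * l else 0)" .
    show "(C * N) $$ (i, j) = (N * B) $$ (i, j)"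
    proof (cases "Suc j < m")
      case True
      hence "coeff (?N j) (m - 1) = 0" using newton_poly_monic[of w j] by simp
      then show ?thesis unfolding L R using True by (simp add: coeff_newton_poly_Suc algebra_simps)
    next
      case False
      with ij obtain c where c: "m = Suc c" "j = c" by (metis Suc_lessI less_antisym less_trans_Suc not_less_eq old.nat.exhaust)
      have 1: "coeff (?N c) c = 1" using newton_poly_monic[of w c] by simp
      show ?thesis unfolding L R fN unfolding c coeff_newton_poly_Suc
        by (simp add: 1 algebra_simps)
    qed
  qed
  have "upper_triangular N"
    unfolding upper_triangular_def using newton_poly_monic[of w] by (auto simp: N_def)
  hence "det N = prod_list (diag_mat N)" by (rule det_upper_triangular[OF _ N])
  also have "\<dots> = 1"
    unfolding prod_list_diag_prod using newton_poly_monic[of w] by (simp add: N_def)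
  finally have detN: "det N = 1" .
  define H where "H k = horner_mat B l m E g k" for k
  have Hc: "H k \<in> carrier_mat m m" for k using B by (simp add: H_def)
  have H0: "H 0 $$ (i, j) = 0" if "i < m" "j < m" for i j using that by (simp add: H_def)
  have HS: "H (Suc k) $$ (i, j) = l * w i * H k $$ (i, j) + (if i = 0 then 0 else l * H k $$ (i - 1, j))
      + (if i = j then l ^ k * coeff g (E - k) else 0)" if ij: "i < m" "j < m" for i j k
  proof -
    have "(B * H k) $$ (i, j) = (\<Sum>k'<m. B $$ (i, k') * H k $$ (k', j))"
      using ij B Hc[of k] by (simp add: scalar_prod_def lessThan_atLeast0)
    also have "\<dots> = (\<Sum>k'<m. (if k' = i then l * w i * H k $$ (i, j) else 0) +
        (if k' = i - 1 then (if i = 0 then 0 else l * H k $$ (i - 1, j)) else 0))"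
      using ij by (intro sum.cong) (auto simp: B_def)
    also have "\<dots> = l * w i * H k $$ (i, j) + (if i = 0 then 0 else l * H k $$ (i - 1, j))"
      using ij by (auto simp: sum.distrib)
    finally have *: "(B * H k) $$ (i, j) = l * w i * H k $$ (i, j) + (if i = 0 then 0 else l * H k $$ (i - 1, j))" .
    have "H (Suc k) = B * H k + (l ^ k * coeff g (E - k)) \<cdot>\<^sub>m 1\<^sub>m m" by (simp add: H_def)
    then have "H (Suc k) $$ (i, j) = (B * H k) $$ (i, j) + (l ^ k * coeff g (E - k)) * (if i = j then 1 else 0)"
      using ij B Hc[of k] by simp
    then show ?thesis unfolding * by simp
  qed
  have Hlow: "H k $$ (i, j) = 0" if "i < j" "j < m" for i j k
    using that by (induction k arbitrary: i) (auto simp: H0 HS)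
  have Hdiag: "k \<le> E \<Longrightarrow> H (Suc k) $$ (i, i) = l ^ k * (\<Sum>r\<le>k. coeff g (E - k + r) * w i ^ r)"
    if i: "i < m" for i k
  proof (induction k)
    case 0
    then show ?case using i Hlow[of "i - 1" i] by (simp add: HS H0)
  next
    case (Suc k)
    have e: "E - Suc k + Suc r = E - k + r" for r using Suc.prems by simp
    have "H (Suc (Suc k)) $$ (i, i) = l * w i * H (Suc k) $$ (i, i) + l ^ Suc k * coeff g (E - Suc k)"
      using i Hlow[of "i - 1" i "Suc k"] by (subst HS) auto
    also have "H (Suc k) $$ (i, i) = l ^ k * (\<Sum>r\<le>k. coeff g (E - k + r) * w i ^ r)"
      using Suc by simp
    also have "l * w i * (l ^ k * (\<Sum>r\<le>k. coeff g (E - k + r) * w i ^ r)) =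
        l ^ Suc k * (\<Sum>r\<le>k. coeff g (E - Suc k + Suc r) * w i ^ Suc r)"
      unfolding e by (simp add: sum_distrib_left algebra_simps)
    also have "l ^ Suc k * (\<Sum>r\<le>k. coeff g (E - Suc k + Suc r) * w i ^ Suc r) + l ^ Suc k * coeff g (E - Suc k)
       = l ^ Suc k * (\<Sum>r\<le>Suc k. coeff g (E - Suc k + r) * w i ^ r)"
      by (subst sum.atMost_Suc_shift) (simp add: algebra_simps)
    finally show ?case .
  qed
  have "det (H (Suc E)) = prod_list (diag_mat (H (Suc E)))"
    by (rule det_lower_triangular[OF _ Hc]) (use Hlow in auto)
  also have "\<dots> = (\<Prod>i<m. H (Suc E) $$ (i, i))"
    unfolding prod_list_diag_prod using Hc[of "Suc E"] by (simp add: lessThan_atLeast0)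
  also have "\<dots> = (\<Prod>i<m. l ^ E * poly g (w i))"
    using g by (intro prod.cong refl) (simp add: Hdiag poly_eq_sum_of_degree_le)
  also have "\<dots> = l ^ (E * m) * (\<Prod>i<m. poly g (w i))"
    by (simp add: prod.distrib power_mult)
  finally have detH: "det (H (Suc E)) = l ^ (E * m) * (\<Prod>i<m. poly g (w i))" .
  have "horner_mat C l m E g (Suc E) * N = N * H (Suc E)"
    unfolding H_def by (rule horner_mat_intertwine[OF C B N CN])
  hence "det (horner_mat C l m E g (Suc E)) * det N = det N * det (H (Suc E))"
    using det_mult[OF horner_mat_carrier[OF C] N] det_mult[OF N Hc] by metis
  then show ?thesis
    unfolding norm_det_def lc C_def[symmetric] detN detH by simp
qed

lemma norm_det_smult:
  fixes f g :: "'a::comm_ring_1 poly"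
  shows "norm_det m (smult s f) E (smult s g) = s ^ (Suc E * m) * norm_det m f E g"
proof -
  have C: "scaled_companion m (smult s f) = s \<cdot>\<^sub>m scaled_companion m f"
    by (rule eq_matI) (auto simp: scaled_companion_def)
  have H: "horner_mat (scaled_companion m (smult s f)) (coeff (smult s f) m) m E (smult s g) k =
      s ^ k \<cdot>\<^sub>m horner_mat (scaled_companion m f) (coeff f m) m E g k" for k
  proof (induction k)
    case (Suc k)
    let ?C = "scaled_companion m f" and ?H = "horner_mat (scaled_companion m f) (coeff f m) m E g k"
    have H: "?H \<in> carrier_mat m m" "?C \<in> carrier_mat m m" by auto
    have "(s \<cdot>\<^sub>m ?C) * (s ^ k \<cdot>\<^sub>m ?H) = (s * s ^ k) \<cdot>\<^sub>m (?C * ?H)"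
      using H by (simp add: mult_smult_distrib[where nr = m and n = m and nc = m]
         mult_smult_assoc_mat[where nr = m and n = m and nc = m]) (auto intro!: eq_matI simp: mult_ac)
    moreover have "((s * coeff f m) ^ k * (s * coeff g (E - k))) \<cdot>\<^sub>m 1\<^sub>m m =
        (s * s ^ k) \<cdot>\<^sub>m ((coeff f m ^ k * coeff g (E - k)) \<cdot>\<^sub>m 1\<^sub>m m)"
      by (rule eq_matI) (auto simp: power_mult_distrib mult_ac)
    ultimately show ?case
      using Suc add_smult_distrib_left_mat[OF mult_carrier_mat[OF H(2,1)],
          of "(coeff f m ^ k * coeff g (E - k)) \<cdot>\<^sub>m 1\<^sub>m m" "s * s ^ k"]
      by (simp add: C)
  qed (auto intro!: eq_matI)
  then show ?thesis
    unfolding norm_det_def H det_smult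
    by (simp add: carrier_matD(2)[OF horner_mat_carrier[OF scaled_companion_carrier]]
        del: horner_mat.simps power_Suc mult_Suc flip: power_mult)
qed

context comm_ring_hom
begin

lemma hom_scaled_companion: "map_mat hom (scaled_companion m f) = scaled_companion m (map_poly hom f)"
  by (rule eq_matI) (auto simp: scaled_companion_def hom_uminus)

lemma hom_horner_mat:
  assumes "C \<in> carrier_mat m m"
  shows "map_mat hom (horner_mat C l m E g k) = horner_mat (map_mat hom C) (hom l) m E (map_poly hom g) k"
proof (induction k)
  case (Suc k)
  have H: "horner_mat C l m E g k \<in> carrier_mat m m" using assms by simp
  have "map_mat hom (horner_mat C l m E g (Suc k)) =
     map_mat hom (C * horner_mat C l m E g k) + hom (l ^ k * coeff g (E - k)) \<cdot>\<^sub>m 1\<^sub>m m"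
    using carrier_matD[OF mult_carrier_mat[OF assms H]]
    by (intro eq_matI) (simp_all add: hom_add hom_mult del: index_mult_mat)
  also have "map_mat hom (C * horner_mat C l m E g k) = map_mat hom C * map_mat hom (horner_mat C l m E g k)"
    by (rule mat_hom_mult[OF assms H])
  finally show ?case using Suc by (simp add: hom_distribs)
qed (auto intro!: eq_matI)

lemma hom_norm_det: "hom (norm_det m f E g) = norm_det m (map_poly hom f) E (map_poly hom g)"
  unfolding norm_det_def
  by (simp only: hom_det[symmetric] hom_horner_mat[OF scaled_companion_carrier] hom_scaled_companion coeff_map_poly_hom)

lemma map_poly_hom_subst:
  "map_poly hom (hom_subst d p A B) = hom_subst d (map_poly hom p) (map_poly hom A) (map_poly hom B)"
proof -
  interpret mp: map_poly_comm_ring_hom hom ..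
  show ?thesis
    unfolding hom_subst_def by (simp add: mp.hom_sum mp.hom_mult mp.hom_power map_poly_hom_smult)
qed

end


section \<open>The multiplier form\<close>

definition coord_num :: "nat \<Rightarrow> (nat \<Rightarrow> 'a::comm_ring_1) \<Rightarrow> 'a poly" where
  "coord_num d x = (\<Sum>i\<le>d. monom (x i) i)"

definition coord_den :: "nat \<Rightarrow> (nat \<Rightarrow> 'a::comm_ring_1) \<Rightarrow> 'a poly" where
  "coord_den d x = (\<Sum>i\<le>d. monom (x (Suc d + i)) i)"

text \<open>
  The \<open>n\<close>-th iterate of the map with coordinates \<open>x\<close>, conjugated by \<open>1 / (t - X)\<close>, which moves \<open>t\<close> to
  \<open>\<infinity>\<close>. As long as \<open>t\<close> is not periodic of period \<open>n\<close>, all fixed points of the conjugate are finite and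
  the fixed point polynomial \<open>moved_fix\<close> has the full degree \<open>d\<^sup>n + 1\<close>.
\<close>

definition moved_num :: "nat \<Rightarrow> nat \<Rightarrow> (nat \<Rightarrow> 'a::comm_ring_1) \<Rightarrow> 'a \<Rightarrow> 'a poly" where
  "moved_num d n x t = conj_num 0 1 (- 1) t (d ^ n) (iter_num d (coord_num d x) (coord_den d x) n)
     (iter_den d (coord_num d x) (coord_den d x) n)"

definition moved_den :: "nat \<Rightarrow> nat \<Rightarrow> (nat \<Rightarrow> 'a::comm_ring_1) \<Rightarrow> 'a \<Rightarrow> 'a poly" where
  "moved_den d n x t = conj_den 0 1 (- 1) t (d ^ n) (iter_num d (coord_num d x) (coord_den d x) n)
     (iter_den d (coord_num d x) (coord_den d x) n)"

definition moved_fix :: "nat \<Rightarrow> nat \<Rightarrow> (nat \<Rightarrow> 'a::comm_ring_1) \<Rightarrow> 'a \<Rightarrow> 'a poly" where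
  "moved_fix d n x t = fix_poly (moved_num d n x t) (moved_den d n x t)"

text \<open>
  At a root of \<open>f\<close> the multiplier is \<open>1 + f' / q\<close>. The second factor is thus the product of
  \<open>q (u + \<lambda>)\<close> over the fixed points, up to a power of \<open>l\<close>. The first factor makes the form vanish when
  \<open>f\<close> and \<open>q\<close> have a common root, that is, on the degenerate coordinates, and the factors \<open>l\<close> make it
  vanish when \<open>t\<close> is a fixed point of the iterate.
\<close>

definition mult_form :: "nat \<Rightarrow> nat \<Rightarrow> (nat \<Rightarrow> 'a::idom) \<Rightarrow> 'a \<Rightarrow> 'a \<Rightarrow> 'a" where
  "mult_form d n x t u = (let f = moved_fix d n x t; q = moved_den d n x t; m = Suc (d ^ n); l = coeff f m
     in (l * norm_det m f (d ^ n) q) * (l * norm_det m f (d ^ n) (smult u q + q + pderiv f)))"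

lemma degree_coord:
  shows "degree (coord_num d x) \<le> d" and "degree (coord_den d x) \<le> d"
  unfolding coord_num_def coord_den_def
  by (auto intro!: degree_sum_le order_trans[OF degree_monom_le])

lemma coeff_coord:
  assumes "i \<le> d"
  shows "coeff (coord_num d x) i = x i" and "coeff (coord_den d x) i = x (Suc d + i)"
proof -
  have *: "coeff (\<Sum>j\<le>d. monom (f j) j) i = f i" for f :: "nat \<Rightarrow> 'a"
    using assms by (simp add: coeff_sum)
  show "coeff (coord_num d x) i = x i" "coeff (coord_den d x) i = x (Suc d + i)"
    unfolding coord_num_def coord_den_def * by simp_all
qed

lemma degree_moved:
  shows "degree (moved_num d n x t) \<le> d ^ n" "degree (moved_den d n x t) \<le> d ^ n"
    "degree (moved_fix d n x t) \<le> Suc (d ^ n)"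
  unfolding moved_num_def moved_den_def moved_fix_def
  by (intro degree_fix_poly degree_conj)+

lemma mult_form_roots:
  fixes x :: "nat \<Rightarrow> 'a::idom"
  assumes f: "moved_fix d n x t = smult l (\<Prod>i<Suc (d ^ n). [:- w i, 1:])"
  shows "mult_form d n x t u = (l * l ^ (d ^ n * Suc (d ^ n))) ^ 2 *
     ((\<Prod>i<Suc (d ^ n). poly (moved_den d n x t) (w i)) *
      (\<Prod>i<Suc (d ^ n). u * poly (moved_den d n x t) (w i) +
         (poly (moved_den d n x t) (w i) + poly (pderiv (moved_fix d n x t)) (w i))))"
proof -
  let ?q = "moved_den d n x t" and ?f = "moved_fix d n x t" and ?m = "Suc (d ^ n)"
  have lc: "coeff ?f ?m = l"
    using newton_poly_monic[of w ?m] unfolding f newton_poly_def by simp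
  have "degree (pderiv ?f) \<le> d ^ n"
    using degree_moved(3)[of d n x t] by (intro degree_le) (auto simp: coeff_pderiv coeff_eq_0)
  hence deg: "degree (smult u ?q + ?q + pderiv ?f) \<le> d ^ n"
    by (intro degree_add_le order_trans[OF degree_smult_le] degree_moved)
  have 1: "norm_det ?m ?f (d ^ n) ?q = l ^ (d ^ n * ?m) * (\<Prod>i<?m. poly ?q (w i))"
    by (rule norm_det_roots[OF _ f degree_moved(2)]) simp
  have 2: "norm_det ?m ?f (d ^ n) (smult u ?q + ?q + pderiv ?f) =
      l ^ (d ^ n * ?m) * (\<Prod>i<?m. poly (smult u ?q + ?q + pderiv ?f) (w i))"
    by (rule norm_det_roots[OF _ f deg]) simp
  show ?thesis
    unfolding mult_form_def Let_def lc 1 2 by (simp add: power2_eq_square mult_ac add_ac)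
qed

lemma hom_subst_scale:
  "hom_subst d (smult s p) (smult r A) (smult r B) = smult (s * r ^ d) (hom_subst d p A B)"
proof -
  have "smult (s * coeff p i) ((smult r A) ^ i * (smult r B) ^ (d - i)) =
     smult (s * r ^ d) (smult (coeff p i) (A ^ i * B ^ (d - i)))" if "i \<le> d" for i
  proof -
    have "r ^ d = r ^ i * r ^ (d - i)" using that by (simp flip: power_add)
    then show ?thesis by (simp add: smult_power mult_ac)
  qed
  then show ?thesis by (simp add: hom_subst_def smult_sum_right')
qed

lemma mult_form_scale: "\<exists>\<delta>. \<forall>x t u (s::'a::idom). mult_form d n (\<lambda>i. s * x i) t u = s ^ \<delta> * mult_form d n x t u"
proof -
  have num: "coord_num d (\<lambda>i. s * x i) = smult s (coord_num d x)"
    and den: "coord_den d (\<lambda>i. s * x i) = smult s (coord_den d x)" for s and x :: "nat \<Rightarrow> 'a"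
    by (simp_all add: coord_num_def coord_den_def smult_sum_right' smult_monom)
  have "\<exists>r. \<forall>(s::'a) p q. iter_num d (smult s p) (smult s q) n = smult (s ^ r) (iter_num d p q n) \<and>
      iter_den d (smult s p) (smult s q) n = smult (s ^ r) (iter_den d p q n)"
  proof (induction n)
    case 0
    then show ?case by (intro exI[of _ 0]) simp
  next
    case (Suc n)
    then obtain r where r: "iter_num d (smult s p) (smult s q) n = smult (s ^ r) (iter_num d p q n)"
      "iter_den d (smult s p) (smult s q) n = smult (s ^ r) (iter_den d p q n)" for s :: 'a and p q by blast
    show ?case
      by (intro exI[of _ "1 + r * d"]) (simp add: r hom_subst_scale power_mult)
  qed
  then obtain r where r: "iter_num d (smult s p) (smult s q) n = smult (s ^ r) (iter_num d p q n)"
      "iter_den d (smult s p) (smult s q) n = smult (s ^ r) (iter_den d p q n)" for s :: 'a and p q by blast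
  have scale: "conj_num a b c e m (smult s p) (smult s q) = smult s (conj_num a b c e m p q)"
    "conj_den a b c e m (smult s p) (smult s q) = smult s (conj_den a b c e m p q)" for a b c e m and s :: 'a and p q
    by (simp_all add: conj_num_def conj_den_def hom_subst_smult smult_add_right mult_ac)
  have f: "fix_poly (smult s p) (smult s q) = smult s (fix_poly p q)" for s :: 'a and p q
    by (simp add: fix_poly_def smult_diff_right)
  have *: "moved_den d n (\<lambda>i. s * x i) t = smult (s ^ r) (moved_den d n x t)"
      "moved_fix d n (\<lambda>i. s * x i) t = smult (s ^ r) (moved_fix d n x t)" for s :: 'a and x t
    unfolding moved_den_def moved_num_def moved_fix_def num den r scale f by simp_all
  have "smult u (smult s q) + smult s q + pderiv (smult s f) = smult s (smult u q + q + pderiv f)" for u s :: 'a and q f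
    by (simp add: smult_add_right pderiv_smult mult_ac)
  note lin = this
  define K where "K = Suc (d ^ n) * Suc (d ^ n)"
  have "mult_form d n (\<lambda>i. s * x i) t u = s ^ (r * (2 + (K + K))) * mult_form d n x t u" for x t u and s :: 'a
    unfolding mult_form_def Let_def * lin norm_det_smult K_def[symmetric] power_mult
    by (simp add: power_add power2_eq_square mult_ac)
  then show ?thesis by blast
qed

context idom_hom
begin

lemma hom_mult_form: "hom (mult_form d n x t u) = mult_form d n (\<lambda>i. hom (x i)) (hom t) (hom u)"
proof -
  interpret mp: map_poly_idom_hom hom ..
  have num: "map_poly hom (coord_num d x) = coord_num d (\<lambda>i. hom (x i))"
    and den: "map_poly hom (coord_den d x) = coord_den d (\<lambda>i. hom (x i))"
    by (simp_all add: coord_num_def coord_den_def mp.hom_sum)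
  have it: "map_poly hom (iter_num d p q n) = iter_num d (map_poly hom p) (map_poly hom q) n \<and>
     map_poly hom (iter_den d p q n) = iter_den d (map_poly hom p) (map_poly hom q) n" for p q
    by (induction n) (simp_all add: map_poly_hom_subst)
  have cj: "map_poly hom (conj_num a b c e m p q) = conj_num (hom a) (hom b) (hom c) (hom e) m (map_poly hom p) (map_poly hom q)"
    "map_poly hom (conj_den a b c e m p q) = conj_den (hom a) (hom b) (hom c) (hom e) m (map_poly hom p) (map_poly hom q)"
    for a b c e m p q
    by (simp_all add: conj_num_def conj_den_def map_poly_hom_subst mp.hom_add map_poly_hom_smult hom_uminus
        map_poly_pCons_hom)
  have m: "map_poly hom (moved_num d n x t) = moved_num d n (\<lambda>i. hom (x i)) (hom t)"
    "map_poly hom (moved_den d n x t) = moved_den d n (\<lambda>i. hom (x i)) (hom t)"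
    by (simp_all add: moved_num_def moved_den_def cj num den it hom_uminus)
  have f: "map_poly hom (moved_fix d n x t) = moved_fix d n (\<lambda>i. hom (x i)) (hom t)"
    by (simp add: moved_fix_def fix_poly_def m mp.hom_minus map_poly_pCons_hom)
  show ?thesis
    unfolding mult_form_def Let_def
    by (simp add: hom_mult hom_norm_det f m mp.hom_add map_poly_hom_smult map_poly_pderiv flip: coeff_map_poly_hom)
qed

end

section \<open>Rational functions and pairs of polynomials\<close>

text \<open>
  The pairs that represent a morphism of degree \<open>d\<close>: the last two conditions exclude a common zero
  at \<open>\<infinity>\<close> and at finite points.
\<close>

definition is_map :: "nat \<Rightarrow> 'a::field poly \<Rightarrow> 'a poly \<Rightarrow> bool" where
  "is_map d p q \<longleftrightarrow> degree p \<le> d \<and> degree q \<le> d \<and> (coeff p d \<noteq> 0 \<or> coeff q d \<noteq> 0) \<and>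
     (\<forall>x. poly p x \<noteq> 0 \<or> poly q x \<noteq> 0)"

lemma is_map_hom_eval:
  assumes "is_map d p q" "a \<noteq> 0 \<or> b \<noteq> 0"
  shows "hom_eval d p a b \<noteq> 0 \<or> hom_eval d q a b \<noteq> 0"
proof (cases "b = 0")
  case True
  then show ?thesis using assms by (auto simp: is_map_def hom_eval_infinity)
next
  case False
  have "hom_eval d p (a / b * b) b = b ^ d * poly p (a / b)"
    "hom_eval d q (a / b * b) b = b ^ d * poly q (a / b)"
    using assms(1) by (simp_all only: is_map_def hom_eval_unit)
  then show ?thesis using assms False by (auto simp: is_map_def)
qed

lemma is_map_hom_subst:
  assumes "is_map d p q" "is_map e A B"
  shows "is_map (d * e) (hom_subst d p A B) (hom_subst d q A B)"
proof -
  have deg: "degree A \<le> e" "degree B \<le> e" using assms by (auto simp: is_map_def)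
  show ?thesis
    unfolding is_map_def poly_hom_subst coeff_hom_subst_top[OF deg]
    using degree_hom_subst[OF deg] is_map_hom_eval[OF assms(1)] assms(2)
    by (auto simp: is_map_def)
qed

lemma is_map_linear:
  assumes "a * e - b * c \<noteq> (0::'a::field)"
  shows "is_map 1 [:b, a:] [:e, c:]"
proof -
  have "a * (e + x * c) - c * (b + x * a) = a * e - b * c" for x by (simp add: algebra_simps)
  moreover have "e * (b + x * a) - b * (e + x * c) = x * (a * e - b * c)" for x by (simp add: algebra_simps)
  ultimately have "b + x * a \<noteq> 0 \<or> e + x * c \<noteq> 0" for x using assms by (metis diff_self mult_zero_right)
  then show ?thesis using assms by (auto simp: is_map_def)
qed

lemma is_map_conj:
  assumes "is_map d p q" "a * e - b * c \<noteq> 0"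
  shows "is_map d (conj_num a b c e d p q) (conj_den a b c e d p q)"
proof -
  have "is_map 1 [:- b, e:] [:a, - c:]"
    using is_map_linear[of e a "- b" "- c"] assms(2) by (simp add: algebra_simps)
  from is_map_hom_subst[OF assms(1) this]
  have "is_map (d * 1) (hom_subst d p [:- b, e:] [:a, - c:]) (hom_subst d q [:- b, e:] [:a, - c:])" .
  from is_map_hom_subst[OF is_map_linear[OF assms(2)] this]
  show ?thesis unfolding hom_subst_linear conj_num_def conj_den_def by (simp add: algebra_simps)
qed

lemma is_map_iter:
  assumes "is_map d p q"
  shows "is_map (d ^ n) (iter_num d p q n) (iter_den d p q n)"
proof (induction n)
  case 0
  then show ?case by (simp add: is_map_def)
next
  case (Suc n)
  then show ?case using is_map_hom_subst[OF assms Suc] by simp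
qed

lemma is_map_smult: "is_map d p q \<Longrightarrow> c \<noteq> 0 \<Longrightarrow> is_map d (smult c p) (smult c q)"
  by (simp add: is_map_def)

context
  fixes d :: nat and p q :: "'a::{alg_closed_field, field_gcd} poly"
  assumes map: "is_map d p q" and d: "d \<ge> 1"
begin

lemma is_map_den_nonzero: "q \<noteq> 0"
proof
  assume "q = 0"
  hence "\<nexists>x. poly p x = 0" "coeff p d \<noteq> 0" using map by (auto simp: is_map_def)
  hence "degree p = 0" using alg_closed_imp_poly_has_root by auto
  with \<open>coeff p d \<noteq> 0\<close> d show False by (simp add: coeff_eq_0)
qed

lemma is_map_coprime: "coprime p q"
proof (rule coprimeI)
  fix c assume c: "c dvd p" "c dvd q"
  have "c \<noteq> 0" using c is_map_den_nonzero by auto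
  have "\<nexists>x. poly c x = 0"
    using c map by (auto simp: is_map_def elim!: dvdE)
  hence "degree c = 0" using alg_closed_imp_poly_has_root by auto
  with \<open>c \<noteq> 0\<close> show "is_unit c" by (simp add: is_unit_iff_degree)
qed

lemma rf_num_den_Fract:
  obtains c where "c \<noteq> 0" "rf_num (Fract p q) = smult c p" "rf_den (Fract p q) = smult c q"
proof -
  define a where "a = rf_num (Fract p q)"
  define b where "b = rf_den (Fract p q)"
  have b: "b \<noteq> 0" by (simp add: b_def rf_den_def)
  have "Fract a b = Fract p q" unfolding a_def b_def rf_num_def rf_den_def by simp
  hence eq: "a * q = p * b" using b is_map_den_nonzero by (simp add: eq_fract)
  have ab: "coprime a b"
    unfolding a_def b_def rf_num_def rf_den_def by (rule coprime_quot_of_fract)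
  have "q dvd p * b" using eq by (metis dvd_triv_right)
  hence "q dvd b" using is_map_coprime by (metis coprime_commute coprime_dvd_mult_right_iff)
  moreover have "b dvd a * q" using eq by (metis dvd_triv_right)
  hence "b dvd q" using ab by (metis coprime_commute coprime_dvd_mult_right_iff)
  ultimately obtain k l where k: "b = q * k" and l: "q = b * l" by (elim dvdE)
  have "q * (k * l) = q * 1" using k l by (metis mult.assoc mult.right_neutral)
  hence kl: "k * l = 1" using is_map_den_nonzero by (metis mult_left_cancel)
  hence k0: "k \<noteq> 0" "l \<noteq> 0" by auto
  have "degree (k * l) = 0" using kl by simp
  hence "degree k = 0" using k0 by (simp add: degree_mult_eq)
  then obtain c where "k = [:c:]" by (rule degree_eq_zeroE)
  with k k0 have c: "b = smult c q" "c \<noteq> 0" by auto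
  have "a * q = smult c p * q" using eq c by simp
  hence "a = smult c p" using is_map_den_nonzero mult_right_cancel by blast
  with c show ?thesis using that unfolding a_def b_def by blast
qed

lemma Fract_in_Rat: "Fract p q \<in> Rat d"
proof -
  obtain c where "c \<noteq> 0" "rf_num (Fract p q) = smult c p" "rf_den (Fract p q) = smult c q"
    by (rule rf_num_den_Fract)
  moreover have "max (degree p) (degree q) = d"
    using map le_degree[of p d] le_degree[of q d] unfolding is_map_def by linarith
  ultimately show ?thesis by (simp add: Rat_def rf_degree_def)
qed

lemma rf_subst_Fract:
  fixes r :: "'a poly"
  assumes "degree r \<le> m" "B \<noteq> 0"
  shows "rf_subst r (Fract A B) = to_fract (hom_subst m r A B) / to_fract B ^ m"
proof -
  have tp: "to_fract (x ^ i) = to_fract x ^ i" for x :: "'a poly" and i by (induction i) auto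
  have deg: "degree (map_poly (\<lambda>c. to_fract [:c:]) r) \<le> m"
    using assms(1) degree_map_poly_le order_trans by blast
  have "rf_subst r (Fract A B) = (\<Sum>i\<le>m. to_fract [:coeff r i:] * (to_fract A / to_fract B) ^ i)"
    unfolding rf_subst_def poly_eq_sum_of_degree_le[OF deg]
    by (simp add: coeff_map_poly Fract_conv_to_fract)
  also have "\<dots> = (\<Sum>i\<le>m. to_fract (smult (coeff r i) (A ^ i * B ^ (m - i))) / to_fract B ^ m)"
  proof (intro sum.cong refl)
    fix i assume "i \<in> {..m}"
    hence "to_fract B ^ m = to_fract B ^ i * to_fract B ^ (m - i)" by (simp flip: power_add)
    moreover have "to_fract (smult (coeff r i) (A ^ i * B ^ (m - i))) = to_fract ([:coeff r i:] * (A ^ i * B ^ (m - i)))"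
      by simp
    ultimately show "to_fract [:coeff r i:] * (to_fract A / to_fract B) ^ i =
        to_fract (smult (coeff r i) (A ^ i * B ^ (m - i))) / to_fract B ^ m"
      using assms(2) by (simp add: tp power_divide field_simps del: mult_pCons_left)
  qed
  finally show ?thesis by (simp add: hom_subst_def sum_divide_distrib)
qed

text \<open>
  Both substitutions have the denominator \<open>B\<^sup>d\<close>, which cancels. The remaining denominator is
  nonzero because the substituted pair has no common zero.
\<close>

lemma rf_comp_Fract:
  assumes AB: "is_map e A B" and e: "e \<ge> 1"
  shows "rf_comp (Fract p q) (Fract A B) = Fract (hom_subst d p A B) (hom_subst d q A B)"
proof -
  obtain c where c: "c \<noteq> 0" "rf_num (Fract p q) = smult c p" "rf_den (Fract p q) = smult c q"
    by (rule rf_num_den_Fract)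
  have B: "B \<noteq> 0"
  proof
    assume "B = 0"
    hence "\<nexists>x. poly A x = 0" "coeff A e \<noteq> 0" using AB by (auto simp: is_map_def)
    hence "degree A = 0" using alg_closed_imp_poly_has_root by auto
    with \<open>coeff A e \<noteq> 0\<close> e show False by (simp add: coeff_eq_0)
  qed
  have deg: "degree (smult c p) \<le> d" "degree (smult c q) \<le> d" using map by (auto simp: is_map_def)
  have *: "to_fract (smult c x) = to_fract [:c:] * to_fract x" for x :: "'a poly"
    by (simp flip: to_fract_mult)
  show ?thesis
    unfolding rf_comp_def c rf_subst_Fract[OF deg(1) B] rf_subst_Fract[OF deg(2) B]
    using c(1) B by (simp add: hom_subst_smult * Fract_conv_to_fract)
qed

end

lemma is_map_rf:
  assumes "\<phi> \<in> Rat d" "d \<ge> 1"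
  shows "is_map d (rf_num \<phi>) (rf_den \<phi>)" and "\<phi> = Fract (rf_num \<phi>) (rf_den \<phi>)"
proof -
  show "\<phi> = Fract (rf_num \<phi>) (rf_den \<phi>)" by (simp add: rf_num_def rf_den_def)
  have cop: "coprime (rf_num \<phi>) (rf_den \<phi>)" unfolding rf_num_def rf_den_def by (rule coprime_quot_of_fract)
  have max: "max (degree (rf_num \<phi>)) (degree (rf_den \<phi>)) = d" using assms(1) by (simp add: Rat_def rf_degree_def)
  have den: "rf_den \<phi> \<noteq> 0" by (simp add: rf_den_def)
  have "coeff (rf_num \<phi>) d \<noteq> 0 \<or> coeff (rf_den \<phi>) d \<noteq> 0"
    using max den assms(2) by (metis degree_0 leading_coeff_0_iff max_def not_one_le_zero)
  moreover have "poly (rf_num \<phi>) x \<noteq> 0 \<or> poly (rf_den \<phi>) x \<noteq> 0" for x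
    using cop by (metis coprime_poly_0)
  ultimately show "is_map d (rf_num \<phi>) (rf_den \<phi>)" using max by (auto simp: is_map_def)
qed

lemma rf_conj_Fract:
  fixes p q :: "'a::{alg_closed_field, field_gcd} poly"
  assumes "is_map d p q" "d \<ge> 1" "a * e - b * c \<noteq> 0"
  shows "rf_conj a b c e (Fract p q) = Fract (conj_num a b c e d p q) (conj_den a b c e d p q)"
proof -
  have adj: "is_map 1 [:- b, e:] [:a, - c:]"
    using is_map_linear[of e a "- b" "- c"] assms(3) by (simp add: algebra_simps)
  have 1: "rf_comp (Fract p q) (moebius e (- b) (- c) a) =
      Fract (hom_subst d p [:- b, e:] [:a, - c:]) (hom_subst d q [:- b, e:] [:a, - c:])"
    unfolding moebius_def by (rule rf_comp_Fract[OF assms(1,2) adj]) simp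
  have "is_map d (hom_subst d p [:- b, e:] [:a, - c:]) (hom_subst d q [:- b, e:] [:a, - c:])"
    using is_map_hom_subst[OF assms(1) adj] by simp
  from rf_comp_Fract[OF is_map_linear[OF assms(3)] order_refl this assms(2)]
  show ?thesis
    unfolding rf_conj_def 1 unfolding moebius_def hom_subst_linear conj_num_def conj_den_def
    by (simp add: algebra_simps)
qed

lemma rf_iter_Fract:
  fixes p q :: "'a::{alg_closed_field, field_gcd} poly"
  assumes "is_map d p q" "d \<ge> 1"
  shows "rf_iter n (Fract p q) = Fract (iter_num d p q n) (iter_den d p q n)"
proof (induction n)
  case 0
  then show ?case by (simp add: rf_iter_def rf_X_def Fract_conv_to_fract)
next
  case (Suc n)
  have "d ^ n \<ge> 1" using assms(2) by simp
  from rf_comp_Fract[OF assms is_map_iter[OF assms(1), of n] this] show ?case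
    using Suc by (simp add: rf_iter_def)
qed

lemma rf_conj_scale:
  fixes \<phi> :: "'a::{alg_closed_field, field_gcd} poly fract"
  assumes "\<phi> \<in> Rat d" "d \<ge> 1" "a * e - b * c \<noteq> 0" "s \<noteq> 0"
  shows "rf_conj (s * a) (s * b) (s * c) (s * e) \<phi> = rf_conj a b c e \<phi>"
proof -
  define p where "p = rf_num \<phi>"
  define q where "q = rf_den \<phi>"
  have pq: "is_map d p q" "\<phi> = Fract p q" unfolding p_def q_def by (rule is_map_rf[OF assms(1,2)])+
  have *: "hom_subst d f [:- (s * b), s * e:] [:s * a, - (s * c):] =
      smult (s ^ d) (hom_subst d f [:- b, e:] [:a, - c:])" for f
    using hom_subst_scale[of d 1 f s "[:- b, e:]" "[:a, - c:]"] by simp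
  have **: "conj_num (s * a) (s * b) (s * c) (s * e) d p q = smult (s ^ Suc d) (conj_num a b c e d p q)"
     "conj_den (s * a) (s * b) (s * c) (s * e) d p q = smult (s ^ Suc d) (conj_den a b c e d p q)"
    unfolding conj_num_def conj_den_def * by (simp_all add: smult_add_right mult_ac)
  have det: "s * a * (s * e) - s * b * (s * c) \<noteq> 0"
  proof -
    have "s * a * (s * e) - s * b * (s * c) = s * s * (a * e - b * c)" by (simp add: algebra_simps)
    then show ?thesis using assms by simp
  qed
  have sm: "Fract (smult k x) (smult k y) = Fract x y" if "k \<noteq> 0" "y \<noteq> 0" for k and x y :: "'a poly"
    using that by (simp add: eq_fract)
  have "conj_den a b c e d p q \<noteq> 0"
    by (rule is_map_den_nonzero[OF is_map_conj[OF pq(1) assms(3)] assms(2)])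
  then show ?thesis
    unfolding pq(2) rf_conj_Fract[OF pq(1) assms(2) det] rf_conj_Fract[OF pq(1) assms(2,3)] **
    using assms(4) by (intro sm) auto
qed

text \<open>
  The conjugations of pairs compose without any correction factor, and every element of
  \<open>Rat d\<close> comes from a pair.
\<close>

lemma rf_conj_rf_conj:
  fixes \<phi> :: "'a::{alg_closed_field, field_gcd} poly fract"
  assumes "\<phi> \<in> Rat d" "d \<ge> 1" "a * e - b * c \<noteq> 0" "a' * e' - b' * c' \<noteq> 0"
  shows "rf_conj a' b' c' e' (rf_conj a b c e \<phi>) =
      rf_conj (a' * a + b' * c) (a' * b + b' * e) (c' * a + e' * c) (c' * b + e' * e) \<phi>"
proof -
  define p where "p = rf_num \<phi>"
  define q where "q = rf_den \<phi>"
  have pq: "is_map d p q" "\<phi> = Fract p q" unfolding p_def q_def by (rule is_map_rf[OF assms(1,2)])+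
  have "(a' * a + b' * c) * (c' * b + e' * e) - (a' * b + b' * e) * (c' * a + e' * c) =
     (a' * e' - b' * c') * (a * e - b * c)" by (simp add: algebra_simps)
  hence det: "(a' * a + b' * c) * (c' * b + e' * e) - (a' * b + b' * e) * (c' * a + e' * c) \<noteq> 0"
    using assms by simp
  show ?thesis
    unfolding pq(2) rf_conj_Fract[OF pq(1) assms(2,3)] rf_conj_Fract[OF pq(1) assms(2) det]
      rf_conj_Fract[OF is_map_conj[OF pq(1) assms(3)] assms(2,4)] conj_conj ..
qed

lemma rf_conj_id:
  fixes \<phi> :: "'a::{alg_closed_field, field_gcd} poly fract"
  assumes "\<phi> \<in> Rat d" "d \<ge> 1"
  shows "rf_conj 1 0 0 1 \<phi> = \<phi>"
proof -
  define p where "p = rf_num \<phi>"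
  define q where "q = rf_den \<phi>"
  have pq: "is_map d p q" "\<phi> = Fract p q" unfolding p_def q_def by (rule is_map_rf[OF assms(1,2)])+
  have deg: "degree p \<le> d" "degree q \<le> d" using pq by (auto simp: is_map_def)
  show ?thesis
    unfolding pq(2) using rf_conj_Fract[OF pq(1) assms(2), of 1 1 0 0] hom_subst_X_one[OF deg(1)] hom_subst_X_one[OF deg(2)]
    by (simp add: conj_num_def conj_den_def flip: one_pCons)
qed

lemma equiv_conj_rel:
  assumes "d \<ge> 1"
  shows "equiv (Rat d) (conj_rel d :: ('a::{alg_closed_field, field_gcd} poly fract \<times> _) set)"
proof (rule equivI)
  show "conj_rel d \<subseteq> Rat d \<times> Rat d" by (auto simp: conj_rel_def)
  show "refl_on (Rat d) (conj_rel d :: ('a poly fract \<times> _) set)"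
  proof (rule refl_onI)
    fix \<phi> :: "'a poly fract" assume \<phi>: "\<phi> \<in> Rat d"
    have "\<exists>a b c e. a * e - b * c \<noteq> 0 \<and> \<phi> = rf_conj a b c e \<phi>"
      by (rule exI[of _ 1], rule exI[of _ 0], rule exI[of _ 0], rule exI[of _ 1])
        (simp add: rf_conj_id[OF \<phi> assms])
    with \<phi> show "(\<phi>, \<phi>) \<in> conj_rel d" by (simp add: conj_rel_def)
  qed
  show "sym (conj_rel d :: ('a poly fract \<times> _) set)"
  proof (rule symI)
    fix \<phi> \<psi> :: "'a poly fract" assume "(\<phi>, \<psi>) \<in> conj_rel d"
    then obtain a b c e where *: "\<phi> \<in> Rat d" "\<psi> \<in> Rat d" "a * e - b * c \<noteq> 0" "\<psi> = rf_conj a b c e \<phi>"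
      by (auto simp: conj_rel_def)
    have det: "e * a - (- b) * (- c) \<noteq> 0" using *(3) by (simp add: algebra_simps)
    have "rf_conj e (- b) (- c) a \<psi> = rf_conj (a * e - b * c) 0 0 (a * e - b * c) \<phi>"
      unfolding *(4) rf_conj_rf_conj[OF *(1) assms *(3) det] by (simp add: algebra_simps)
    also have "\<dots> = \<phi>"
      using rf_conj_scale[OF *(1) assms, of 1 1 0 0 "a * e - b * c"] *(3) rf_conj_id[OF *(1) assms] by simp
    finally have "\<phi> = rf_conj e (- b) (- c) a \<psi>" ..
    then show "(\<psi>, \<phi>) \<in> conj_rel d" using *(1,2) det unfolding conj_rel_def by blast
  qed
  show "trans (conj_rel d :: ('a poly fract \<times> _) set)"
  proof (rule transI)
    fix \<phi> \<psi> \<chi> :: "'a poly fract" assume "(\<phi>, \<psi>) \<in> conj_rel d" "(\<psi>, \<chi>) \<in> conj_rel d"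
    then obtain a b c e a' b' c' e' where *: "\<phi> \<in> Rat d" "\<chi> \<in> Rat d" "a * e - b * c \<noteq> 0" "a' * e' - b' * c' \<noteq> 0"
        "\<chi> = rf_conj a' b' c' e' (rf_conj a b c e \<phi>)"
      by (auto simp: conj_rel_def)
    have "(a' * a + b' * c) * (c' * b + e' * e) - (a' * b + b' * e) * (c' * a + e' * c) =
       (a' * e' - b' * c') * (a * e - b * c)" by (simp add: algebra_simps)
    then have "(a' * a + b' * c) * (c' * b + e' * e) - (a' * b + b' * e) * (c' * a + e' * c) \<noteq> 0" using * by simp
    then show "(\<phi>, \<chi>) \<in> conj_rel d"
      using * rf_conj_rf_conj[OF *(1) assms *(3,4)] unfolding conj_rel_def by blast
  qed
qed

section \<open>The multiplier spectrum\<close>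

definition spectrum :: "'a::field_gcd poly fract \<Rightarrow> 'a multiset" where
  "spectrum \<phi> = image_mset (multiplier \<phi>) (fixpoints \<phi>)"

lemma proots_linear: "v \<noteq> 0 \<Longrightarrow> proots [:u, v:] = {#- u / v#}" for u v :: "'a::field"
proof -
  assume "v \<noteq> 0"
  hence "[:u, v:] = smult v [:u / v, 1:]" by simp
  then have "proots [:u, v:] = proots (smult v [:u / v, 1:])" by simp
  also have "\<dots> = {#- (u / v)#}" unfolding proots_smult[OF \<open>v \<noteq> 0\<close>] by (rule proots_linear_factor)
  finally show ?thesis by simp
qed

lemma proots_prod_linear: "proots (\<Prod>z\<in>#A. [:- z, 1:]) = A" for A :: "'a::idom multiset"
proof (induction A)
  case (add z A)
  have "(\<Prod>z\<in>#A. [:- z, 1:]) \<noteq> 0" by (induction A) (simp_all del: mult_pCons_left)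
  then have "proots ([:- z, 1:] * (\<Prod>z\<in>#A. [:- z, 1:])) = add_mset z A"
    using add by (subst proots_mult) auto
  then show ?case by (simp del: mult_pCons_left)
qed simp

lemma hom_subst_prod_mset:
  "hom_subst (size A) (\<Prod>z\<in>#A. [:- z, 1:]) L M = (\<Prod>z\<in>#A. L - smult z M)" for L M :: "'a::idom poly"
proof (induction A)
  case (add z A)
  have "degree (\<Prod>z\<in>#A. [:- z, 1:]) \<le> size A"
    by (induction A) (auto intro!: order_trans[OF degree_mult_le] simp del: mult_pCons_left)
  hence "hom_subst (1 + size A) ([:- z, 1:] * (\<Prod>z\<in>#A. [:- z, 1:])) L M =
      hom_subst 1 [:- z, 1:] L M * hom_subst (size A) (\<Prod>z\<in>#A. [:- z, 1:]) L M"
    by (intro hom_subst_mult) auto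
  then show ?case using add by (simp add: hom_subst_linear plus_1_eq_Suc del: mult_pCons_left One_nat_def)
qed (simp add: hom_subst_0_one)

text \<open>
  The homogeneous factorisation of \<open>f\<close> has the roots of \<open>f\<close> and, with multiplicity
  \<open>m - degree f\<close>, the point \<open>\<infinity>\<close>. Linear substitution turns the latter into powers of \<open>M\<close>.
\<close>

lemma hom_subst_full_factors:
  fixes f :: "'a::alg_closed_field poly"
  assumes f: "f \<noteq> 0" and deg: "degree f \<le> m"
  shows "hom_subst m f L M = smult (lead_coeff f) ((\<Prod>z\<in>#proots f. L - smult z M) * M ^ (m - degree f))"
    and "size (proots f) = degree f"
proof -
  obtain A where A: "size A = degree f" "f = smult (lead_coeff f) (\<Prod>z\<in>#A. [:- z, 1:])"
    using alg_closed_imp_factorization[OF f] by blast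
  have "proots f = proots (\<Prod>z\<in>#A. [:- z, 1:])"
    using f by (subst A(2)) simp
  also have "\<dots> = A" by (rule proots_prod_linear)
  finally have pA: "proots f = A" .
  show "size (proots f) = degree f" by (simp add: pA A(1))
  have "hom_subst (m - degree f) 1 L M = M ^ (m - degree f)"
    using hom_subst_monom[of 0 "m - degree f" 1 L M] by (simp add: monom_eq_1)
  moreover have "hom_subst (degree f + (m - degree f)) (f * 1) L M = hom_subst (degree f) f L M * hom_subst (m - degree f) 1 L M"
    by (intro hom_subst_mult) auto
  ultimately have "hom_subst m f L M = hom_subst (degree f) f L M * M ^ (m - degree f)"
    using deg by simp
  also have "hom_subst (degree f) f L M = smult (lead_coeff f) (hom_subst (size A) (\<Prod>z\<in>#A. [:- z, 1:]) L M)"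
    using hom_subst_smult[of "degree f" "lead_coeff f" "\<Prod>z\<in>#A. [:- z, 1:]" L M]
    unfolding A(1) A(2)[symmetric] .
  finally show "hom_subst m f L M = smult (lead_coeff f) ((\<Prod>z\<in>#proots f. L - smult z M) * M ^ (m - degree f))"
    by (simp add: hom_subst_prod_mset pA)
qed

text \<open>
  Differentiate \<open>f = p - X q\<close> and use \<open>p = z q\<close> at the fixed point.
\<close>

lemma rf_deriv_at_fixed:
  fixes p q :: "'a::{alg_closed_field, field_gcd} poly"
  assumes map: "is_map d p q" "d \<ge> 1" and z: "poly (fix_poly p q) z = 0"
  shows "poly q z \<noteq> 0" and "rf_deriv_at (Fract p q) z = 1 + poly (pderiv (fix_poly p q)) z / poly q z"
proof -
  have pz: "poly p z = z * poly q z" using z by (simp add: fix_poly_def)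
  show q: "poly q z \<noteq> 0" using map(1) pz unfolding is_map_def by (metis mult_zero_right)
  obtain c where c: "c \<noteq> 0" "rf_num (Fract p q) = smult c p" "rf_den (Fract p q) = smult c q"
    by (rule rf_num_den_Fract[OF map])
  show "rf_deriv_at (Fract p q) z = 1 + poly (pderiv (fix_poly p q)) z / poly q z"
    using c(1) q unfolding rf_deriv_at_def c Let_def fix_poly_def
    by (simp add: pderiv_smult pderiv_diff pderiv_pCons pz field_simps power2_eq_square)
qed

text \<open>
  The right hand side does not mention the matrix. Hence every conjugation that moves \<open>\<infinity>\<close> to a
  finite point gives the same multiplier there; in particular this applies to the conjugation by
  \<open>1 / X\<close> that defines the multiplier at \<open>\<infinity>\<close>.
\<close>

lemma derivative_at_image_of_infinity:
  fixes a b c e :: "'a::field"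
  assumes deg: "degree p \<le> d" "degree q \<le> d" and d: "d \<ge> 1"
    and c: "c \<noteq> 0" and det: "a * e - b * c \<noteq> 0"
    and inf: "coeff (fix_poly p q) (Suc d) = 0" and top: "coeff p d \<noteq> 0 \<or> coeff q d \<noteq> 0"
  defines "p' \<equiv> conj_num a b c e d p q" and "q' \<equiv> conj_den a b c e d p q"
  shows "poly (pderiv (fix_poly p' q')) (a / c) / poly q' (a / c) = - coeff (fix_poly p q) d / coeff p d"
    and "poly (fix_poly p' q') (a / c) = 0"
proof -
  define f where "f = fix_poly p q"
  define l where "l = e * (a / c) - b"
  have "degree f \<le> Suc d" unfolding f_def by (rule degree_fix_poly[OF deg])
  have df: "degree f \<le> d"
  proof (rule degree_le, intro allI impI)
    fix i assume "i > d"
    then show "coeff f i = 0" using inf \<open>degree f \<le> Suc d\<close>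
      by (cases "i = Suc d") (auto simp: f_def coeff_eq_0)
  qed
  have qd: "coeff q d = 0" using inf deg by (simp add: fix_poly_def coeff_eq_0)
  have l: "l = (a * e - b * c) / c" using c by (simp add: l_def field_simps)
  have l0: "l \<noteq> 0" using l c det by simp
  have lin: "poly [:- b, e:] (a / c) = l" "poly [:a, - c:] (a / c) = 0"
    using c by (simp_all add: l_def)
  have F: "fix_poly p' q' = [:a, - c:] * hom_subst d f [:- b, e:] [:a, - c:]"
    unfolding p'_def q'_def fix_poly_conj[OF deg] f_def[symmetric] by (rule hom_subst_Suc[OF df])
  show "poly (fix_poly p' q') (a / c) = 0" unfolding F using lin(2) by (simp only: poly_mult) simp
  have 1: "poly (pderiv (fix_poly p' q')) (a / c) = - c * (coeff f d * l ^ d)"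
    unfolding F pderiv_mult poly_add poly_mult lin poly_hom_subst hom_eval_infinity
    by (simp add: pderiv_pCons)
  have 2: "poly q' (a / c) = c * (coeff p d * l ^ d)"
    unfolding q'_def conj_den_def poly_add poly_smult poly_hom_subst lin hom_eval_infinity qd by simp
  show "poly (pderiv (fix_poly p' q')) (a / c) / poly q' (a / c) = - coeff (fix_poly p q) d / coeff p d"
    unfolding 1 2 using c l0 top qd by (simp add: f_def)
qed

lemma order_flip_factor:
  fixes A :: "'a::field multiset"
  shows "order 0 ((\<Prod>z\<in>#A. [:- 1, z:]) * [:0, - 1:] ^ r) = r"
proof -
  have o1: "poly (\<Prod>z\<in>#A. [:- 1, z:]) 0 \<noteq> 0"
    by (induction A) simp_all
  hence o2: "(\<Prod>z\<in>#A. [:- 1, z:]) \<noteq> 0" by (metis poly_0)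
  have s: "([:0, - 1:] :: 'a poly) ^ r = smult ((- 1) ^ r) ([:- 0, 1:] ^ r)"
    unfolding smult_power[symmetric] by simp
  have nz: "(\<Prod>z\<in>#A. [:- 1, z:]) * [:0, - 1:] ^ r \<noteq> 0" 
    using o2 unfolding s by simp
  show ?thesis
    unfolding Polynomial.order_mult[OF nz] order_0I[OF o1] unfolding s
    using order_smult[of "(- 1 :: 'a) ^ r" 0 "[:- 0, 1:] ^ r"] order_power_n_n[of "0::'a" r] by simp
qed

text \<open>
  Once no fixed point is at \<open>\<infinity>\<close>, the spectrum is computed from the finite roots alone. The roots
  of the conjugated fixed point polynomial are the images of the finite fixed points, together with
  the image \<open>a / c\<close> of \<open>\<infinity>\<close> taken \<open>r\<close> times, where \<open>r\<close> is the missing degree; this \<open>r\<close> is also the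
  multiplicity of \<open>\<infinity>\<close> that is measured after the flip.
\<close>

theorem spectrum_conj:
  fixes p q :: "'a::{alg_closed_field, field_gcd} poly"
  assumes map: "is_map d p q" and d: "d \<ge> 1" and det: "a * e - b * c = 1"
  defines "p' \<equiv> conj_num a b c e d p q" and "q' \<equiv> conj_den a b c e d p q"
  assumes top: "coeff (fix_poly p' q') (Suc d) \<noteq> 0"
  shows "spectrum (Fract p q) =
    image_mset (\<lambda>w. 1 + poly (pderiv (fix_poly p' q')) w / poly q' w) (proots (fix_poly p' q'))"
proof -
  let ?\<phi> = "Fract p q"
  define f where "f = fix_poly p q"
  define r where "r = Suc d - degree f"
  have deg: "degree p \<le> d" "degree q \<le> d" using map by (auto simp: is_map_def)
  have F': "fix_poly p' q' = hom_subst (Suc d) f [:- b, e:] [:a, - c:]"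
    unfolding p'_def q'_def f_def by (rule fix_poly_conj[OF deg])
  have f0: "f \<noteq> 0"
  proof
    assume "f = 0"
    hence "fix_poly p' q' = 0" unfolding F' by (simp add: hom_subst_def)
    with top show False by simp
  qed
  have df: "degree f \<le> Suc d" unfolding f_def by (rule degree_fix_poly[OF deg])
  have lin: "[:- b, e:] - smult z [:a, - c:] = [:- (a * z + b), c * z + e:]" for z
    by (simp add: algebra_simps)
  have fac: "fix_poly p' q' = smult (lead_coeff f) ((\<Prod>z\<in>#proots f. [:- (a * z + b), c * z + e:]) * [:a, - c:] ^ r)"
    unfolding F' hom_subst_full_factors[OF f0 df] lin r_def ..
  have "degree f + r = Suc d" using df by (simp add: r_def)
  hence sz: "size (proots f) + r = Suc d" using hom_subst_full_factors(2)[OF f0 df] by simp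
  \<comment> \<open>The leading coefficient of the conjugated polynomial shows that no fixed point is sent to \<open>\<infinity>\<close>.\<close>
  have c0: "r = 0 \<or> c \<noteq> 0" and e0: "\<forall>z\<in>#proots f. c * z + e \<noteq> 0"
  proof -
    have "coeff ((\<Prod>z\<in>#A. [:- (a * z + b), c * z + e:]) * [:a, - c:] ^ r) (size A + r) =
        (\<Prod>z\<in>#A. c * z + e) * (- c) ^ r" for A
    proof -
      have d1: "degree (\<Prod>z\<in>#A. [:- (a * z + b), c * z + e:]) \<le> size A \<and>
          coeff (\<Prod>z\<in>#A. [:- (a * z + b), c * z + e:]) (size A) = (\<Prod>z\<in>#A. c * z + e)"
      proof (induction A)
        case (add z A)
        have dz: "degree [:- (a * z + b), c * z + e:] \<le> 1" by simp
        from add have "coeff ([:- (a * z + b), c * z + e:] * (\<Prod>z\<in>#A. [:- (a * z + b), c * z + e:])) (1 + size A) =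
           coeff [:- (a * z + b), c * z + e:] 1 * coeff (\<Prod>z\<in>#A. [:- (a * z + b), c * z + e:]) (size A)"
          by (intro coeff_mult_top dz) auto
        moreover have "degree ([:- (a * z + b), c * z + e:] * (\<Prod>z\<in>#A. [:- (a * z + b), c * z + e:])) \<le> 1 + size A"
          using add dz by (intro order_trans[OF degree_mult_le] add_mono) auto
        ultimately show ?case using add by (simp del: mult_pCons_left)
      qed simp
      have "degree ([:a, - c:] ^ r) \<le> r * 1" by (rule degree_power_le') simp
      hence "coeff ((\<Prod>z\<in>#A. [:- (a * z + b), c * z + e:]) * [:a, - c:] ^ r) (size A + r * 1) =
        (\<Prod>z\<in>#A. c * z + e) * coeff ([:a, - c:] ^ r) (r * 1)"
        using d1 by (subst coeff_mult_top) auto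
      then show ?thesis using coeff_power_top[of "[:a, - c:]" 1 r] by simp
    qed
    from this[of "proots f"] have "coeff (fix_poly p' q') (Suc d) = lead_coeff f * ((\<Prod>z\<in>#proots f. c * z + e) * (- c) ^ r)"
      unfolding fac coeff_smult sz by simp
    with top have nz: "(\<Prod>z\<in>#proots f. c * z + e) \<noteq> 0" "(- c) ^ r \<noteq> 0" by auto
    show "r = 0 \<or> c \<noteq> 0" using nz(2) by auto
    show "\<forall>z\<in>#proots f. c * z + e \<noteq> 0" using nz(1) by (auto simp: prod_mset_zero_iff)
  qed
  have pr: "proots (fix_poly p' q') = image_mset (\<lambda>z. (a * z + b) / (c * z + e)) (proots f) + replicate_mset r (a / c)"
  proof -
    have nz: "(\<Prod>z\<in>#proots f. [:- (a * z + b), c * z + e:]) \<noteq> 0"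
      using e0 by (auto simp: prod_mset_zero_iff)
    have nz2: "[:a, - c:] ^ r \<noteq> 0" using c0 by auto
    have "\<forall>z\<in>#A. c * z + e \<noteq> 0 \<Longrightarrow> proots (\<Prod>z\<in>#A. [:- (a * z + b), c * z + e:]) = image_mset (\<lambda>z. (a * z + b) / (c * z + e)) A" for A
    proof (induction A)
      case (add z A)
      then have "[:- (a * z + b), c * z + e:] * (\<Prod>z\<in>#A. [:- (a * z + b), c * z + e:]) \<noteq> 0"
        by (auto simp: prod_mset_zero_iff simp del: mult_pCons_left)
      then show ?case using add by (simp add: proots_mult proots_linear del: mult_pCons_left minus_add_distrib) 
    qed simp
    moreover have "proots ([:a, - c:] ^ r) = replicate_mset r (a / c)"
      using c0 by (cases "r = 0") (simp_all add: proots_power proots_linear repeat_mset_replicate_mset)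
    ultimately show ?thesis
      unfolding fac using e0 nz nz2 f0 by (simp add: proots_mult)
  qed
  obtain k where k: "k \<noteq> 0" "rf_num ?\<phi> = smult k p" "rf_den ?\<phi> = smult k q"
    by (rule rf_num_den_Fract[OF map d])
  have fp: "fixpoint_poly ?\<phi> = smult k f"
    unfolding fixpoint_poly_def k f_def fix_poly_def by (simp add: smult_diff_right)
  \<comment> \<open>The multiplicity of \<open>\<infinity>\<close> in the definition of the fixed points is also the missing degree \<open>r\<close>.\<close>
  have flip: "rf_flip ?\<phi> = Fract (conj_num 0 1 1 0 d p q) (conj_den 0 1 1 0 d p q)"
    unfolding rf_flip_def by (rule rf_conj_Fract[OF map d]) simp
  have fmap: "is_map d (conj_num 0 1 1 0 d p q) (conj_den 0 1 1 0 d p q)"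
    by (rule is_map_conj[OF map]) simp
  obtain k' where k': "k' \<noteq> 0" "rf_num (rf_flip ?\<phi>) = smult k' (conj_num 0 1 1 0 d p q)" "rf_den (rf_flip ?\<phi>) = smult k' (conj_den 0 1 1 0 d p q)"
    unfolding flip by (rule rf_num_den_Fract[OF fmap d])
  have "fixpoint_poly (rf_flip ?\<phi>) = smult k' (fix_poly (conj_num 0 1 1 0 d p q) (conj_den 0 1 1 0 d p q))"
    unfolding fixpoint_poly_def k' fix_poly_def by (simp add: smult_diff_right)
  also have "fix_poly (conj_num 0 1 1 0 d p q) (conj_den 0 1 1 0 d p q) =
      smult (lead_coeff f) ((\<Prod>z\<in>#proots f. [:- 1, z:]) * [:0, - 1:] ^ r)"
    unfolding fix_poly_conj[OF deg] f_def[symmetric] hom_subst_full_factors[OF f0 df] r_def by simp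
  finally have "order 0 (fixpoint_poly (rf_flip ?\<phi>)) = order 0 ((\<Prod>z\<in>#proots f. [:- 1, z:]) * [:0, - 1:] ^ r)"
    using k' f0 by (simp add: order_smult)
  also have "\<dots> = r" by (rule order_flip_factor)
  finally have ord: "order 0 (fixpoint_poly (rf_flip ?\<phi>)) = r" by simp
  have fin: "multiplier ?\<phi> (Some z) = 1 + poly (pderiv (fix_poly p' q')) w / poly q' w"
    if z: "z \<in># proots f" and w: "w = (a * z + b) / (c * z + e)" for z w
  proof -
    have fz: "poly (fix_poly p q) z = 0" using z f0 by (simp add: f_def)
    have ez: "c * z + e \<noteq> 0" using e0 z by blast
    have "(c * z + e) * w = a * z + b" using ez w by simp
    note C = conj_at_fixed_point[OF deg det fz this]
    have "a - c * w \<noteq> 0" using C(4) by (metis mult_zero_left zero_neq_one)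
    hence s0: "(c * z + e) * (a - c * w) ^ d \<noteq> 0" using ez by (intro no_zero_divisors power_not_zero)
    have "multiplier ?\<phi> (Some z) = rf_deriv_at ?\<phi> z" by (simp only: multiplier_def option.case)
    also have "\<dots> = 1 + poly (pderiv (fix_poly p q)) z / poly q z"
      by (rule rf_deriv_at_fixed(2)[OF map d fz])
    also have "poly (pderiv (fix_poly p q)) z / poly q z = poly (pderiv (fix_poly p' q')) w / poly q' w"
      unfolding p'_def q'_def C(2) C(3) by (rule mult_divide_mult_cancel_left[OF s0, symmetric])
    finally show ?thesis .
  qed
  have inf: "multiplier ?\<phi> None = 1 + poly (pderiv (fix_poly p' q')) (a / c) / poly q' (a / c)" if r: "r > 0"
  proof -
    have top': "coeff (fix_poly p q) (Suc d) = 0" using r by (simp add: r_def f_def coeff_eq_0)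
    have tp: "coeff p d \<noteq> 0 \<or> coeff q d \<noteq> 0" using map by (auto simp: is_map_def)
    have c: "c \<noteq> 0" using c0 r by simp
    have det': "a * e - b * c \<noteq> 0" using det by simp
    have det'': "0 * 0 - 1 * 1 \<noteq> (0::'a)" by simp
    note 1 = derivative_at_image_of_infinity[OF deg d c det' top' tp]
    note 2 = derivative_at_image_of_infinity[OF deg d one_neq_zero det'' top' tp]
    have "poly (fix_poly (conj_num 0 1 1 0 d p q) (conj_den 0 1 1 0 d p q)) 0 = 0" using 2(2) by simp
    from rf_deriv_at_fixed(2)[OF fmap d this] show ?thesis
      using 1(1) 2(1) unfolding multiplier_def flip p'_def q'_def by simp
  qed
  have "spectrum ?\<phi> = image_mset (\<lambda>z. multiplier ?\<phi> (Some z)) (proots f) + replicate_mset r (multiplier ?\<phi> None)"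
    unfolding spectrum_def fixpoints_def ord fp using k(1) by (simp add: image_mset.compositionality o_def)
  also have "image_mset (\<lambda>z. multiplier ?\<phi> (Some z)) (proots f) =
     image_mset (\<lambda>z. 1 + poly (pderiv (fix_poly p' q')) ((a * z + b) / (c * z + e)) / poly q' ((a * z + b) / (c * z + e))) (proots f)"
    by (intro image_mset_cong fin) auto
  also have "replicate_mset r (multiplier ?\<phi> None) =
      replicate_mset r (1 + poly (pderiv (fix_poly p' q')) (a / c) / poly q' (a / c))"
    using inf by (cases "r > 0") auto
  finally show ?thesis unfolding pr by (simp add: image_mset.compositionality o_def)
qed

lemma infinite_UNIV_alg_closed: "infinite (UNIV :: 'a::alg_closed_field set)"
proof
  assume fin: "finite (UNIV :: 'a set)"
  define p :: "'a poly" where "p = (\<Prod>a\<in>UNIV. [:- a, 1:]) + 1"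
  have v: "poly p x = 1" for x
    using fin by (auto simp: p_def poly_prod intro!: prod_zero exI[of _ x])
  have "degree (\<Prod>a\<in>S. [:- a, 1:] :: 'a poly) = card S" if "finite S" for S
    using that
  proof (induction S rule: finite_induct)
    case (insert x S)
    have "(\<Prod>a\<in>S. [:- a, 1:] :: 'a poly) \<noteq> 0" using insert by simp
    then show ?case using insert by (simp add: degree_mult_eq del: mult_pCons_left)
  qed simp
  hence "degree (\<Prod>a\<in>UNIV. [:- a, 1:] :: 'a poly) > 0"
    using fin by (simp add: card_gt_0_iff)
  hence "degree p > 0" unfolding p_def by (subst degree_add_eq_left) auto
  then show False using alg_closed_imp_poly_has_root v by (metis zero_neq_one)
qed

lemma poly_eq_cofinite:
  fixes p q :: "'a::alg_closed_field poly"
  assumes "finite {x. poly p x \<noteq> poly q x}"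
  shows "p = q"
proof (rule ccontr)
  assume "p \<noteq> q"
  hence "finite {x. poly (p - q) x = 0}" by (intro poly_roots_finite) auto
  moreover have "{x. poly (p - q) x = 0} = {x. poly p x = poly q x}" by auto
  ultimately have "finite ({x. poly p x = poly q x} \<union> {x. poly p x \<noteq> poly q x})" using assms by simp
  moreover have "{x. poly p x = poly q x} \<union> {x. poly p x \<noteq> poly q x} = UNIV" by auto
  ultimately show False using infinite_UNIV_alg_closed by metis
qed

lemma poly_eq_UNIV: "(\<And>x. poly p x = poly q x) \<Longrightarrow> p = q" for p q :: "'a::alg_closed_field poly"
  by (rule poly_eq_cofinite) simp


section \<open>Conjugation invariance of the spectrum\<close>

lemma fix_poly_nonzero:
  fixes p q :: "'a::{alg_closed_field, field_gcd} poly"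
  assumes map: "is_map d p q" and d: "d \<ge> 2"
  shows "fix_poly p q \<noteq> 0"
proof
  assume "fix_poly p q = 0"
  hence p: "p = pCons 0 q" by (simp add: fix_poly_def)
  have "\<nexists>x. poly q x = 0" using map p by (auto simp: is_map_def)
  hence "degree q = 0" using alg_closed_imp_poly_has_root by auto
  then show False using map d p by (auto simp: is_map_def coeff_eq_0 coeff_pCons split: nat.splits)
qed

text \<open>
  The conjugation sends \<open>t\<close> to \<open>\<infinity>\<close>, so the leading coefficient vanishes exactly if \<open>t\<close> is fixed.
\<close>

lemma coeff_moved_fix_poly:
  assumes "degree p \<le> d" "degree q \<le> d"
  shows "coeff (fix_poly (conj_num 0 1 (- 1) t d p q) (conj_den 0 1 (- 1) t d p q)) (Suc d) = poly (fix_poly p q) t"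
proof -
  have df: "degree (fix_poly p q) \<le> Suc d" by (rule degree_fix_poly[OF assms])
  have "coeff (hom_subst (Suc d) (fix_poly p q) [:- 1, t:] [:0, - (- 1):]) (Suc d * 1) =
      hom_eval (Suc d) (fix_poly p q) (coeff [:- 1, t:] 1) (coeff [:0, - (- 1):] 1)"
    by (rule coeff_hom_subst_top) auto
  also have "\<dots> = poly (fix_poly p q) t" using hom_eval_unit[OF df, of t 1] by simp
  finally show ?thesis unfolding fix_poly_conj[OF assms] by simp
qed

lemma ex_not_fixed:
  fixes p q :: "'a::{alg_closed_field, field_gcd} poly"
  assumes map: "is_map d p q" and d: "d \<ge> 2"
  obtains t where "poly (fix_poly p q) t \<noteq> 0"
proof -
  have "finite {t. poly (fix_poly p q) t = 0}" by (rule poly_roots_finite[OF fix_poly_nonzero[OF assms]])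
  then obtain t where "t \<notin> {t. poly (fix_poly p q) t = 0}" using infinite_UNIV_alg_closed ex_new_if_finite by blast
  then show ?thesis using that by blast
qed

text \<open>
  Compose both sides with a conjugation that moves a point that is not fixed to \<open>\<infinity>\<close>; by
  \<open>spectrum_conj\<close> both spectra are read off from the same pair.
\<close>

lemma spectrum_Fract_conj:
  fixes p q :: "'a::{alg_closed_field, field_gcd} poly"
  assumes map: "is_map d p q" and d: "d \<ge> 2" and det: "a * e - b * c = 1"
  shows "spectrum (Fract (conj_num a b c e d p q) (conj_den a b c e d p q)) = spectrum (Fract p q)"
proof -
  define p' where "p' = conj_num a b c e d p q"
  define q' where "q' = conj_den a b c e d p q"
  have map': "is_map d p' q'" unfolding p'_def q'_def by (rule is_map_conj[OF map], unfold det, simp)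
  have d1: "d \<ge> 1" using d by simp
  obtain t where t: "poly (fix_poly p' q') t \<noteq> 0" by (rule ex_not_fixed[OF map' d])
  have deg: "degree p' \<le> d" "degree q' \<le> d" using map' by (auto simp: is_map_def)
  have top: "coeff (fix_poly (conj_num 0 1 (- 1) t d p' q') (conj_den 0 1 (- 1) t d p' q')) (Suc d) \<noteq> 0"
    unfolding coeff_moved_fix_poly[OF deg] by (rule t)
  have det1: "0 * t - 1 * (- 1) = (1::'a)" by simp
  have eq: "conj_num 0 1 (- 1) t d p' q' = conj_num c e (t * c - a) (t * e - b) d p q"
     "conj_den 0 1 (- 1) t d p' q' = conj_den c e (t * c - a) (t * e - b) d p q"
    unfolding p'_def q'_def conj_conj by simp_all
  have det2: "c * (t * e - b) - e * (t * c - a) = 1" using det by (simp add: algebra_simps)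
  show ?thesis
    unfolding p'_def[symmetric] q'_def[symmetric] spectrum_conj[OF map' d1 det1 top]
      spectrum_conj[OF map d1 det2 top[unfolded eq]] unfolding eq ..
qed

lemma period_multipliers_eq_spectrum: "period_multipliers n \<phi> = spectrum (rf_iter n \<phi>)"
  by (simp add: period_multipliers_def spectrum_def)

lemma power_ge_2: "d \<ge> 2 \<Longrightarrow> n \<ge> 1 \<Longrightarrow> d ^ n \<ge> (2::nat)"
  by (metis One_nat_def Suc_1 Suc_leD le_trans power_increasing power_one_right)

text \<open>
  Over an algebraically closed field the matrix can be scaled to determinant \<open>1\<close>, where conjugation
  commutes with iteration of pairs.
\<close>

theorem period_multipliers_conj:
  fixes \<phi> :: "'a::{alg_closed_field, field_gcd} poly fract"
  assumes \<phi>: "\<phi> \<in> Rat d" and d: "d \<ge> 2" and n: "n \<ge> 1" and det: "a * e - b * c \<noteq> 0"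
  shows "period_multipliers n (rf_conj a b c e \<phi>) = period_multipliers n \<phi>"
proof -
  have d1: "d \<ge> 1" using d by simp
  define p where "p = rf_num \<phi>"
  define q where "q = rf_den \<phi>"
  have pq: "is_map d p q" "\<phi> = Fract p q" unfolding p_def q_def by (rule is_map_rf[OF \<phi> d1])+
  obtain s where s: "s ^ 2 = 1 / (a * e - b * c)" using nth_root_exists[of 2] by auto
  have s0: "s \<noteq> 0" using s det by auto
  have det1: "(s * a) * (s * e) - (s * b) * (s * c) = 1"
  proof -
    have "(s * a) * (s * e) - (s * b) * (s * c) = s ^ 2 * (a * e - b * c)" by (simp add: algebra_simps power2_eq_square)
    then show ?thesis using s det by simp
  qed
  define p' where "p' = conj_num (s * a) (s * b) (s * c) (s * e) d p q"
  define q' where "q' = conj_den (s * a) (s * b) (s * c) (s * e) d p q"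
  have map': "is_map d p' q'" unfolding p'_def q'_def by (rule is_map_conj[OF pq(1)], unfold det1, simp)
  have "rf_conj a b c e \<phi> = rf_conj (s * a) (s * b) (s * c) (s * e) \<phi>"
    using rf_conj_scale[OF \<phi> d1 det s0] by simp
  also have "\<dots> = Fract p' q'"
    unfolding pq(2) p'_def q'_def by (rule rf_conj_Fract[OF pq(1) d1], unfold det1, simp)
  finally have "rf_iter n (rf_conj a b c e \<phi>) = Fract (iter_num d p' q' n) (iter_den d p' q' n)"
    using rf_iter_Fract[OF map' d1] by simp
  also have "spectrum \<dots> = spectrum (Fract (iter_num d p q n) (iter_den d p q n))"
    unfolding p'_def q'_def iter_pair_conj[OF det1] fst_conv snd_conv
    by (rule spectrum_Fract_conj[OF is_map_iter[OF pq(1)] power_ge_2[OF d n] det1])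
  also have "Fract (iter_num d p q n) (iter_den d p q n) = rf_iter n \<phi>"
    unfolding pq(2) using rf_iter_Fract[OF pq(1) d1] by simp
  finally show ?thesis by (simp add: period_multipliers_eq_spectrum)
qed


section \<open>Elementary symmetric functions\<close>

text \<open>
  The polynomial \<open>\<Prod> (X + \<lambda>)\<close>, whose coefficients are the elementary symmetric functions without
  signs. A multiplier \<open>1\<close> corresponds to the root \<open>- 1\<close>.
\<close>

definition mult_poly :: "'a::comm_ring_1 multiset \<Rightarrow> 'a poly" where
  "mult_poly A = (\<Prod>x\<in>#A. [:x, 1:])"

text \<open>
  Expanding the product chooses a subset of the factors; the set of pairs in the definition of
  \<open>elem_sym\<close> enumerates the factors with their multiplicity.
\<close>

lemma mult_poly_eq_sum: "mult_poly A = (\<Sum>j\<le>size A. monom (elem_sym j A) (size A - j))"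
proof -
  define T where "T = (SIGMA x:set_mset A. {..<count A x})"
  have T: "finite T" "card T = size A"
    by (simp_all add: T_def card_SigmaI size_multiset_overloaded_eq)
  have "mult_poly A = (\<Prod>x\<in>set_mset A. \<Prod>i<count A x. [:x, 1:])"
    by (simp add: mult_poly_def image_prod_mset_multiplicity)
  also have "\<dots> = (\<Prod>(x, i)\<in>T. [:x, 1:])"
    unfolding T_def by (rule prod.Sigma) auto
  also have "\<dots> = (\<Prod>s\<in>T. [:fst s:] + [:0, 1:])"
    by (intro prod.cong) auto
  also have "\<dots> = (\<Sum>S\<in>Pow T. (\<Prod>s\<in>S. [:fst s:]) * (\<Prod>s\<in>T - S. [:0, 1:]))"
    by (rule prod_add[OF T(1)])
  also have "\<dots> = (\<Sum>S\<in>Pow T. monom (\<Prod>s\<in>S. fst s) (size A - card S))"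
  proof (intro sum.cong refl)
    fix S assume S: "S \<in> Pow T"
    hence fS: "finite S" using T finite_subset by auto
    have "card (T - S) = size A - card S" using S fS T by (simp add: card_Diff_subset)
    moreover have "(\<Prod>s\<in>S. [:fst s:]) = [:\<Prod>s\<in>S. fst s:]" for S :: "('a \<times> nat) set"
      by (induction S rule: infinite_finite_induct) (auto simp: one_pCons)
    ultimately show "(\<Prod>s\<in>S. [:fst s:]) * (\<Prod>s\<in>T - S. [:0, 1:]) = monom (\<Prod>s\<in>S. fst s) (size A - card S)"
      by (simp add: monom_altdef)
  qed
  also have "\<dots> = (\<Sum>j\<le>size A. \<Sum>S | S \<in> Pow T \<and> card S = j. monom (\<Prod>s\<in>S. fst s) (size A - card S))"
    by (rule sum.group[symmetric]) (use T in \<open>auto simp flip: T(2) intro: card_mono\<close>)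
  also have "\<dots> = (\<Sum>j\<le>size A. monom (elem_sym j A) (size A - j))"
  proof (intro sum.cong refl)
    fix j
    have "(\<Sum>S | S \<in> Pow T \<and> card S = j. monom (\<Prod>s\<in>S. fst s) (size A - card S)) =
       (\<Sum>S | S \<in> Pow T \<and> card S = j. monom (\<Prod>s\<in>S. fst s) (size A - j))"
      by (intro sum.cong) auto
    also have "\<dots> = monom (\<Sum>S | S \<in> Pow T \<and> card S = j. \<Prod>s\<in>S. fst s) (size A - j)"
      by (simp add: monom_sum)
    finally show "(\<Sum>S | S \<in> Pow T \<and> card S = j. monom (\<Prod>s\<in>S. fst s) (size A - card S)) = monom (elem_sym j A) (size A - j)"
      by (simp add: elem_sym_def T_def case_prod_unfold Pow_def)
  qed
  finally show ?thesis .
qed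

lemma coeff_mult_poly:
  assumes "j \<le> size A"
  shows "coeff (mult_poly A) (size A - j) = elem_sym j A"
proof -
  have "coeff (mult_poly A) (size A - j) = (\<Sum>i\<le>size A. if i = j then elem_sym j A else 0)"
    unfolding mult_poly_eq_sum coeff_sum using assms by (intro sum.cong) auto
  then show ?thesis using assms by simp
qed

lemma elem_sym_0: "elem_sym 0 A = 1"
proof -
  have "{S. S \<subseteq> (SIGMA x:set_mset A. {..<count A x}) \<and> card S = 0} = {{}}"
  proof -
    have "finite (SIGMA x:set_mset A. {..<count A x})" by auto
    then show ?thesis using finite_subset by fastforce
  qed
  then show ?thesis by (simp add: elem_sym_def)
qed

lemma mult_poly_monic: "coeff (mult_poly A) (size A) = 1" "degree (mult_poly A) \<le> size A"
proof -
  show "coeff (mult_poly A) (size A) = 1" using coeff_mult_poly[of 0 A] by (simp add: elem_sym_0)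
  show "degree (mult_poly A) \<le> size A"
    unfolding mult_poly_eq_sum by (intro degree_sum_le) (auto intro: order_trans[OF degree_monom_le])
qed

lemma mult_poly_eqI:
  assumes "size A = m" "size B = m" "\<And>j. 1 \<le> j \<Longrightarrow> j \<le> m \<Longrightarrow> elem_sym j A = elem_sym j B"
  shows "mult_poly A = mult_poly B"
proof -
  have "elem_sym j A = elem_sym j B" if "j \<le> m" for j
    using assms(3)[of j] that by (cases "j = 0") (auto simp: elem_sym_0)
  then show ?thesis unfolding mult_poly_eq_sum assms(1,2) by (intro sum.cong) auto
qed

lemma size_spectrum_Fract:
  fixes p q :: "'a::{alg_closed_field, field_gcd} poly"
  assumes map: "is_map d p q" and d: "d \<ge> 2"
  shows "size (spectrum (Fract p q)) = Suc d"
proof -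
  have d1: "d \<ge> 1" using d by simp
  obtain t where t: "poly (fix_poly p q) t \<noteq> 0" by (rule ex_not_fixed[OF map d])
  have deg: "degree p \<le> d" "degree q \<le> d" using map by (auto simp: is_map_def)
  define f where "f = fix_poly (conj_num 0 1 (- 1) t d p q) (conj_den 0 1 (- 1) t d p q)"
  have top: "coeff f (Suc d) \<noteq> 0"
    unfolding f_def coeff_moved_fix_poly[OF deg] by (rule t)
  have "degree f \<le> Suc d" unfolding f_def by (intro degree_fix_poly degree_conj)
  with top have "degree f = Suc d" "f \<noteq> 0" by (auto intro: antisym le_degree)
  moreover have "size (spectrum (Fract p q)) = size (proots f)"
    using spectrum_conj[OF map d1 _ top[unfolded f_def]] by (simp add: f_def)
  ultimately show ?thesis using hom_subst_full_factors(2)[of f "Suc d"] by simp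
qed

lemma size_period_multipliers:
  fixes \<phi> :: "'a::{alg_closed_field, field_gcd} poly fract"
  assumes \<phi>: "\<phi> \<in> Rat d" and d: "d \<ge> 2" and n: "n \<ge> 1"
  shows "size (period_multipliers n \<phi>) = Suc (d ^ n)"
proof -
  have d1: "d \<ge> 1" using d by simp
  have pq: "is_map d (rf_num \<phi>) (rf_den \<phi>)" "\<phi> = Fract (rf_num \<phi>) (rf_den \<phi>)" by (rule is_map_rf[OF \<phi> d1])+
  show ?thesis
    using size_spectrum_Fract[OF is_map_iter[OF pq(1)] power_ge_2[OF d n]] rf_iter_Fract[OF pq(1) d1, of n] pq(2)
    unfolding period_multipliers_eq_spectrum by simp
qed

lemma Lambda_rf_eq_iff:
  fixes \<phi> \<psi> :: "'a::{alg_closed_field, field_gcd} poly fract"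
  assumes "\<phi> \<in> Rat d" "\<psi> \<in> Rat d" "d \<ge> 2" "n \<ge> 1"
  shows "Lambda_rf d n \<phi> = Lambda_rf d n \<psi> \<longleftrightarrow>
    mult_poly (period_multipliers n \<phi>) = mult_poly (period_multipliers n \<psi>)" (is "?L \<longleftrightarrow> ?R")
proof
  note sz = size_period_multipliers[OF assms(1,3,4)] size_period_multipliers[OF assms(2,3,4)]
  { assume ?L
    hence *: "\<forall>j\<in>set [1..<num_period_points d n + 1]. elem_sym j (period_multipliers n \<phi>) = elem_sym j (period_multipliers n \<psi>)"
      unfolding Lambda_rf_def by (simp only: map_eq_conv)
    show ?R
    proof (rule mult_poly_eqI[OF sz])
      fix j assume "1 \<le> j" "j \<le> Suc (d ^ n)"
      hence "j \<in> set [1..<num_period_points d n + 1]" unfolding num_period_points_def set_upt by auto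
      with * show "elem_sym j (period_multipliers n \<phi>) = elem_sym j (period_multipliers n \<psi>)" by blast
    qed }
  { assume R: ?R
    show ?L unfolding Lambda_rf_def
    proof (rule map_cong[OF refl])
      fix j assume "j \<in> set [1..<num_period_points d n + 1]"
      hence "j \<le> Suc (d ^ n)" unfolding num_period_points_def set_upt by auto
      then show "elem_sym j (period_multipliers n \<phi>) = elem_sym j (period_multipliers n \<psi>)"
        using coeff_mult_poly[of j "period_multipliers n \<phi>"] coeff_mult_poly[of j "period_multipliers n \<psi>"] R sz by simp
    qed }
qed


section \<open>Symmetric functions of multipliers as ratios of forms\<close>

lemma alg_closed_split_fun:
  fixes f :: "'a::{alg_closed_field} poly"
  assumes "degree f \<le> m" "coeff f m \<noteq> 0"
  obtains w where "f = smult (coeff f m) (\<Prod>i<m. [:- w i, 1:])" "proots f = image_mset w (mset_set {..<m})"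
proof -
  have deg: "degree f = m" "f \<noteq> 0" using assms by (auto intro: antisym le_degree)
  obtain A where A: "size A = degree f" "f = smult (lead_coeff f) (\<Prod>x\<in>#A. [:- x, 1:])"
    using alg_closed_imp_factorization[OF deg(2)] by blast
  obtain ws where ws: "mset ws = A" using ex_mset by blast
  have len: "length ws = m" using ws A deg by (metis size_mset)
  have A': "A = image_mset (\<lambda>i. ws ! i) (mset_set {..<m})"
    by (metis len ws lessThan_atLeast0 map_nth mset_map mset_set_upto_eq_mset_upto)
  have pr: "(\<Prod>x\<in>#A. [:- x, 1:]) = (\<Prod>i<m. [:- (ws ! i), 1:])"
    unfolding A' by (simp add: image_mset.compositionality o_def prod_unfold_prod_mset)
  have "proots f = proots (smult (lead_coeff f) (\<Prod>x\<in>#A. [:- x, 1:]))" using A(2) by simp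
  also have "\<dots> = A" using deg(2) by (simp add: proots_prod_linear)
  finally have "proots f = A" .
  then show ?thesis using that[of "\<lambda>i. ws ! i"] A(2) A' deg(1) unfolding pr by simp
qed

text \<open>
  The factor \<open>B t\<close> depends on the choice of \<open>t\<close> and of the coordinates, but not on \<open>u\<close>, so it
  disappears from ratios of coefficients.
\<close>

lemma mult_form_period_multipliers:
  fixes x :: "nat \<Rightarrow> 'a::{alg_closed_field, field_gcd}"
  assumes map: "is_map d (coord_num d x) (coord_den d x)" and d: "d \<ge> 2" and n: "n \<ge> 1"
  shows "\<exists>B. \<forall>t. (\<forall>u. mult_form d n x t u =
      B t * poly (mult_poly (period_multipliers n (Fract (coord_num d x) (coord_den d x)))) u) \<and>
    (poly (fix_poly (iter_num d (coord_num d x) (coord_den d x) n) (iter_den d (coord_num d x) (coord_den d x) n)) t \<noteq> 0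
      \<longrightarrow> B t \<noteq> 0)"
proof -
  define p where "p = coord_num d x"
  define q where "q = coord_den d x"
  define P where "P = iter_num d p q n"
  define Q where "Q = iter_den d p q n"
  define \<chi> where "\<chi> = mult_poly (period_multipliers n (Fract p q))"
  let ?D = "d ^ n"
  have map': "is_map d p q" using map by (simp add: p_def q_def)
  have PQ: "is_map ?D P Q" unfolding P_def Q_def by (rule is_map_iter[OF map'])
  have degPQ: "degree P \<le> ?D" "degree Q \<le> ?D" using PQ by (auto simp: is_map_def)
  have D: "?D \<ge> 1" using d by simp
  have "\<exists>b. (\<forall>u. mult_form d n x t u = b * poly \<chi> u) \<and> (poly (fix_poly P Q) t \<noteq> 0 \<longrightarrow> b \<noteq> 0)" for t
  proof -
    let ?f = "moved_fix d n x t" and ?q = "moved_den d n x t"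
    have fdef: "?f = fix_poly (conj_num 0 1 (- 1) t ?D P Q) (conj_den 0 1 (- 1) t ?D P Q)"
      unfolding moved_fix_def moved_num_def moved_den_def P_def Q_def p_def q_def ..
    have qdef: "?q = conj_den 0 1 (- 1) t ?D P Q"
      unfolding moved_den_def P_def Q_def p_def q_def ..
    have top: "coeff ?f (Suc ?D) = poly (fix_poly P Q) t"
      unfolding fdef by (rule coeff_moved_fix_poly[OF degPQ])
    show ?thesis
    proof (cases "poly (fix_poly P Q) t = 0")
      case True
      then have "mult_form d n x t u = 0" for u
        unfolding mult_form_def Let_def top by simp
      then show ?thesis using True by auto
    next
      case False
      hence c: "coeff ?f (Suc ?D) \<noteq> 0" using top by simp
      obtain w where w: "?f = smult (coeff ?f (Suc ?D)) (\<Prod>i<Suc ?D. [:- w i, 1:])"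
         "proots ?f = image_mset w (mset_set {..<Suc ?D})"
        by (rule alg_closed_split_fun[OF degree_moved(3) c])
      have f0: "?f \<noteq> 0" using c by auto
      have det1: "0 * t - 1 * (- 1) = (1::'a)" by simp
      have mapc: "is_map ?D (conj_num 0 1 (- 1) t ?D P Q) (conj_den 0 1 (- 1) t ?D P Q)"
        by (rule is_map_conj[OF PQ]) simp
      have q0: "poly ?q (w i) \<noteq> 0" if "i < Suc ?D" for i
      proof -
        have "w i \<in># proots ?f" unfolding w(2) using that by simp
        hence "poly ?f (w i) = 0" using f0 by simp
        then show ?thesis unfolding qdef by (rule rf_deriv_at_fixed(1)[OF mapc D, folded fdef])
      qed
      have spec: "spectrum (Fract P Q) = image_mset (\<lambda>w. 1 + poly (pderiv ?f) w / poly ?q w) (proots ?f)"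
        using spectrum_conj[OF PQ D det1] c unfolding fdef qdef by simp
      have d1: "d \<ge> 1" using d by simp
      have "period_multipliers n (Fract p q) = spectrum (Fract P Q)"
        unfolding period_multipliers_eq_spectrum rf_iter_Fract[OF map' d1] P_def Q_def ..
      hence "\<chi> = (\<Prod>i<Suc ?D. [:1 + poly (pderiv ?f) (w i) / poly ?q (w i), 1:])"
        unfolding \<chi>_def mult_poly_def spec w(2)
        by (simp only: image_mset.compositionality o_def prod_unfold_prod_mset)
      hence chi: "poly \<chi> u = (\<Prod>i<Suc ?D. 1 + poly (pderiv ?f) (w i) / poly ?q (w i) + u)" for u
        by (simp add: poly_prod del: prod.lessThan_Suc)
      define l where "l = coeff ?f (Suc ?D)"
      define b where "b = (l * l ^ (?D * Suc ?D)) ^ 2 * (\<Prod>i<Suc ?D. poly ?q (w i)) ^ 2"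
      have "mult_form d n x t u = b * poly \<chi> u" for u
      proof -
        have "(\<Prod>i<Suc ?D. u * poly ?q (w i) + (poly ?q (w i) + poly (pderiv ?f) (w i))) =
          (\<Prod>i<Suc ?D. poly ?q (w i) * (1 + poly (pderiv ?f) (w i) / poly ?q (w i) + u))"
          using q0 by (intro prod.cong refl) (simp add: field_simps)
        also have "\<dots> = (\<Prod>i<Suc ?D. poly ?q (w i)) * poly \<chi> u"
          unfolding chi prod.distrib ..
        finally have *: "(\<Prod>i<Suc ?D. u * poly ?q (w i) + (poly ?q (w i) + poly (pderiv ?f) (w i))) =
           (\<Prod>i<Suc ?D. poly ?q (w i)) * poly \<chi> u" .
        show ?thesis
          unfolding mult_form_roots[OF w(1)] * b_def l_def by (simp add: power2_eq_square mult_ac del: prod.lessThan_Suc)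
      qed
      moreover have "b \<noteq> 0" unfolding b_def l_def using c q0 by (simp del: prod.lessThan_Suc)
      ultimately show ?thesis by blast
    qed
  qed
  then obtain B where "\<forall>t. (\<forall>u. mult_form d n x t u = B t * poly \<chi> u) \<and> (poly (fix_poly P Q) t \<noteq> 0 \<longrightarrow> B t \<noteq> 0)"
    by metis
  then show ?thesis unfolding \<chi>_def P_def Q_def p_def q_def by blast
qed

text \<open>
  The multiplier form with indeterminates for \<open>u\<close> (outer variable) and for \<open>t\<close> (inner variable).
\<close>

definition generic_form :: "nat \<Rightarrow> nat \<Rightarrow> (nat \<Rightarrow> 'a::idom) \<Rightarrow> 'a poly poly" where
  "generic_form d n x = mult_form d n (\<lambda>i. [:[:x i:]:]) [:[:0, 1:]:] [:0, 1:]"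

text \<open>
  The coefficient of \<open>u\<^sup>j t\<^sup>r\<close>. For each \<open>r\<close> the values \<open>mult_coeff d n x j r\<close>, \<open>j \<le> d\<^sup>n + 1\<close>, are
  homogeneous coordinates for the symmetric functions of the multipliers, unless all of them vanish.
\<close>

definition mult_coeff :: "nat \<Rightarrow> nat \<Rightarrow> (nat \<Rightarrow> 'a::idom) \<Rightarrow> nat \<Rightarrow> nat \<Rightarrow> 'a" where
  "mult_coeff d n x j r = coeff (coeff (generic_form d n x) j) r"

lemma generic_form_eval:
  "poly (map_poly (\<lambda>c. poly c t) (generic_form d n x)) u = mult_form d n x t (u :: 'a::idom)"
proof -
  interpret h: comm_ring_hom "\<lambda>c. poly c t" by unfold_locales auto
  interpret mh: map_poly_comm_ring_hom "\<lambda>c. poly c t" ..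
  interpret e: idom_hom "\<lambda>P. poly (map_poly (\<lambda>c. poly c t) P) u"
    by unfold_locales (auto simp: mh.hom_add mh.hom_mult)
  show ?thesis
    unfolding generic_form_def e.hom_mult_form by (simp add: poly_hom.map_poly_pCons_hom)
qed

lemma (in idom_hom) hom_mult_coeff: "hom (mult_coeff d n x j r) = mult_coeff d n (\<lambda>i. hom (x i)) j r"
proof -
  interpret mh: map_poly_idom_hom hom ..
  interpret mmh: map_poly_idom_hom "map_poly hom" ..
  have "map_poly (map_poly hom) (generic_form d n x) = generic_form d n (\<lambda>i. hom (x i))"
    unfolding generic_form_def mmh.hom_mult_form by (simp add: map_poly_pCons_hom mh.map_poly_pCons_hom)
  then have "coeff (coeff (map_poly (map_poly hom) (generic_form d n x)) j) r = mult_coeff d n (\<lambda>i. hom (x i)) j r"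
    by (simp add: mult_coeff_def)
  then show ?thesis by (simp add: mult_coeff_def)
qed

lemma mult_coeff_scale:
  "\<exists>\<delta>. \<forall>x s j r. mult_coeff d n (\<lambda>i. (s::'a::idom) * x i) j r = s ^ \<delta> * mult_coeff d n x j r"
proof -
  obtain \<delta> where \<delta>: "mult_form d n (\<lambda>i. s * x i) t u = s ^ \<delta> * mult_form d n x t u"
    for x t u and s :: "'a poly poly"
    using mult_form_scale[of d n] by blast
  have "mult_coeff d n (\<lambda>i. s * x i) j r = s ^ \<delta> * mult_coeff d n x j r" for x j r and s :: 'a
  proof -
    have "generic_form d n (\<lambda>i. s * x i) = [:[:s:]:] ^ \<delta> * generic_form d n x"
      unfolding generic_form_def \<delta>[symmetric] by simp
    also have "[:[:s:]:] ^ \<delta> = [:[:s ^ \<delta>:]:]"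
      by (induction \<delta>) (auto simp: one_pCons)
    finally show ?thesis by (simp add: mult_coeff_def)
  qed
  then show ?thesis by blast
qed

context
  fixes d n :: nat and x :: "nat \<Rightarrow> 'a::{alg_closed_field, field_gcd}"
  assumes d: "d \<ge> 2" and n: "n \<ge> 1"
begin

lemma poly_coeff_generic_form: "map_poly (\<lambda>c. poly c t) (generic_form d n x) = smult b \<chi>"
  if "\<And>u. mult_form d n x t u = b * poly \<chi> u"
  by (rule poly_eq_UNIV) (simp add: generic_form_eval that)

text \<open>
  The polynomial \<open>coeff (generic_form d n x) j\<close> in \<open>t\<close> is \<open>B t\<close> times the constant \<open>coeff \<chi> j\<close>, and
  \<open>B\<close> is not identically zero.
\<close>

lemma mult_coeff_regular:
  assumes map: "is_map d (coord_num d x) (coord_den d x)"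
  defines "\<chi> \<equiv> mult_poly (period_multipliers n (Fract (coord_num d x) (coord_den d x)))"
  shows "mult_coeff d n x j r = coeff \<chi> j * mult_coeff d n x (Suc (d ^ n)) r"
    and "\<exists>r. mult_coeff d n x (Suc (d ^ n)) r \<noteq> 0"
proof -
  let ?F = "fix_poly (iter_num d (coord_num d x) (coord_den d x) n) (iter_den d (coord_num d x) (coord_den d x) n)"
  obtain B where B: "\<And>t u. mult_form d n x t u = B t * poly \<chi> u" "\<And>t. poly ?F t \<noteq> 0 \<Longrightarrow> B t \<noteq> 0"
    using mult_form_period_multipliers[OF map d n] unfolding \<chi>_def by blast
  have co: "poly (coeff (generic_form d n x) j) t = B t * coeff \<chi> j" for j t
  proof -
    have "coeff (map_poly (\<lambda>c. poly c t) (generic_form d n x)) j = B t * coeff \<chi> j"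
      by (simp add: poly_coeff_generic_form[OF B(1)])
    then show ?thesis by (simp add: coeff_map_poly)
  qed
  have d1: "d \<ge> 1" using d by simp
  have monic: "coeff \<chi> (Suc (d ^ n)) = 1"
    using mult_poly_monic(1) size_period_multipliers[OF Fract_in_Rat[OF map d1] d n] unfolding \<chi>_def by metis
  have eq: "coeff (generic_form d n x) j = smult (coeff \<chi> j) (coeff (generic_form d n x) (Suc (d ^ n)))" for j
    by (rule poly_eq_UNIV) (simp add: co monic)
  show "mult_coeff d n x j r = coeff \<chi> j * mult_coeff d n x (Suc (d ^ n)) r"
    unfolding mult_coeff_def by (subst eq) simp
  obtain t where "poly ?F t \<noteq> 0"
    by (rule ex_not_fixed[OF is_map_iter[OF map] power_ge_2[OF d n]])
  hence "poly (coeff (generic_form d n x) (Suc (d ^ n))) t \<noteq> 0" using B(2) by (simp add: co monic)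
  hence "coeff (generic_form d n x) (Suc (d ^ n)) \<noteq> 0" by auto
  then show "\<exists>r. mult_coeff d n x (Suc (d ^ n)) r \<noteq> 0"
    unfolding mult_coeff_def by (meson leading_coeff_0_iff)
qed

lemma mult_form_common_zero:
  assumes "poly (moved_fix d n x t) w = 0" "poly (moved_den d n x t) w = 0"
  shows "mult_form d n x t u = 0"
proof (cases "coeff (moved_fix d n x t) (Suc (d ^ n)) = 0")
  case True
  then show ?thesis by (simp add: mult_form_def Let_def)
next
  case False
  obtain v where v: "moved_fix d n x t = smult (coeff (moved_fix d n x t) (Suc (d ^ n))) (\<Prod>i<Suc (d ^ n). [:- v i, 1:])"
    by (rule alg_closed_split_fun[OF degree_moved(3) False])
  have "poly (smult (coeff (moved_fix d n x t) (Suc (d ^ n))) (\<Prod>i<Suc (d ^ n). [:- v i, 1:])) w = 0"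
    using assms(1) v by simp
  hence "\<exists>i\<in>{..<Suc (d ^ n)}. w - v i = 0"
    using False by (simp add: poly_prod prod_zero_iff del: prod.lessThan_Suc)
  then obtain i where i: "i < Suc (d ^ n)" "v i = w" by auto
  hence "(\<Prod>i<Suc (d ^ n). poly (moved_den d n x t) (v i)) = 0"
    using assms(2) by (intro prod_zero) auto
  then show ?thesis unfolding mult_form_roots[OF v] by simp
qed

text \<open>
  A common zero of numerator and denominator, finite or at \<open>\<infinity>\<close>, persists under iteration and
  conjugation, and it is a common root of \<open>f\<close> and \<open>q\<close>. This lemma shows that the forms detect
  whether coordinates belong to a map.
\<close>

lemma mult_coeff_degenerate:
  assumes map: "\<not> is_map d (coord_num d x) (coord_den d x)"
  shows "mult_coeff d n x j r = 0"
proof -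
  define p where "p = coord_num d x"
  define q where "q = coord_den d x"
  define P where "P = iter_num d p q n"
  define Q where "Q = iter_den d p q n"
  let ?D = "d ^ n"
  have d1: "d \<ge> 1" using d by simp
  have deg: "degree p \<le> d" "degree q \<le> d" unfolding p_def q_def by (rule degree_coord)+
  have degPQ: "degree P \<le> ?D" "degree Q \<le> ?D" unfolding P_def Q_def by (rule degree_iter)+
  have fdef: "moved_fix d n x t = fix_poly (conj_num 0 1 (- 1) t ?D P Q) (conj_den 0 1 (- 1) t ?D P Q)"
    and qdef: "moved_den d n x t = conj_den 0 1 (- 1) t ?D P Q" for t
    unfolding moved_fix_def moved_num_def moved_den_def P_def Q_def p_def q_def by simp_all
  have "\<exists>z. \<forall>t u. t \<noteq> z \<longrightarrow> mult_form d n x t u = 0"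
  proof -
    consider z where "poly p z = 0" "poly q z = 0" | "coeff p d = 0" "coeff q d = 0"
      using map deg unfolding is_map_def p_def[symmetric] q_def[symmetric] by blast
    then show ?thesis
    proof cases
      \<comment> \<open>A finite common zero \<open>z\<close> is moved to \<open>1 / (t - z)\<close>, except for \<open>t = z\<close>.\<close>
      case (1 z)
      have "poly (iter_num d p q (Suc m)) z = 0 \<and> poly (iter_den d p q (Suc m)) z = 0" for m
      proof (induction m)
        case 0
        then show ?case using 1 deg by (simp add: hom_subst_X_one)
      next
        case (Suc m)
        then show ?case
          unfolding iter_pair.simps(2)[of d p q "Suc m"] fst_conv snd_conv poly_hom_subst
          using Suc by (simp add: hom_eval_zero d1 del: iter_pair.simps One_nat_def)
      qed
      from this[of "n - 1"] n have PQz: "poly P z = 0" "poly Q z = 0" by (simp_all add: P_def Q_def)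
      have "mult_form d n x t u = 0" if t: "t \<noteq> z" for t u
      proof (rule mult_form_common_zero)
        have f: "poly (fix_poly P Q) z = 0" using PQz by (simp add: fix_poly_def)
        have det: "0 * t - 1 * (- 1) = (1::'a)" by simp
        have w: "((- 1) * z + t) * (1 / (t - z)) = 0 * z + 1" using t by (simp add: field_simps)
        note C = conj_at_fixed_point[OF degPQ det f w]
        show "poly (moved_fix d n x t) (1 / (t - z)) = 0" unfolding fdef by (rule C(1))
        show "poly (moved_den d n x t) (1 / (t - z)) = 0" unfolding qdef C(2) PQz by simp
      qed
      then show ?thesis by blast
    next
      \<comment> \<open>A common zero at \<open>\<infinity>\<close> is moved to \<open>0\<close>.\<close>
      case 2
      have "coeff (iter_num d p q (Suc m)) (d ^ Suc m) = 0 \<and> coeff (iter_den d p q (Suc m)) (d ^ Suc m) = 0" for m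
      proof (induction m)
        case 0
        then show ?case using 2 deg by (simp add: hom_subst_X_one)
      next
        case (Suc m)
        have "coeff (iter_num d p q (Suc (Suc m))) (d * d ^ Suc m) = 0 \<and> coeff (iter_den d p q (Suc (Suc m))) (d * d ^ Suc m) = 0"
          unfolding iter_pair.simps(2)[of d p q "Suc m"] fst_conv snd_conv coeff_hom_subst_top[OF degree_iter]
          using Suc by (simp add: hom_eval_zero d1 del: iter_pair.simps One_nat_def)
        then show ?case by simp
      qed
      from this[of "n - 1"] n have PQz: "coeff P ?D = 0" "coeff Q ?D = 0" by (simp_all add: P_def Q_def)
      have dP: "coeff P (Suc ?D) = 0" using degPQ by (simp add: coeff_eq_0)
      have "mult_form d n x t u = 0" for t u
      proof (rule mult_form_common_zero)
        show "poly (moved_fix d n x t) 0 = 0"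
          unfolding fdef fix_poly_conj[OF degPQ] poly_hom_subst
          using PQz dP by (simp add: hom_eval_infinity fix_poly_def)
        show "poly (moved_den d n x t) 0 = 0"
          unfolding qdef conj_den_def poly_add poly_smult poly_hom_subst
          using PQz by (simp add: hom_eval_infinity)
      qed
      then show ?thesis by blast
    qed
  qed
  then obtain z where z: "\<And>t u. t \<noteq> z \<Longrightarrow> mult_form d n x t u = 0" by blast
  have "coeff (generic_form d n x) j = 0"
  proof (rule poly_eq_cofinite)
    have "poly (coeff (generic_form d n x) j) t = 0" if "t \<noteq> z" for t
    proof -
      have "coeff (map_poly (\<lambda>c. poly c t) (generic_form d n x)) j = 0"
        using poly_coeff_generic_form[of t 0 0] z[OF that] by simp
      then show ?thesis by (simp add: coeff_map_poly)
    qed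
    then have "{t. poly (coeff (generic_form d n x) j) t \<noteq> poly 0 t} \<subseteq> {z}" by auto
    then show "finite {t. poly (coeff (generic_form d n x) j) t \<noteq> poly 0 t}" using finite_subset by blast
  qed
  then show ?thesis by (simp add: mult_coeff_def)
qed

text \<open>
  The ratios of the coefficients do not depend on the power of \<open>t\<close>. At degenerate coordinates both
  sides vanish, so this is an identity of polynomials in the coordinates.
\<close>

lemma mult_coeff_cross:
  "mult_coeff d n x j r * mult_coeff d n x (Suc (d ^ n)) s = mult_coeff d n x j s * mult_coeff d n x (Suc (d ^ n)) r"
proof (cases "is_map d (coord_num d x) (coord_den d x)")
  case True
  then show ?thesis using mult_coeff_regular(1)[OF True, of j r] mult_coeff_regular(1)[OF True, of j s] by simp
qed (simp add: mult_coeff_degenerate)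

end

section \<open>Polynomials in several variables\<close>

type_synonym 'a mpol = "(nat \<Rightarrow>\<^sub>0 nat) \<Rightarrow>\<^sub>0 'a"

definition monom_eval :: "(nat \<Rightarrow> 'r::comm_ring_1) \<Rightarrow> (nat \<Rightarrow>\<^sub>0 nat) \<Rightarrow> 'r" where
  "monom_eval x m = (\<Prod>i\<in>Poly_Mapping.keys m. x i ^ Poly_Mapping.lookup m i)"

text \<open>
  Evaluation along a coefficient map \<open>h\<close>. With \<open>h = mpol_const\<close> it is substitution of polynomials.
\<close>

definition mpol_eval :: "('a::zero \<Rightarrow> 'r::comm_ring_1) \<Rightarrow> (nat \<Rightarrow> 'r) \<Rightarrow> 'a mpol \<Rightarrow> 'r" where
  "mpol_eval h x f = (\<Sum>m\<in>Poly_Mapping.keys f. h (Poly_Mapping.lookup f m) * monom_eval x m)"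

definition mpol_var :: "nat \<Rightarrow> 'a::comm_ring_1 mpol" where
  "mpol_var i = Poly_Mapping.single (Poly_Mapping.single i 1) 1"

definition mpol_const :: "'a::zero \<Rightarrow> 'a mpol" where
  "mpol_const c = Poly_Mapping.single 0 c"

definition total_degree :: "(nat \<Rightarrow>\<^sub>0 nat) \<Rightarrow> nat" where
  "total_degree m = (\<Sum>i\<in>Poly_Mapping.keys m. Poly_Mapping.lookup m i)"

lemma monom_eval_superset:
  assumes "finite S" "Poly_Mapping.keys m \<subseteq> S"
  shows "monom_eval x m = (\<Prod>i\<in>S. x i ^ Poly_Mapping.lookup m i)"
  unfolding monom_eval_def using assms
  by (intro prod.mono_neutral_left) (auto simp: in_keys_iff)

lemma total_degree_superset:
  assumes "finite S" "Poly_Mapping.keys m \<subseteq> S"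
  shows "total_degree m = (\<Sum>i\<in>S. Poly_Mapping.lookup m i)"
  unfolding total_degree_def using assms
  by (intro sum.mono_neutral_left) (auto simp: in_keys_iff)

lemma monom_eval_0 [simp]: "monom_eval x 0 = 1"
  by (simp add: monom_eval_def)

lemma monom_eval_single: "monom_eval x (Poly_Mapping.single i e) = x i ^ e"
  by (cases "e = 0") (simp_all add: monom_eval_def)

lemma monom_eval_add: "monom_eval x (m + n) = monom_eval x m * monom_eval x n"
proof -
  define S where "S = Poly_Mapping.keys m \<union> Poly_Mapping.keys n"
  have S: "finite S" "Poly_Mapping.keys m \<subseteq> S" "Poly_Mapping.keys n \<subseteq> S" "Poly_Mapping.keys (m + n) \<subseteq> S"
    using Poly_Mapping.keys_add[of m n] by (auto simp: S_def)
  show ?thesis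
    unfolding monom_eval_superset[OF S(1,2)] monom_eval_superset[OF S(1,3)] monom_eval_superset[OF S(1,4)]
    by (simp add: lookup_add power_add prod.distrib)
qed

lemma monom_eval_scale: "monom_eval (\<lambda>i. c * x i) m = c ^ total_degree m * monom_eval x m"
  by (simp add: monom_eval_def total_degree_def power_mult_distrib prod.distrib power_sum)

lemma total_degree_add: "total_degree (m + n) = total_degree m + total_degree n"
proof -
  define S where "S = Poly_Mapping.keys m \<union> Poly_Mapping.keys n"
  have S: "finite S" "Poly_Mapping.keys m \<subseteq> S" "Poly_Mapping.keys n \<subseteq> S" "Poly_Mapping.keys (m + n) \<subseteq> S"
    using Poly_Mapping.keys_add[of m n] by (auto simp: S_def)
  show ?thesis
    unfolding total_degree_superset[OF S(1,2)] total_degree_superset[OF S(1,3)] total_degree_superset[OF S(1,4)]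
    by (simp add: lookup_add sum.distrib)
qed

lemma mpol_eq_sum: "f = (\<Sum>m\<in>Poly_Mapping.keys f. Poly_Mapping.single m (Poly_Mapping.lookup f m))"
  by (rule poly_mapping_eqI) (auto simp: lookup_sum lookup_single when_def in_keys_iff)

context comm_ring_hom
begin

lemma mpol_eval_superset:
  assumes "finite S" "Poly_Mapping.keys f \<subseteq> S"
  shows "mpol_eval hom x f = (\<Sum>m\<in>S. hom (Poly_Mapping.lookup f m) * monom_eval x m)"
  unfolding mpol_eval_def using assms
  by (intro sum.mono_neutral_left) (auto simp: in_keys_iff)

lemma mpol_eval_single: "mpol_eval hom x (Poly_Mapping.single m c) = hom c * monom_eval x m"
  by (subst mpol_eval_superset[of "{m}"]) auto

lemma mpol_eval_add: "mpol_eval hom x (f + g) = mpol_eval hom x f + mpol_eval hom x g"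
proof -
  define S where "S = Poly_Mapping.keys f \<union> Poly_Mapping.keys g"
  have S: "finite S" "Poly_Mapping.keys f \<subseteq> S" "Poly_Mapping.keys g \<subseteq> S" "Poly_Mapping.keys (f + g) \<subseteq> S"
    using Poly_Mapping.keys_add[of f g] by (auto simp: S_def)
  show ?thesis
    unfolding mpol_eval_superset[OF S(1,2)] mpol_eval_superset[OF S(1,3)] mpol_eval_superset[OF S(1,4)]
    by (simp add: lookup_add hom_add distrib_right sum.distrib)
qed

lemma mpol_eval_0: "mpol_eval hom x 0 = 0"
  by (simp add: mpol_eval_def)

lemma mpol_eval_sum: "mpol_eval hom x (sum f S) = (\<Sum>s\<in>S. mpol_eval hom x (f s))"
  by (induction S rule: infinite_finite_induct) (simp_all add: mpol_eval_0 mpol_eval_add)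

lemma mpol_eval_mult: "mpol_eval hom x (f * g) = mpol_eval hom x f * mpol_eval hom x g"
proof -
  have "f * g = (\<Sum>m\<in>Poly_Mapping.keys f. \<Sum>n\<in>Poly_Mapping.keys g.
      Poly_Mapping.single (m + n) (Poly_Mapping.lookup f m * Poly_Mapping.lookup g n))"
    by (subst (1) mpol_eq_sum[of f], subst (1) mpol_eq_sum[of g]) (simp add: sum_product mult_single)
  then have "mpol_eval hom x (f * g) = (\<Sum>m\<in>Poly_Mapping.keys f. \<Sum>n\<in>Poly_Mapping.keys g.
      hom (Poly_Mapping.lookup f m * Poly_Mapping.lookup g n) * monom_eval x (m + n))"
    by (simp add: mpol_eval_sum mpol_eval_single)
  also have "\<dots> = mpol_eval hom x f * mpol_eval hom x g"
    by (simp add: mpol_eval_def sum_product hom_mult monom_eval_add mult_ac)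
  finally show ?thesis .
qed

lemma mpol_eval_1: "mpol_eval hom x 1 = 1"
  using mpol_eval_single[of x 0 1] by simp

lemma mpol_eval_hom: "comm_ring_hom (mpol_eval hom x)"
  by unfold_locales (simp_all add: mpol_eval_0 mpol_eval_add mpol_eval_mult mpol_eval_1)

lemma mpol_eval_var: "mpol_eval hom x (mpol_var i) = x i"
  by (simp add: mpol_var_def mpol_eval_single monom_eval_single)

lemma mpol_eval_const: "mpol_eval hom x (mpol_const c) = hom c"
  by (simp add: mpol_const_def mpol_eval_single)

lemma mpol_eval_homogeneous:
  assumes "mpoly_homogeneous D f"
  shows "mpol_eval hom (\<lambda>i. c * x i) f = c ^ D * mpol_eval hom x f"
  using assms unfolding mpol_eval_def mpoly_homogeneous_def total_degree_def[symmetric]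
  by (auto simp: monom_eval_scale sum_distrib_left mult_ac intro!: sum.cong)

end

lemma mpol_eval_hom_comp:
  assumes "comm_ring_hom g"
  shows "g (mpol_eval h x f) = mpol_eval (\<lambda>c. g (h c)) (\<lambda>i. g (x i)) f"
proof -
  interpret g: comm_ring_hom g by fact
  show ?thesis by (simp add: mpol_eval_def monom_eval_def g.hom_sum g.hom_mult g.hom_prod g.hom_power)
qed

lemma comm_ring_hom_mpol_const: "comm_ring_hom (mpol_const :: 'a::comm_ring_1 \<Rightarrow> 'a mpol)"
  by unfold_locales (simp_all add: mpol_const_def single_add mult_single)

text \<open>
  Induction on the set of variables: fixing the others, the sum is a polynomial in the variable \<open>j\<close>,
  whose coefficients are sums of the same kind in fewer variables.
\<close>

lemma monomials_independent_aux:
  fixes a :: "(nat \<Rightarrow>\<^sub>0 nat) \<Rightarrow> 'r::idom"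
  assumes inf: "infinite (UNIV :: 'r set)" and I: "finite I"
  shows "finite S \<Longrightarrow> (\<forall>m\<in>S. \<forall>n\<in>S. (\<forall>i\<in>I. Poly_Mapping.lookup m i = Poly_Mapping.lookup n i) \<longrightarrow> m = n) \<Longrightarrow>
    (\<forall>x. (\<Sum>m\<in>S. a m * (\<Prod>i\<in>I. x i ^ Poly_Mapping.lookup m i)) = 0) \<Longrightarrow> \<forall>m\<in>S. a m = 0"
  using I
proof (induction I arbitrary: S rule: finite_induct)
  case empty
  then have "\<forall>m\<in>S. \<forall>n\<in>S. m = n" by simp
  show ?case
  proof
    fix m assume m: "m \<in> S"
    hence "S = {m}" using \<open>\<forall>m\<in>S. \<forall>n\<in>S. m = n\<close> by auto
    then show "a m = 0" using empty by simp
  qed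
next
  case (insert j I)
  show ?case
  proof
    fix m0 assume m0: "m0 \<in> S"
    define e where "e = Poly_Mapping.lookup m0 j"
    define T where "T = {m \<in> S. Poly_Mapping.lookup m j = e}"
    have "\<forall>m\<in>T. a m = 0"
    proof (rule insert.IH)
      show "finite T" using insert by (simp add: T_def)
      show "\<forall>m\<in>T. \<forall>n\<in>T. (\<forall>i\<in>I. Poly_Mapping.lookup m i = Poly_Mapping.lookup n i) \<longrightarrow> m = n"
        using insert.prems(2) by (auto simp: T_def)
      show "\<forall>x. (\<Sum>m\<in>T. a m * (\<Prod>i\<in>I. x i ^ Poly_Mapping.lookup m i)) = 0"
      proof
        fix x :: "nat \<Rightarrow> 'r"
        define c where "c m = a m * (\<Prod>i\<in>I. x i ^ Poly_Mapping.lookup m i)" for m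
        define p where "p = (\<Sum>m\<in>S. monom (c m) (Poly_Mapping.lookup m j))"
        have "poly p t = 0" for t
        proof -
          have "(\<Sum>m\<in>S. a m * (\<Prod>i\<in>insert j I. (x(j := t)) i ^ Poly_Mapping.lookup m i)) = 0"
            using insert.prems(3) by blast
          also have "(\<Sum>m\<in>S. a m * (\<Prod>i\<in>insert j I. (x(j := t)) i ^ Poly_Mapping.lookup m i)) =
              (\<Sum>m\<in>S. c m * t ^ Poly_Mapping.lookup m j)"
          proof (intro sum.cong refl)
            fix m
            have "(\<Prod>i\<in>I. (x(j := t)) i ^ Poly_Mapping.lookup m i) = (\<Prod>i\<in>I. x i ^ Poly_Mapping.lookup m i)"
              using insert(2) by (intro prod.cong) auto
            then show "a m * (\<Prod>i\<in>insert j I. (x(j := t)) i ^ Poly_Mapping.lookup m i) = c m * t ^ Poly_Mapping.lookup m j"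
              using insert(1,2) by (simp add: c_def mult_ac)
          qed
          finally show "poly p t = 0" by (simp add: p_def poly_sum poly_monom)
        qed
        hence "{t. poly p t = 0} = UNIV" by auto
        hence "p = 0" using poly_roots_finite[of p] inf by auto
        hence "coeff p e = 0" by simp
        also have "coeff p e = (\<Sum>m\<in>S. if Poly_Mapping.lookup m j = e then c m else 0)"
          by (simp add: p_def coeff_sum)
        also have "\<dots> = (\<Sum>m\<in>T. c m)"
          unfolding T_def using insert.prems(1) by (simp add: sum.inter_filter)
        finally show "(\<Sum>m\<in>T. a m * (\<Prod>i\<in>I. x i ^ Poly_Mapping.lookup m i)) = 0" by (simp add: c_def)
      qed
    qed
    then show "a m0 = 0" using m0 by (simp add: T_def e_def)
  qed
qed

lemma monomials_independent:
  fixes a :: "(nat \<Rightarrow>\<^sub>0 nat) \<Rightarrow> 'r::idom"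
  assumes inf: "infinite (UNIV :: 'r set)" and S: "finite S"
    and eq: "\<And>x. (\<Sum>m\<in>S. a m * monom_eval x m) = 0" and m: "m \<in> S"
  shows "a m = 0"
proof -
  define I where "I = (\<Union>m\<in>S. Poly_Mapping.keys m)"
  have I: "finite I" using S by (simp add: I_def)
  have "\<forall>m\<in>S. a m = 0"
  proof (rule monomials_independent_aux[OF inf I S])
    show "\<forall>m\<in>S. \<forall>n\<in>S. (\<forall>i\<in>I. Poly_Mapping.lookup m i = Poly_Mapping.lookup n i) \<longrightarrow> m = n"
    proof (intro ballI impI poly_mapping_eqI)
      fix m n i assume "m \<in> S" "n \<in> S" "\<forall>i\<in>I. Poly_Mapping.lookup m i = Poly_Mapping.lookup n i"
      then show "Poly_Mapping.lookup m i = Poly_Mapping.lookup n i"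
        by (cases "i \<in> I") (auto simp: I_def in_keys_iff)
    qed
    have "monom_eval x m = (\<Prod>i\<in>I. x i ^ Poly_Mapping.lookup m i)" if "m \<in> S" for m and x :: "nat \<Rightarrow> 'r"
      using that by (intro monom_eval_superset I) (auto simp: I_def)
    then show "\<forall>x. (\<Sum>m\<in>S. a m * (\<Prod>i\<in>I. x i ^ Poly_Mapping.lookup m i)) = 0"
      using eq by (metis (no_types, lifting) sum.cong)
  qed
  then show ?thesis using m by blast
qed

text \<open>
  A polynomial that vanishes at all points of an infinite domain is zero.
\<close>

lemma mpol_eval_eq_0_imp:
  fixes h :: "'a::comm_ring_1 \<Rightarrow> 'r::idom"
  assumes "inj_comm_ring_hom h" "infinite (UNIV :: 'r set)" "\<And>x. mpol_eval h x f = 0"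
  shows "f = 0"
proof -
  interpret h: inj_comm_ring_hom h by fact
  have "h (Poly_Mapping.lookup f m) = 0" if "m \<in> Poly_Mapping.keys f" for m
    by (rule monomials_independent[OF assms(2) finite_keys _ that]) (use assms(3) in \<open>simp add: mpol_eval_def\<close>)
  hence "Poly_Mapping.lookup f m = 0" for m by (cases "m \<in> Poly_Mapping.keys f") (auto simp: in_keys_iff)
  then show ?thesis by (intro poly_mapping_eqI) simp
qed

text \<open>
  A polynomial function that scales with degree \<open>D\<close> agrees with the homogeneous part of degree \<open>D\<close> of
  any polynomial that represents it. Monomials with variables outside of \<open>V\<close> vanish at the points in
  question and are dropped.
\<close>

lemma homogeneous_part:
  fixes f :: "'a::comm_ring_1 mpol" and h :: "'a \<Rightarrow> 'r::idom"
  assumes h: "comm_ring_hom h" and inf: "infinite (UNIV :: 'r set)"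
    and scale: "\<And>c x. mpol_eval h (\<lambda>i. c * x i) f = c ^ D * mpol_eval h x f"
  obtains g where "mpoly_vars g \<subseteq> V" "mpoly_homogeneous D g"
    "\<And>x. (\<forall>i. i \<notin> V \<longrightarrow> x i = 0) \<Longrightarrow> mpol_eval h x g = mpol_eval h x f"
proof -
  interpret h: comm_ring_hom h by fact
  define S where "S = {m \<in> Poly_Mapping.keys f. total_degree m = D \<and> Poly_Mapping.keys m \<subseteq> V}"
  define g where "g = (\<Sum>m\<in>S. Poly_Mapping.single m (Poly_Mapping.lookup f m))"
  have S: "finite S" by (simp add: S_def)
  have kg: "Poly_Mapping.keys g \<subseteq> S"
    unfolding g_def using keys_sum[of "\<lambda>m. Poly_Mapping.single m (Poly_Mapping.lookup f m)" S] by (auto split: if_splits)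
  show ?thesis
  proof
    show "mpoly_vars g \<subseteq> V" using kg by (auto simp: mpoly_vars_def S_def)
    show "mpoly_homogeneous D g"
      unfolding mpoly_homogeneous_def total_degree_def[symmetric] using kg by (auto simp: S_def)
    fix x :: "nat \<Rightarrow> 'r" assume x: "\<forall>i. i \<notin> V \<longrightarrow> x i = 0"
    define c where "c m = h (Poly_Mapping.lookup f m) * monom_eval x m" for m
    define p where "p = (\<Sum>m\<in>Poly_Mapping.keys f. monom (c m) (total_degree m))"
    have "poly p t = poly (monom (mpol_eval h x f) D) t" for t
    proof -
      have "poly p t = mpol_eval h (\<lambda>i. t * x i) f"
        by (simp add: p_def c_def poly_sum poly_monom mpol_eval_def monom_eval_scale mult_ac)
      then show ?thesis by (simp add: scale poly_monom mult_ac)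
    qed
    hence "{t. poly (p - monom (mpol_eval h x f) D) t = 0} = UNIV" by auto
    hence "p = monom (mpol_eval h x f) D" using poly_roots_finite[of "p - monom (mpol_eval h x f) D"] inf by auto
    hence "mpol_eval h x f = coeff p D" by simp
    also have "\<dots> = (\<Sum>m\<in>Poly_Mapping.keys f. if total_degree m = D then c m else 0)"
      by (simp add: p_def coeff_sum)
    also have "\<dots> = (\<Sum>m\<in>{m \<in> Poly_Mapping.keys f. total_degree m = D}. c m)"
      by (simp add: sum.inter_filter)
    also have "\<dots> = (\<Sum>m\<in>S. c m)"
    proof (rule sum.mono_neutral_right)
      show "\<forall>m\<in>{m \<in> Poly_Mapping.keys f. total_degree m = D} - S. c m = 0"
      proof
        fix m assume "m \<in> {m \<in> Poly_Mapping.keys f. total_degree m = D} - S"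
        then obtain i where "i \<in> Poly_Mapping.keys m" "i \<notin> V" by (auto simp: S_def)
        then have "monom_eval x m = 0"
          unfolding monom_eval_def using x by (intro prod_zero) (auto simp: in_keys_iff intro!: bexI[of _ i])
        then show "c m = 0" by (simp add: c_def)
      qed
    qed (auto simp: S_def)
    also have "\<dots> = mpol_eval h x g"
      by (simp add: g_def h.mpol_eval_sum h.mpol_eval_single c_def)
    finally show "mpol_eval h x g = mpol_eval h x f" by simp
  qed
qed


section \<open>Bounded exponents\<close>

text \<open>
  Bounding each exponent, rather than the total degree, makes the monomials easy to count.
\<close>

definition boxed :: "nat set \<Rightarrow> nat \<Rightarrow> 'a::zero mpol \<Rightarrow> bool" where
  "boxed I e f \<longleftrightarrow> (\<forall>m\<in>Poly_Mapping.keys f. Poly_Mapping.keys m \<subseteq> I \<and> (\<forall>i. Poly_Mapping.lookup m i \<le> e))"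

lemma boxed_mono: "boxed I e f \<Longrightarrow> e \<le> e' \<Longrightarrow> boxed I e' f"
  unfolding boxed_def using le_trans by blast

lemma boxed_add: "boxed I e f \<Longrightarrow> boxed I e g \<Longrightarrow> boxed I e (f + g)" for f :: "'a::monoid_add mpol"
  using Poly_Mapping.keys_add[of f g] by (fastforce simp: boxed_def)

lemma boxed_sum: "(\<And>s. s \<in> S \<Longrightarrow> boxed I e (f s)) \<Longrightarrow> boxed I e (sum f S)"
  for f :: "_ \<Rightarrow> 'a::comm_monoid_add mpol"
proof (induction S rule: infinite_finite_induct)
  case (insert x F)
  then show ?case by (simp add: boxed_add)
qed (auto simp: boxed_def)

lemma boxed_mult:
  fixes f g :: "'a::comm_ring_1 mpol"
  assumes "boxed I e f" "boxed I e' g"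
  shows "boxed I (e + e') (f * g)"
  unfolding boxed_def
proof (intro ballI conjI allI)
  fix k assume "k \<in> Poly_Mapping.keys (f * g)"
  then obtain m n where k: "k = m + n" "m \<in> Poly_Mapping.keys f" "n \<in> Poly_Mapping.keys g"
    using Poly_Mapping.keys_mult[of f g] by blast
  show "Poly_Mapping.keys k \<subseteq> I"
    using k assms Poly_Mapping.keys_add[of m n] by (fastforce simp: boxed_def)
  fix i
  have "Poly_Mapping.lookup m i \<le> e" "Poly_Mapping.lookup n i \<le> e'"
    using k assms by (auto simp: boxed_def)
  then show "Poly_Mapping.lookup k i \<le> e + e'" by (simp add: k lookup_add)
qed

lemma boxed_const: "boxed I 0 (mpol_const c)"
  by (simp add: boxed_def mpol_const_def)

lemma boxed_one: "boxed I 0 (1 :: 'a::comm_ring_1 mpol)"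
  by (simp add: boxed_def)

lemma boxed_zero: "boxed I e 0"
  by (simp add: boxed_def)

lemma boxed_var: "i \<in> I \<Longrightarrow> boxed I 1 (mpol_var i)"
  by (auto simp: boxed_def mpol_var_def lookup_single when_def)

lemma boxed_power: "boxed I e f \<Longrightarrow> boxed I (k * e) (f ^ k)" for f :: "'a::comm_ring_1 mpol"
proof (induction k)
  case (Suc k)
  then show ?case using boxed_mult[of I e f "k * e" "f ^ k"] by simp
qed (simp add: boxed_one)

lemma boxed_prod: "(\<And>s. s \<in> S \<Longrightarrow> boxed I (e s) (f s)) \<Longrightarrow> boxed I (sum e S) (prod f S)"
  for f :: "_ \<Rightarrow> 'a::comm_ring_1 mpol"
proof (induction S rule: infinite_finite_induct)
  case (insert x F)
  then show ?case by (simp add: boxed_mult)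
qed (auto simp: boxed_one)

lemma boxed_monom_eval:
  fixes x :: "nat \<Rightarrow> 'a::comm_ring_1 mpol"
  assumes "\<And>i. i \<in> Poly_Mapping.keys m \<Longrightarrow> boxed I e (x i)"
  shows "boxed I (total_degree m * e) (monom_eval x m)"
proof -
  have "boxed I (\<Sum>i\<in>Poly_Mapping.keys m. Poly_Mapping.lookup m i * e) (monom_eval x m)"
    unfolding monom_eval_def using assms by (intro boxed_prod boxed_power)
  then show ?thesis by (simp add: total_degree_def sum_distrib_right)
qed

lemma ex_boxed_mpol_eval:
  fixes x :: "nat \<Rightarrow> 'a::comm_ring_1 mpol"
  assumes "\<And>i. boxed I e (x i)"
  shows "\<exists>E. boxed I E (mpol_eval mpol_const x f)"
proof -
  define E where "E = Max (insert 0 (total_degree ` Poly_Mapping.keys f))"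
  have "boxed I (E * e) (mpol_eval mpol_const x f)"
    unfolding mpol_eval_def
  proof (rule boxed_sum)
    fix m assume m: "m \<in> Poly_Mapping.keys f"
    hence "total_degree m \<le> E" by (simp add: E_def)
    moreover have "boxed I (0 + total_degree m * e) (mpol_const (Poly_Mapping.lookup f m) * monom_eval x m)"
      by (intro boxed_mult boxed_const boxed_monom_eval assms)
    moreover have "0 + total_degree m * e \<le> E * e" using \<open>total_degree m \<le> E\<close> by simp
    ultimately show "boxed I (E * e) (mpol_const (Poly_Mapping.lookup f m) * monom_eval x m)"
      using boxed_mono by blast
  qed
  then show ?thesis by blast
qed

definition box_monomials :: "nat set \<Rightarrow> nat \<Rightarrow> (nat \<Rightarrow>\<^sub>0 nat) set" where
  "box_monomials I e = {m. Poly_Mapping.keys m \<subseteq> I \<and> (\<forall>i. Poly_Mapping.lookup m i \<le> e)}"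

lemma box_monomials_card:
  assumes "finite I"
  shows "finite (box_monomials I e)" "card (box_monomials I e) = (e + 1) ^ card I"
proof -
  let ?r = "\<lambda>m. restrict (Poly_Mapping.lookup m) I"
  have inj: "inj_on ?r (box_monomials I e)"
  proof (rule inj_onI, rule poly_mapping_eqI)
    fix m n i assume mn: "m \<in> box_monomials I e" "n \<in> box_monomials I e" and eq: "?r m = ?r n"
    show "Poly_Mapping.lookup m i = Poly_Mapping.lookup n i"
    proof (cases "i \<in> I")
      case True
      then show ?thesis using fun_cong[OF eq, of i] by simp
    next
      case False
      then have "i \<notin> Poly_Mapping.keys m" "i \<notin> Poly_Mapping.keys n" using mn by (auto simp: box_monomials_def)
      then show ?thesis by (simp add: in_keys_iff)
    qed
  qed
  have im: "?r ` box_monomials I e = (I \<rightarrow>\<^sub>E {..e})"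
  proof
    show "?r ` box_monomials I e \<subseteq> (I \<rightarrow>\<^sub>E {..e})" by (auto simp: box_monomials_def)
    show "(I \<rightarrow>\<^sub>E {..e}) \<subseteq> ?r ` box_monomials I e"
    proof
      fix g assume g: "g \<in> (I \<rightarrow>\<^sub>E {..e})"
      define m where "m = Poly_Mapping.Abs_poly_mapping (\<lambda>i. if i \<in> I then g i else 0)"
      have "finite {i. (if i \<in> I then g i else 0) \<noteq> 0}" using assms by (rule rev_finite_subset) auto
      hence l: "Poly_Mapping.lookup m i = (if i \<in> I then g i else 0)" for i by (simp add: m_def)
      have "Poly_Mapping.lookup m i \<le> e" for i using PiE_mem[OF g, of i] by (simp add: l)
      moreover have "Poly_Mapping.keys m \<subseteq> I" by (auto simp: in_keys_iff l split: if_splits)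
      ultimately have "m \<in> box_monomials I e" by (simp add: box_monomials_def)
      moreover have "?r m = g"
      proof
        fix i show "?r m i = g i" using PiE_arb[OF g, of i] by (simp add: l restrict_def)
      qed
      ultimately show "g \<in> ?r ` box_monomials I e" by blast
    qed
  qed
  have fin: "finite (I \<rightarrow>\<^sub>E {..e})" using assms by (intro finite_PiE) auto
  show "finite (box_monomials I e)" using inj im fin finite_image_iff by metis
  have "card (box_monomials I e) = card (I \<rightarrow>\<^sub>E {..e})" using card_image[OF inj] im by metis
  also have "\<dots> = (e + 1) ^ card I" using assms by (simp add: card_PiE)
  finally show "card (box_monomials I e) = (e + 1) ^ card I" .
qed

global_interpretation mpol: vector_space "\<lambda>(c::'a::field) f. mpol_const c * (f :: 'a mpol)"
proof -
  interpret comm_ring_hom "mpol_const :: 'a \<Rightarrow> 'a mpol" by (rule comm_ring_hom_mpol_const)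
  show "vector_space (\<lambda>(c::'a) f. mpol_const c * f)"
    by unfold_locales (simp_all add: algebra_simps hom_add hom_mult)
qed

lemma boxed_in_span:
  fixes f :: "'a::field mpol"
  assumes "boxed I e f"
  shows "f \<in> mpol.span ((\<lambda>m. Poly_Mapping.single m 1) ` box_monomials I e)"
proof -
  have "f = (\<Sum>m\<in>Poly_Mapping.keys f. mpol_const (Poly_Mapping.lookup f m) * Poly_Mapping.single m 1)"
    by (subst mpol_eq_sum) (simp add: mpol_const_def mult_single)
  also have "\<dots> \<in> mpol.span ((\<lambda>m. Poly_Mapping.single m 1) ` box_monomials I e)"
    using assms by (intro mpol.span_sum mpol.span_scale mpol.span_base) (auto simp: boxed_def box_monomials_def)
  finally show ?thesis .
qed

section \<open>Counting dimensions\<close>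

text \<open>
  A variant for families, in which the members need not be known to be distinct beforehand.
\<close>

lemma (in vector_space) family_card_le:
  assumes A: "finite A" and T: "finite T" and sub: "u ` A \<subseteq> span T"
    and indep: "\<And>a t. (\<Sum>t\<in>A. scale (a t) (u t)) = 0 \<Longrightarrow> t \<in> A \<Longrightarrow> a t = 0"
  shows "card A \<le> card T"
proof -
  have inj: "inj_on u A"
  proof (rule inj_onI, rule ccontr)
    fix s t assume st: "s \<in> A" "t \<in> A" "u s = u t" "s \<noteq> t"
    define a where "a x = (if x = s then 1 else if x = t then - 1 else (0::'a))" for x
    have "(\<Sum>x\<in>A. scale (a x) (u x)) = (\<Sum>x\<in>{s, t}. scale (a x) (u x))"
      using A st by (intro sum.mono_neutral_right) (auto simp: a_def)
    also have "\<dots> = 0" using st by (simp add: a_def)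
    finally have "a s = 0" using indep st by blast
    then show False by (simp add: a_def)
  qed
  have "independent (u ` A)"
  proof
    assume "dependent (u ` A)"
    then obtain f v where f: "v \<in> u ` A" "f v \<noteq> 0" "(\<Sum>v\<in>u ` A. scale (f v) v) = 0"
      using A by (auto simp: dependent_finite)
    then obtain t where t: "t \<in> A" "v = u t" by blast
    have "(\<Sum>t\<in>A. scale (f (u t)) (u t)) = 0" using f(3) inj by (simp add: sum.reindex)
    from indep[OF this t(1)] show False using f t by simp
  qed
  from independent_span_bound[OF T this sub] show ?thesis by (simp add: card_image[OF inj])
qed

definition form_monomials :: "nat \<Rightarrow> nat \<Rightarrow> (nat \<Rightarrow>\<^sub>0 nat) set" where
  "form_monomials M w = {b. Poly_Mapping.keys b \<subseteq> {..M} \<and> total_degree b = w}"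

lemma finite_form_monomials: "finite (form_monomials M w)"
proof (rule finite_subset)
  show "form_monomials M w \<subseteq> box_monomials {..M} w"
  proof
    fix b assume b: "b \<in> form_monomials M w"
    have "Poly_Mapping.lookup b i \<le> w" for i
    proof (cases "i \<in> Poly_Mapping.keys b")
      case True
      hence "Poly_Mapping.lookup b i \<le> total_degree b"
        unfolding total_degree_def by (intro member_le_sum) auto
      then show ?thesis using b by (simp add: form_monomials_def)
    qed (simp add: in_keys_iff)
    then show "b \<in> box_monomials {..M} w" using b by (simp add: box_monomials_def form_monomials_def)
  qed
  show "finite (box_monomials {..M} w)" by (rule box_monomials_card) simp
qed

text \<open>
  The values at \<open>G\<^sub>0, \<dots>, G\<^sub>M\<close> of the forms of degree \<open>w\<close>.
\<close>

definition form_space :: "nat \<Rightarrow> (nat \<Rightarrow> 'a::field mpol) \<Rightarrow> nat \<Rightarrow> 'a mpol set" where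
  "form_space M G w = mpol.span (monom_eval G ` form_monomials M w)"

lemma form_space_eval:
  fixes G :: "nat \<Rightarrow> 'a::field mpol"
  assumes "v \<in> form_space M G w"
  obtains W where "mpoly_homogeneous w W" "mpoly_vars W \<subseteq> {..M}" "v = mpol_eval mpol_const G W"
proof -
  interpret mc: comm_ring_hom "mpol_const :: 'a \<Rightarrow> 'a mpol" by (rule comm_ring_hom_mpol_const)
  define T where "T = form_monomials M w"
  have "\<exists>W. Poly_Mapping.keys W \<subseteq> T \<and> v = mpol_eval mpol_const G W"
    using assms unfolding form_space_def T_def[symmetric]
  proof (induction rule: mpol.span_induct_alt)
    case base
    then show ?case by (intro exI[of _ 0]) (simp add: mc.mpol_eval_0)
  next
    case (step c x y)
    then obtain W b where W: "Poly_Mapping.keys W \<subseteq> T" "y = mpol_eval mpol_const G W" and b: "b \<in> T" "x = monom_eval G b"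
      by auto
    have "Poly_Mapping.keys (Poly_Mapping.single b c + W) \<subseteq> T"
      using Poly_Mapping.keys_add[of "Poly_Mapping.single b c" W] W(1) b(1) by (auto split: if_splits)
    moreover have "mpol_const c * x + y = mpol_eval mpol_const G (Poly_Mapping.single b c + W)"
      by (simp add: mc.mpol_eval_add mc.mpol_eval_single W b)
    ultimately show ?case by blast
  qed
  then obtain W where "Poly_Mapping.keys W \<subseteq> T" "v = mpol_eval mpol_const G W" by blast
  then show ?thesis
    by (intro that[of W]) (auto simp: mpoly_homogeneous_def total_degree_def[symmetric] mpoly_vars_def T_def form_monomials_def)
qed

text \<open>
  With \<open>m\<close> variables, the products of \<open>1, X\<^sub>i, \<dots>, X\<^sub>i\<^sup>S\<close> with a basis \<open>B\<close> of the values of the forms of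
  degree \<open>w = m S\<close> are \<open>(S + 1) card B\<close> polynomials, which is at least \<open>(S + 1)\<^bsup>m+1\<^esup> / C\<close>. They lie in a
  box with at most \<open>((E m + 1) (S + 1))\<^sup>m\<close> monomials. For \<open>S = C (E m + 1)\<^sup>m\<close> they are
  therefore dependent. Collecting powers of \<open>X\<^sub>i\<close> in the dependency gives the relation, and the independence of \<open>B\<close>
  shows that not all of its coefficients vanish.
\<close>

lemma algebraic_relation_from_growth:
  fixes G :: "nat \<Rightarrow> 'a::field mpol"
  assumes I: "finite I" and G: "\<And>j. j \<le> M \<Longrightarrow> boxed I E (G j)"
    and growth: "\<And>N. (N + 1) ^ card I \<le> C * mpol.dim (form_space M G (card I * N))"
    and i: "i \<in> I"
  obtains w S W where "\<And>s. s \<le> S \<Longrightarrow> mpoly_homogeneous w (W s)" "\<And>s. s \<le> S \<Longrightarrow> mpoly_vars (W s) \<subseteq> {..M}"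
    "(\<Sum>s\<le>S. mpol_var i ^ s * mpol_eval mpol_const G (W s)) = 0"
    "\<exists>s\<le>S. mpol_eval mpol_const G (W s) \<noteq> 0"
proof -
  define m where "m = card I"
  \<comment> \<open>The choice of \<open>S\<close> makes \<open>(S + 1) (S + 1)\<^sup>m\<close> exceed \<open>C\<close> times the number of monomials in the box.\<close>
  define S where "S = C * (E * m + 1) ^ m"
  define w where "w = m * S"
  obtain B where B: "B \<subseteq> monom_eval G ` form_monomials M w" "mpol.independent B"
      "form_space M G w \<subseteq> mpol.span B" "card B = mpol.dim (monom_eval G ` form_monomials M w)"
    using mpol.basis_exists[of "monom_eval G ` form_monomials M w"] mpol.span_minimal[of "monom_eval G ` form_monomials M w"]
      mpol.subspace_span unfolding form_space_def by metis
  have fB: "finite B" using B(1) finite_form_monomials finite_surj by blast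
  have cB: "card B = mpol.dim (form_space M G w)" using B(4) by (simp add: form_space_def)
  have Bspace: "B \<subseteq> form_space M G w" using B(1) unfolding form_space_def using mpol.span_superset by blast
  have boxB: "boxed I (w * E) v" if vB: "v \<in> B" for v
  proof -
    obtain b where b: "b \<in> form_monomials M w" "v = monom_eval G b" using vB B(1) by blast
    have "boxed I (total_degree b * E) (monom_eval G b)"
      using b(1) G by (intro boxed_monom_eval) (auto simp: form_monomials_def)
    then show ?thesis using b by (simp add: form_monomials_def)
  qed
  define u where "u = (\<lambda>(s, v). mpol_var i ^ s * v :: 'a mpol)"
  define A where "A = {..S} \<times> B"
  let ?T = "(\<lambda>m. Poly_Mapping.single m (1::'a)) ` box_monomials I (S + w * E)"
  have "\<exists>a. (\<Sum>t\<in>A. mpol_const (a t) * u t) = 0 \<and> (\<exists>t\<in>A. a t \<noteq> 0)"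
  proof (rule ccontr)
    assume neg: "\<not> ?thesis"
    have "card A \<le> card ?T"
    proof (rule mpol.family_card_le)
      show "finite A" using fB by (simp add: A_def)
      show "finite ?T" using box_monomials_card(1)[OF I] by simp
      show "u ` A \<subseteq> mpol.span ?T"
      proof
        fix y assume "y \<in> u ` A"
        then obtain s v where y: "s \<le> S" "v \<in> B" "y = mpol_var i ^ s * v" by (auto simp: A_def u_def)
        have "boxed I (s * 1 + w * E) y" unfolding y(3) by (intro boxed_mult boxed_power boxed_var i boxB y)
        hence "boxed I (S + w * E) y" by (rule boxed_mono) (use y in simp)
        then show "y \<in> mpol.span ?T" by (rule boxed_in_span)
      qed
      fix a t assume "(\<Sum>t\<in>A. mpol_const (a t) * u t) = 0" "t \<in> A"
      then show "a t = 0" using neg by blast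
    qed
    also have "card ?T \<le> (S + w * E + 1) ^ m"
      using card_image_le[OF box_monomials_card(1)[OF I], of _ "S + w * E"] box_monomials_card(2)[OF I] by (metis m_def)
    also have "S + w * E + 1 \<le> (E * m + 1) * (S + 1)" by (simp add: w_def algebra_simps)
    hence "(S + w * E + 1) ^ m \<le> ((E * m + 1) * (S + 1)) ^ m" by (rule power_mono) simp
    finally have "(S + 1) * card B \<le> (E * m + 1) ^ m * (S + 1) ^ m"
      unfolding power_mult_distrib by (simp only: A_def card_cartesian_product card_atMost Suc_eq_plus1)
    hence "C * ((S + 1) * card B) \<le> S * (S + 1) ^ m"
      unfolding S_def[of] by (metis mult.assoc mult_le_mono2 S_def)
    moreover have "(S + 1) ^ m \<le> C * card B" using growth[of S] unfolding cB w_def m_def .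
    hence "(S + 1) * (S + 1) ^ m \<le> (S + 1) * (C * card B)" by (rule mult_le_mono2)
    ultimately have "(S + 1) * (S + 1) ^ m \<le> S * (S + 1) ^ m"
      unfolding mult.left_commute[of "S + 1" C "card B"] by (rule order_trans[rotated])
    then show False by simp
  qed
  then obtain a t0 where a: "(\<Sum>t\<in>A. mpol_const (a t) * u t) = 0" "t0 \<in> A" "a t0 \<noteq> 0" by blast
  define v where "v s = (\<Sum>b\<in>B. mpol_const (a (s, b)) * b)" for s
  have "v s \<in> form_space M G w" for s
    unfolding v_def using Bspace
    unfolding form_space_def by (intro mpol.span_sum mpol.span_scale) auto
  hence "\<forall>s. \<exists>W. mpoly_homogeneous w W \<and> mpoly_vars W \<subseteq> {..M} \<and> v s = mpol_eval mpol_const G W"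
    using form_space_eval by metis
  then obtain W where W: "\<And>s. mpoly_homogeneous w (W s)" "\<And>s. mpoly_vars (W s) \<subseteq> {..M}" "\<And>s. v s = mpol_eval mpol_const G (W s)"
    by metis
  show ?thesis
  proof (rule that[of S w W])
    have "(\<Sum>s\<le>S. mpol_var i ^ s * v s) = (\<Sum>s\<le>S. \<Sum>b\<in>B. mpol_const (a (s, b)) * (mpol_var i ^ s * b))"
      by (simp add: v_def sum_distrib_left mult_ac)
    also have "\<dots> = (\<Sum>t\<in>A. mpol_const (a t) * u t)"
      using fB by (simp add: A_def u_def sum.cartesian_product case_prod_unfold)
    finally show "(\<Sum>s\<le>S. mpol_var i ^ s * mpol_eval mpol_const G (W s)) = 0" using a(1) W(3) by simp
    obtain s b where sb: "t0 = (s, b)" "s \<le> S" "b \<in> B" using a(2) by (auto simp: A_def)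
    have "v s \<noteq> 0"
    proof
      assume "v s = 0"
      hence "a (s, b) = 0" unfolding v_def using B(2) fB sb(3) by (auto simp: mpol.dependent_finite)
      with a(3) sb show False by simp
    qed
    then show "\<exists>s\<le>S. mpol_eval mpol_const G (W s) \<noteq> 0" using sb W(3) by auto
  qed (use W in auto)
qed


section \<open>A lower bound for the growth\<close>

text \<open>
  Functions of the direction \<open>h\<close> with values in power series, as a vector space over the field of
  constants. The estimate below is a comparison of dimensions in this space.
\<close>

global_interpretation fun_fps: vector_space "\<lambda>(c::'a::field) (f :: 'b \<Rightarrow> 'a fps). (\<lambda>h. fps_const c * f h)"
  by unfold_locales (auto simp: fun_eq_iff algebra_simps simp flip: fps_const_add fps_const_mult)

lemma sum_fun_apply: "sum f S x = (\<Sum>s\<in>S. f s x)" for f :: "'b \<Rightarrow> 'c \<Rightarrow> 'a::comm_monoid_add"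
  by (induction S rule: infinite_finite_induct) simp_all

lemma comm_ring_hom_fps_const: "comm_ring_hom (fps_const :: 'a::comm_ring_1 \<Rightarrow> 'a fps)"
  by unfold_locales simp_all

lemma comm_ring_hom_fps_nth_0: "comm_ring_hom (\<lambda>f :: 'a::comm_ring_1 fps. fps_nth f 0)"
  by unfold_locales simp_all

text \<open>
  Here \<open>c\<^sub>j = G\<^sub>j / G\<^sub>M\<close> are the coefficients of a monic polynomial of degree \<open>M\<close> that has the roots
  \<open>- lam \<zeta>\<close>, and \<open>\<nu>\<^sub>i\<close> are linear combinations of the \<open>lam \<zeta>\<close> with the expansion \<open>h\<^sub>i \<epsilon> + \<dots>\<close>.

  On the one hand, the \<open>(N + 1)\<^sup>m\<close> monomials in the \<open>\<nu>\<^sub>i\<close> with exponents at most \<open>N\<close>, \<open>m = card I\<close>, are linearly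
  independent: in a vanishing combination the lowest order terms in \<open>\<epsilon>\<close> form a vanishing polynomial in
  \<open>h\<close>. On the other hand, they lie in the space \<open>A w\<close> with \<open>w = m N\<close>, which is spanned by the products of
  a monomial in the \<open>lam \<zeta>\<close> with exponents below \<open>M\<close> and a monomial of degree \<open>w\<close> in the \<open>c\<^sub>j\<close>; each
  multiplication by \<open>lam \<zeta>\<close> raises \<open>w\<close> by at most one, because \<open>(lam \<zeta>)\<^sup>M\<close> is replaced by a
  combination of lower powers that is linear in the \<open>c\<^sub>j\<close>. There are \<open>M\<^bsup>card Z\<^esup>\<close> monomials of the first
  kind, and the second kind contributes the dimension of the forms of degree \<open>w\<close> in the \<open>G\<^sub>j\<close>.
\<close>

lemma growth_bound:
  fixes G :: "nat \<Rightarrow> 'a::field mpol" and k :: "'a \<Rightarrow> 'r::field"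
    and \<nu> :: "nat \<Rightarrow> (nat \<Rightarrow> 'r) \<Rightarrow> 'r fps" and lam :: "'z \<Rightarrow> (nat \<Rightarrow> 'r) \<Rightarrow> 'r fps"
    and c :: "nat \<Rightarrow> (nat \<Rightarrow> 'r) \<Rightarrow> 'r fps"
  assumes k: "comm_ring_hom k" and inf: "infinite (UNIV :: 'r set)" and I: "finite I" and Z: "finite Z"
  defines "ev \<equiv> \<lambda>h. mpol_eval (\<lambda>a. fps_const (k a)) (\<lambda>i. fps_X * fps_const (h i))"
  assumes unit: "\<And>h. fps_nth (ev h (G M)) 0 \<noteq> 0"
    and c: "\<And>j h. j \<le> M \<Longrightarrow> ev h (G j) = ev h (G M) * c j h" and M: "M \<ge> 1"
    and root: "\<And>\<zeta> h. \<zeta> \<in> Z \<Longrightarrow> (\<Sum>j\<le>M. c j h * (- lam \<zeta> h) ^ j) = 0"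
    and \<nu>: "\<And>i h. i \<in> I \<Longrightarrow> \<nu> i h = (\<Sum>\<zeta>\<in>Z. fps_const (e i \<zeta>) * lam \<zeta> h)"
    and lin: "\<And>i h. i \<in> I \<Longrightarrow> fps_nth (\<nu> i h) 0 = 0 \<and> fps_nth (\<nu> i h) 1 = h i"
  shows "(N + 1) ^ card I \<le> M ^ card Z * mpol.dim (form_space M G (card I * N))"
proof -
  interpret k: comm_ring_hom k by fact
  interpret fc: comm_ring_hom "fps_const :: 'r \<Rightarrow> 'r fps" by (rule comm_ring_hom_fps_const)
  interpret kk: comm_ring_hom "\<lambda>a. fps_const (k a)"
    by unfold_locales (simp_all add: k.hom_add k.hom_mult)
  have evh: "comm_ring_hom (ev h)" for h unfolding ev_def by (rule kk.mpol_eval_hom)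
  define D where "D h = inverse (ev h (G M))" for h
  have D: "ev h (G M) * D h = 1" for h unfolding D_def using inverse_mult_eq_1'[OF unit] by simp
  have c': "c j h = ev h (G j) * D h" if "j \<le> M" for j h
  proof -
    have "ev h (G j) * D h = (ev h (G M) * D h) * c j h" unfolding c[OF that] by (simp add: mult_ac)
    then show ?thesis by (simp add: D)
  qed
  have cM: "c M h = 1" for h using c'[of M h] D by simp
  \<comment> \<open>\<open>lm\<close> and \<open>cm\<close> are the two kinds of monomials, in \<open>lam\<close> and in \<open>c\<close>.\<close>
  define lm where "lm = (\<lambda>e h. \<Prod>\<zeta>\<in>Z. lam \<zeta> h ^ e \<zeta> :: 'r fps)"
  define cm where "cm = (\<lambda>b h. monom_eval (\<lambda>j. c j h) b :: 'r fps)"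
  define A where "A w = fun_fps.span ((\<lambda>(e, b). (\<lambda>h. lm e h * cm b h)) ` ((Z \<rightarrow>\<^sub>E {..<M}) \<times> form_monomials M w))" for w
  have gen: "(\<lambda>h. lm e h * cm b h) \<in> A w" if "e \<in> Z \<rightarrow>\<^sub>E {..<M}" "b \<in> form_monomials M w" for e b w
    unfolding A_def using that by (intro fun_fps.span_base) auto
  have cm_add: "cm (b + Poly_Mapping.single j 1) h = c j h * cm b h" for b j h
    by (simp add: cm_def monom_eval_add monom_eval_single mult_ac)
  have fm_add: "b + Poly_Mapping.single j 1 \<in> form_monomials M (Suc w)" if "b \<in> form_monomials M w" "j \<le> M" for b j w
  proof -
    have "total_degree (Poly_Mapping.single j (1::nat)) = 1" by (simp add: total_degree_def)
    moreover have "Poly_Mapping.keys (b + Poly_Mapping.single j 1) \<subseteq> Poly_Mapping.keys b \<union> {j}"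
      using Poly_Mapping.keys_add[of b "Poly_Mapping.single j 1"] by simp
    ultimately show ?thesis using that by (auto simp: form_monomials_def total_degree_add)
  qed
  have induct: "(\<lambda>h. g h * f h) \<in> A w'" if f: "f \<in> A w"
    and st: "\<And>e b. e \<in> Z \<rightarrow>\<^sub>E {..<M} \<Longrightarrow> b \<in> form_monomials M w \<Longrightarrow> (\<lambda>h. g h * (lm e h * cm b h)) \<in> A w'" for f g w w'
    using f unfolding A_def[of w]
  proof (induction rule: fun_fps.span_induct_alt)
    case base
    have "(\<lambda>h. g h * (0 :: (nat \<Rightarrow> 'r) \<Rightarrow> 'r fps) h) = 0" by (simp add: fun_eq_iff)
    then show ?case by (simp only:) (simp add: A_def fun_fps.span_zero)
  next
    case (step a x y)
    then obtain e b where x: "e \<in> Z \<rightarrow>\<^sub>E {..<M}" "b \<in> form_monomials M w" "x = (\<lambda>h. lm e h * cm b h)" by auto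
    have "(\<lambda>h. fps_const a * (g h * x h)) + (\<lambda>h. g h * y h) \<in> A w'"
      unfolding A_def
      by (intro fun_fps.span_add fun_fps.span_scale) (use st[OF x(1,2)] x(3) step in \<open>auto simp: A_def\<close>)
    moreover have "(\<lambda>h. fps_const a * (g h * x h)) + (\<lambda>h. g h * y h) = (\<lambda>h. g h * ((\<lambda>h. fps_const a * x h) + y) h)"
      by (simp add: fun_eq_iff algebra_simps)
    ultimately show ?case by simp
  qed
  have pad: "f \<in> A (Suc w)" if f: "f \<in> A w" for f w
  proof -
    have "(\<lambda>h. 1 * f h) \<in> A (Suc w)"
    proof (rule induct[OF f])
      fix e b assume eb: "e \<in> Z \<rightarrow>\<^sub>E {..<M}" "b \<in> form_monomials M w"
      have "(\<lambda>h. lm e h * cm (b + Poly_Mapping.single M 1) h) \<in> A (Suc w)"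
        by (intro gen fm_add eb) simp
      then show "(\<lambda>h. 1 * (lm e h * cm b h)) \<in> A (Suc w)" by (simp only: cm_add cM mult_1)
    qed
    then show ?thesis by simp
  qed
  have lam_mult: "(\<lambda>h. lam \<zeta> h * f h) \<in> A (Suc w)" if f: "f \<in> A w" and \<zeta>: "\<zeta> \<in> Z" for f w \<zeta>
  proof (rule induct[OF f])
    fix e b assume eb: "e \<in> Z \<rightarrow>\<^sub>E {..<M}" "b \<in> form_monomials M w"
    define r where "r h = (\<Prod>\<xi>\<in>Z - {\<zeta>}. lam \<xi> h ^ e \<xi>)" for h
    have lm: "lm (e(\<zeta> := j)) h = lam \<zeta> h ^ j * r h" for j h
    proof -
      have "lm (e(\<zeta> := j)) h = lam \<zeta> h ^ j * (\<Prod>\<xi>\<in>Z - {\<zeta>}. lam \<xi> h ^ (e(\<zeta> := j)) \<xi>)"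
        unfolding lm_def using Z \<zeta> by (subst prod.remove[of Z \<zeta>]) auto
      also have "(\<Prod>\<xi>\<in>Z - {\<zeta>}. lam \<xi> h ^ (e(\<zeta> := j)) \<xi>) = r h"
        unfolding r_def by (intro prod.cong) auto
      finally show ?thesis .
    qed
    have e': "e(\<zeta> := j) \<in> Z \<rightarrow>\<^sub>E {..<M}" if "j < M" for j using eb(1) \<zeta> that by (auto simp: PiE_def extensional_def)
    have le: "lm e h = lam \<zeta> h ^ e \<zeta> * r h" for h using lm[of "e \<zeta>" h] by simp
    show "(\<lambda>h. lam \<zeta> h * (lm e h * cm b h)) \<in> A (Suc w)"
    proof (cases "Suc (e \<zeta>) < M")
      case True
      have "(\<lambda>h. lm (e(\<zeta> := Suc (e \<zeta>))) h * cm b h) \<in> A w" by (intro gen e' True eb)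
      then have "(\<lambda>h. lm (e(\<zeta> := Suc (e \<zeta>))) h * cm b h) \<in> A (Suc w)" by (rule pad)
      then show ?thesis unfolding lm le by (simp add: mult_ac)
    next
      case False
      have "e \<zeta> < M" using eb(1) \<zeta> by auto
      hence eM: "M = Suc (e \<zeta>)" using False by simp
      \<comment> \<open>The monic equation, solved for the highest power.\<close>
      have pw: "lam \<zeta> h ^ M = (\<Sum>j<M. fps_const (- ((- 1) ^ M * (- 1) ^ j)) * (c j h * lam \<zeta> h ^ j))" for h
      proof -
        have neg: "(- lam \<zeta> h) ^ j = fps_const ((- 1) ^ j) * lam \<zeta> h ^ j" for j
          by (subst power_minus) (simp flip: fps_const_power fps_const_neg)
        have "(\<Sum>j<M. c j h * (- lam \<zeta> h) ^ j) + (- lam \<zeta> h) ^ M = 0"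
          using root[OF \<zeta>, of h] by (simp add: lessThan_Suc_atMost[symmetric] cM)
        hence "(- lam \<zeta> h) ^ M = - (\<Sum>j<M. c j h * (- lam \<zeta> h) ^ j)" by (simp add: eq_neg_iff_add_eq_0 add.commute)
        hence "fps_const ((- 1) ^ M) * (fps_const ((- 1) ^ M) * lam \<zeta> h ^ M) =
            fps_const ((- 1) ^ M) * - (\<Sum>j<M. c j h * (fps_const ((- 1) ^ j) * lam \<zeta> h ^ j))" by (simp add: neg)
        moreover have "fps_const ((- 1) ^ M) * (fps_const ((- 1) ^ M) * lam \<zeta> h ^ M) = lam \<zeta> h ^ M"
        proof -
          have "((- 1) ^ M * (- 1) ^ M :: 'r) = 1" by (simp flip: power_mult_distrib)
          hence "fps_const ((- 1) ^ M) * fps_const ((- 1) ^ M) = (1 :: 'r fps)" by simp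
          then show ?thesis by (metis mult.assoc mult_1)
        qed
        ultimately have "lam \<zeta> h ^ M = fps_const ((- 1) ^ M) * - (\<Sum>j<M. c j h * (fps_const ((- 1) ^ j) * lam \<zeta> h ^ j))" by simp
        also have "\<dots> = (\<Sum>j<M. - (fps_const ((- 1) ^ M) * (fps_const ((- 1) ^ j) * (c j h * lam \<zeta> h ^ j))))"
          by (simp add: sum_negf sum_distrib_left mult_ac)
        also have "\<dots> = (\<Sum>j<M. fps_const (- ((- 1) ^ M * (- 1) ^ j)) * (c j h * lam \<zeta> h ^ j))"
          by (intro sum.cong refl) (simp add: mult.assoc flip: fps_const_neg fps_const_mult)
        finally show ?thesis .
      qed
      have "(\<lambda>h. lam \<zeta> h * (lm e h * cm b h)) =
         (\<Sum>j<M. (\<lambda>h. fps_const (- ((- 1) ^ M * (- 1) ^ j)) * (lm (e(\<zeta> := j)) h * cm (b + Poly_Mapping.single j 1) h)))"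
      proof
        fix h
        have "lam \<zeta> h * (lm e h * cm b h) = lam \<zeta> h ^ M * (r h * cm b h)"
          unfolding le by (subst eM) (simp add: mult_ac)
        also have "\<dots> = (\<Sum>j<M. fps_const (- ((- 1) ^ M * (- 1) ^ j)) * (lm (e(\<zeta> := j)) h * cm (b + Poly_Mapping.single j 1) h))"
          unfolding pw sum_distrib_right lm cm_add by (intro sum.cong refl) (simp add: mult_ac)
        also have "\<dots> = (\<Sum>j<M. (\<lambda>h. fps_const (- ((- 1) ^ M * (- 1) ^ j)) * (lm (e(\<zeta> := j)) h * cm (b + Poly_Mapping.single j 1) h))) h"
          by (simp add: sum_fun_apply)
        finally show "lam \<zeta> h * (lm e h * cm b h) = \<dots>" .
      qed
      also have "\<dots> \<in> A (Suc w)"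
        unfolding A_def
        by (intro fun_fps.span_sum fun_fps.span_scale) (use gen e' fm_add eb in \<open>auto simp: A_def\<close>)
      finally show ?thesis .
    qed
  qed
  have nu_mult: "(\<lambda>h. \<nu> i h * f h) \<in> A (Suc w)" if f: "f \<in> A w" and i: "i \<in> I" for f w i
  proof -
    have "(\<lambda>h. \<nu> i h * f h) = (\<Sum>\<zeta>\<in>Z. (\<lambda>h. fps_const (e i \<zeta>) * (lam \<zeta> h * f h)))"
      by (simp add: fun_eq_iff sum_fun_apply \<nu>[OF i] sum_distrib_right mult.assoc)
    also have "\<dots> \<in> A (Suc w)"
      unfolding A_def by (intro fun_fps.span_sum fun_fps.span_scale) (use lam_mult[OF f] in \<open>auto simp: A_def\<close>)
    finally show ?thesis .
  qed
  have one: "(\<lambda>h. 1) \<in> A 0"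
  proof -
    have "(\<lambda>h. lm (restrict (\<lambda>_. 0) Z) h * cm 0 h) \<in> A 0"
      using M by (intro gen) (auto simp: form_monomials_def total_degree_def)
    moreover have "lm (restrict (\<lambda>_. 0) Z) h = 1" for h by (simp add: lm_def)
    ultimately show ?thesis by (simp add: cm_def)
  qed
  have nu_pow: "(\<lambda>h. \<nu> i h ^ t * f h) \<in> A (t + w)" if "f \<in> A w" "i \<in> I" for f w i t
  proof (induction t)
    case (Suc t)
    have "(\<lambda>h. \<nu> i h * (\<nu> i h ^ t * f h)) \<in> A (Suc (t + w))" by (rule nu_mult[OF Suc that(2)])
    then show ?case by (simp add: mult.assoc)
  qed (use that in simp)
  have nu_prod: "J \<subseteq> I \<Longrightarrow> (\<lambda>h. \<Prod>i\<in>J. \<nu> i h ^ b i) \<in> A (sum b J)" if "finite J" for J and b :: "nat \<Rightarrow> nat"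
    using that
  proof (induction J rule: finite_induct)
    case (insert i J)
    then have "(\<lambda>h. \<nu> i h ^ b i * (\<Prod>i\<in>J. \<nu> i h ^ b i)) \<in> A (b i + sum b J)" by (intro nu_pow) auto
    then show ?case using insert by simp
  qed (use one in simp)
  have mono: "w \<le> w' \<Longrightarrow> f \<in> A w \<Longrightarrow> f \<in> A w'" for w w' f
    by (induction rule: inc_induct) (auto intro: pad)
  define W where "W = card I * N"
  define u where "u b h = monom_eval (\<lambda>i. \<nu> i h) b" for b h
  have uA: "u b \<in> A W" if b: "b \<in> box_monomials I N" for b
  proof -
    have "(\<lambda>h. \<Prod>i\<in>I. \<nu> i h ^ Poly_Mapping.lookup b i) \<in> A (sum (Poly_Mapping.lookup b) I)"
      by (rule nu_prod[OF I order_refl])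
    moreover have "u b = (\<lambda>h. \<Prod>i\<in>I. \<nu> i h ^ Poly_Mapping.lookup b i)"
      unfolding u_def using b I by (intro ext monom_eval_superset) (auto simp: box_monomials_def)
    moreover have "sum (Poly_Mapping.lookup b) I \<le> W"
      using sum_bounded_above[of I "Poly_Mapping.lookup b" N] b by (simp add: box_monomials_def W_def)
    ultimately show ?thesis using mono by metis
  qed
  \<comment> \<open>The monomials in \<open>c\<close> are replaced by a basis of the forms in \<open>G\<close>; the denominator \<open>G\<^sub>M\<close> occurs in all of them with the same power \<open>W\<close>.\<close>
  let ?gens = "monom_eval G ` form_monomials M W"
  obtain B where B: "B \<subseteq> ?gens" "?gens \<subseteq> mpol.span B" "card B = mpol.dim ?gens"
    using mpol.basis_exists[of ?gens] by metis
  have fB: "finite B" using B(1) finite_form_monomials finite_surj by blast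
  define T where "T = (\<lambda>(e, v). (\<lambda>h. lm e h * (ev h v * D h ^ W))) ` ((Z \<rightarrow>\<^sub>E {..<M}) \<times> B)"
  have fT: "finite T" unfolding T_def using fB Z by (intro finite_imageI finite_cartesian_product finite_PiE) auto
  have cT: "card T \<le> M ^ card Z * mpol.dim (form_space M G W)"
  proof -
    have "card T \<le> card ((Z \<rightarrow>\<^sub>E {..<M}) \<times> B)" unfolding T_def
      using fB Z by (intro card_image_le finite_cartesian_product finite_PiE) auto
    also have "\<dots> = M ^ card Z * card B" using Z by (simp add: card_cartesian_product card_PiE)
    finally show ?thesis using B(3) by (simp add: form_space_def)
  qed
  have AT: "A W \<subseteq> fun_fps.span T"
    unfolding A_def
  proof (rule fun_fps.span_minimal[OF _ fun_fps.subspace_span], safe)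
    fix e b assume eb: "e \<in> Z \<rightarrow>\<^sub>E {..<M}" "b \<in> form_monomials M W"
    have "(\<lambda>h. lm e h * (ev h v * D h ^ W)) \<in> fun_fps.span T" if "v \<in> mpol.span B" for v
      using that
    proof (induction rule: mpol.span_induct_alt)
      case base
      have "ev h 0 = 0" for h using evh[of h] by (simp add: comm_ring_hom_def ring_hom_def ev_def kk.mpol_eval_0)
      then have "(\<lambda>h. lm e h * (ev h 0 * D h ^ W)) = 0" by (simp add: fun_eq_iff)
      then show ?case by (simp add: fun_fps.span_zero)
    next
      case (step a x y)
      have "(\<lambda>h. lm e h * (ev h x * D h ^ W)) \<in> T" using eb(1) step(1) by (auto simp: T_def)
      hence "(\<lambda>h. fps_const (k a) * (lm e h * (ev h x * D h ^ W))) + (\<lambda>h. lm e h * (ev h y * D h ^ W)) \<in> fun_fps.span T"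
        by (intro fun_fps.span_add fun_fps.span_scale step fun_fps.span_base)
      moreover have "(\<lambda>h. fps_const (k a) * (lm e h * (ev h x * D h ^ W))) + (\<lambda>h. lm e h * (ev h y * D h ^ W)) =
          (\<lambda>h. lm e h * (ev h (mpol_const a * x + y) * D h ^ W))"
        by (simp add: fun_eq_iff ev_def kk.mpol_eval_add kk.mpol_eval_mult kk.mpol_eval_const algebra_simps)
      ultimately show ?case by simp
    qed
    then have "(\<lambda>h. lm e h * (ev h (monom_eval G b) * D h ^ W)) \<in> fun_fps.span T"
      using B(2) eb(2) by blast
    moreover have "ev h (monom_eval G b) * D h ^ W = cm b h" for h
    proof -
      interpret e: comm_ring_hom "ev h" by (rule evh)
      have "cm b h = (\<Prod>j\<in>Poly_Mapping.keys b. (ev h (G j) * D h) ^ Poly_Mapping.lookup b j)"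
        unfolding cm_def monom_eval_def using eb(2) by (intro prod.cong) (auto simp: c' form_monomials_def)
      also have "\<dots> = ev h (monom_eval G b) * D h ^ total_degree b"
        by (simp add: power_mult_distrib prod.distrib monom_eval_def e.hom_prod e.hom_power total_degree_def power_sum)
      finally show ?thesis using eb(2) by (simp add: form_monomials_def)
    qed
    ultimately show "(\<lambda>h. lm e h * cm b h) \<in> fun_fps.span T" by simp
  qed
  have "card (box_monomials I N) \<le> card T"
  proof (rule fun_fps.family_card_le[of _ _ u])
    show "finite (box_monomials I N)" by (rule box_monomials_card(1)[OF I])
    show "finite T" by (rule fT)
    show "u ` box_monomials I N \<subseteq> fun_fps.span T" using uA AT by auto
    fix a t assume sum0: "(\<Sum>t\<in>box_monomials I N. (\<lambda>h. fps_const (a t) * u t h)) = 0" and t: "t \<in> box_monomials I N"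
    show "a t = 0"
    proof (rule ccontr)
      assume "a t \<noteq> 0"
      define P where "P r \<longleftrightarrow> (\<exists>t\<in>box_monomials I N. a t \<noteq> 0 \<and> total_degree t = r)" for r
      \<comment> \<open>\<open>r\<close> is the lowest order in \<open>\<epsilon>\<close> that occurs in the combination.\<close>
      define r where "r = (LEAST r. P r)"
      have "P (total_degree t)" unfolding P_def using t \<open>a t \<noteq> 0\<close> by blast
      hence "P r" unfolding r_def by (rule LeastI)
      then obtain t1 where t1: "t1 \<in> box_monomials I N" "a t1 \<noteq> 0" "total_degree t1 = r" by (auto simp: P_def)
      have low: "a s = 0" if "s \<in> box_monomials I N" "total_degree s < r" for s
      proof -
        have "\<not> P (total_degree s)" using not_less_Least[of "total_degree s" P] that(2) by (simp add: r_def)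
        then show ?thesis using that(1) by (auto simp: P_def)
      qed
      define S where "S = {s \<in> box_monomials I N. total_degree s = r}"
      have "a t1 = 0"
      proof (rule monomials_independent[OF inf])
        show "finite S" unfolding S_def using box_monomials_card(1)[OF I] by simp
        show "t1 \<in> S" using t1 by (simp add: S_def)
        fix h :: "nat \<Rightarrow> 'r"
        define g where "g i = fps_shift 1 (\<nu> i h)" for i
        have co: "fps_nth (u s h) r = (if total_degree s = r then monom_eval h s else 0)"
          if s: "s \<in> box_monomials I N" and le: "r \<le> total_degree s" for s
        proof -
          interpret n0: comm_ring_hom "\<lambda>f :: 'r fps. fps_nth f 0" by (rule comm_ring_hom_fps_nth_0)
          have "\<nu> i h = fps_X * g i" if "i \<in> I" for i
            using lin[OF that, of h] by (intro fps_ext) (auto simp: g_def fps_X_mult_nth gr0_conv_Suc)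
          hence "u s h = monom_eval (\<lambda>i. fps_X * g i) s"
            unfolding u_def monom_eval_def using s by (intro prod.cong) (auto simp: box_monomials_def)
          also have "\<dots> = fps_X ^ total_degree s * monom_eval g s" by (rule monom_eval_scale)
          finally have "fps_nth (u s h) r = (if r < total_degree s then 0 else fps_nth (monom_eval g s) 0)"
            using le by (simp add: fps_X_power_mult_nth)
          moreover have "fps_nth (monom_eval g s) 0 = monom_eval h s"
          proof -
            have "fps_nth (monom_eval g s) 0 = (\<Prod>i\<in>Poly_Mapping.keys s. fps_nth (g i) 0 ^ Poly_Mapping.lookup s i)"
              by (simp add: monom_eval_def n0.hom_prod n0.hom_power)
            also have "\<dots> = monom_eval h s"
              unfolding monom_eval_def using s lin
              by (intro prod.cong refl) (auto simp: g_def box_monomials_def)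
            finally show ?thesis .
          qed
          ultimately show ?thesis using le by auto
        qed
        have "(\<Sum>s\<in>box_monomials I N. fps_const (a s) * u s h) = 0"
          using fun_cong[OF sum0, of h] by (simp add: sum_fun_apply)
        hence "fps_nth (\<Sum>s\<in>box_monomials I N. fps_const (a s) * u s h) r = 0" by simp
        hence "(\<Sum>s\<in>box_monomials I N. a s * fps_nth (u s h) r) = 0" by (simp add: fps_sum_nth)
        also have "(\<Sum>s\<in>box_monomials I N. a s * fps_nth (u s h) r) =
            (\<Sum>s\<in>box_monomials I N. if total_degree s = r then a s * monom_eval h s else 0)"
        proof (intro sum.cong refl)
          fix s assume s: "s \<in> box_monomials I N"
          show "a s * fps_nth (u s h) r = (if total_degree s = r then a s * monom_eval h s else 0)"
            using co[OF s] low[OF s] by (cases "total_degree s < r") auto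
        qed
        also have "\<dots> = (\<Sum>s\<in>S. a s * monom_eval h s)"
          unfolding S_def using box_monomials_card(1)[OF I] by (simp add: sum.inter_filter)
        finally show "(\<Sum>s\<in>S. a s * monom_eval h s) = 0" .
      qed
      with t1(2) show False by simp
    qed
  qed
  with cT box_monomials_card(2)[OF I, of N] show ?thesis by (simp add: W_def)
qed

section \<open>Roots of unity\<close>

lemma card_simple_roots:
  fixes f :: "'a::alg_closed_field poly"
  assumes deg: "degree f \<le> m" "coeff f m \<noteq> 0"
    and simple: "\<And>x. poly f x = 0 \<Longrightarrow> poly (pderiv f) x \<noteq> 0"
  shows "card {x. poly f x = 0} = m"
proof -
  obtain w where w: "f = smult (coeff f m) (\<Prod>i<m. [:- w i, 1:])"
    by (rule alg_closed_split_fun[OF deg])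
  have roots: "{x. poly f x = 0} = w ` {..<m}"
  proof -
    have "poly f x = coeff f m * (\<Prod>i<m. x - w i)" for x
      by (subst w) (simp add: poly_prod)
    then show ?thesis using deg(2) by (auto simp: prod_zero_iff)
  qed
  have "inj_on w {..<m}"
  proof (rule inj_onI, rule ccontr)
    fix i j assume ij: "i \<in> {..<m}" "j \<in> {..<m}" "w i = w j" "i \<noteq> j"
    define g where "g = smult (coeff f m) (\<Prod>k\<in>{..<m} - {i} - {j}. [:- w k, 1:])"
    have prd: "(\<Prod>k<m. [:- w k, 1:]) = [:- w i, 1:] * ([:- w j, 1:] * (\<Prod>k\<in>{..<m} - {i} - {j}. [:- w k, 1:]))"
      using ij by (subst prod.remove[of _ i], simp, simp, subst prod.remove[of _ j]) auto
    have "f = [:- w i, 1:] * ([:- w i, 1:] * g)"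
      by (rule trans[OF w]) (simp only: prd g_def mult_smult_right ij(3))
    hence "poly (pderiv f) (w i) = 0"
      by (simp only: pderiv_mult poly_add poly_mult) simp
    moreover have "poly f (w i) = 0" using roots ij by auto
    ultimately show False using simple by blast
  qed
  then show ?thesis unfolding roots by (simp add: card_image)
qed

definition unity_roots :: "nat \<Rightarrow> 'a::field set" where
  "unity_roots N = {z. z ^ N = 1}"

lemma unity_roots:
  assumes N: "N \<ge> 1" "of_nat N \<noteq> (0::'a::alg_closed_field)"
  shows "finite (unity_roots N :: 'a set)" "card (unity_roots N :: 'a set) = N"
proof -
  define f :: "'a poly" where "f = monom 1 N - 1"
  have fx: "poly f z = z ^ N - 1" for z by (simp add: f_def poly_monom)
  have "card {z. poly f z = 0} = N"
  proof (rule card_simple_roots)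
    show "degree f \<le> N" unfolding f_def by (intro degree_diff_le order_trans[OF degree_monom_le]) auto
    show "coeff f N \<noteq> 0" using N by (simp add: f_def)
    fix z assume "poly f z = 0"
    hence "z \<noteq> 0" using N by (auto simp: fx zero_power)
    then show "poly (pderiv f) z \<noteq> 0"
      using N by (simp add: f_def pderiv_diff pderiv_monom poly_monom)
  qed
  then show c: "card (unity_roots N :: 'a set) = N" by (simp add: unity_roots_def fx)
  then show "finite (unity_roots N :: 'a set)" using N by (intro card_ge_0_finite) simp
qed

text \<open>
  Multiplication by an \<open>N\<close>-th root of unity permutes the summands and multiplies the sum by its
  \<open>a\<close>-th power. If \<open>N\<close> does not divide \<open>a\<close>, some root of unity has \<open>a\<close>-th power different from \<open>1\<close>, since a
  nonzero polynomial of degree below \<open>N\<close> cannot have \<open>N\<close> roots.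
\<close>

lemma unity_roots_sum:
  assumes N: "N \<ge> 1" "of_nat N \<noteq> (0::'a::alg_closed_field)"
  shows "(\<Sum>z\<in>unity_roots N. z ^ a) = (if N dvd a then of_nat N else (0::'a))"
proof (cases "N dvd a")
  case True
  then have "z ^ a = 1" if "z \<in> unity_roots N" for z :: 'a
    using that by (auto simp: unity_roots_def power_mult elim!: dvdE)
  then show ?thesis using True unity_roots(2)[OF N] by simp
next
  case False
  define b where "b = a mod N"
  have b: "0 < b" "b < N" using False N by (auto simp: b_def mod_eq_0_iff_dvd intro!: Nat.gr0I)
  have pw: "z ^ a = z ^ b" if "z \<in> unity_roots N" for z :: 'a
  proof -
    have "z ^ a = (z ^ N) ^ (a div N) * z ^ b" unfolding b_def by (simp flip: power_mult power_add)
    then show ?thesis using that by (simp add: unity_roots_def)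
  qed
  have "\<exists>z\<in>unity_roots N. z ^ b \<noteq> (1::'a)"
  proof (rule ccontr)
    assume neg: "\<not> (\<exists>z\<in>unity_roots N. z ^ b \<noteq> (1::'a))"
    define f :: "'a poly" where "f = monom 1 b - 1"
    have "coeff f b \<noteq> 0" using b by (simp add: f_def)
    hence f0: "f \<noteq> 0" by auto
    have "unity_roots N \<subseteq> {z. poly f z = 0}" using neg by (auto simp: f_def poly_monom)
    hence "N \<le> card {z. poly f z = 0}"
      using card_mono[OF poly_roots_finite[OF f0]] unity_roots(2)[OF N] by metis
    also have "\<dots> \<le> degree f" by (rule card_poly_roots_bound[OF f0])
    also have "\<dots> \<le> b" unfolding f_def by (intro degree_diff_le order_trans[OF degree_monom_le]) auto
    finally show False using b by simp
  qed
  then obtain z0 :: 'a where z0: "z0 \<in> unity_roots N" "z0 ^ b \<noteq> 1" by blast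
  \<comment> \<open>Translation by \<open>z0\<close> permutes the roots of unity.\<close>
  have z00: "z0 \<noteq> 0" using z0 N by (auto simp: unity_roots_def zero_power)
  have "bij_betw ((*) z0) (unity_roots N) (unity_roots N)"
    unfolding bij_betw_def
  proof
    show "inj_on ((*) z0) (unity_roots N)" using z00 by (auto intro: inj_onI)
    have "z \<in> (*) z0 ` unity_roots N" if "z \<in> unity_roots N" for z
      using that z0 z00 by (intro image_eqI[of _ _ "z / z0"]) (auto simp: unity_roots_def power_divide)
    then show "(*) z0 ` unity_roots N = unity_roots N"
      using z0 by (auto simp: unity_roots_def power_mult_distrib)
  qed
  from sum.reindex_bij_betw[OF this, of "\<lambda>z. z ^ b"]
  have "(\<Sum>z\<in>unity_roots N. z ^ b) = z0 ^ b * (\<Sum>z\<in>unity_roots N. z ^ b)"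
    by (simp add: power_mult_distrib sum_distrib_left)
  hence "(1 - z0 ^ b) * (\<Sum>z\<in>unity_roots N. z ^ b) = 0" by (simp add: algebra_simps)
  hence "(\<Sum>z\<in>unity_roots N. z ^ b) = (0::'a)" using z0 by simp
  then show ?thesis using False pw by (simp cong: sum.cong)
qed


section \<open>Hensel's lemma\<close>

lemma poly_taylor1:
  fixes f :: "'a::idom poly"
  shows "\<exists>g. poly f (y + e) = poly f y + poly (pderiv f) y * e + e ^ 2 * g"
proof (induction f)
  case (pCons a f)
  then obtain g where g: "poly f (y + e) = poly f y + poly (pderiv f) y * e + e ^ 2 * g" by blast
  show ?case
    by (rule exI[of _ "poly (pderiv f) y + (y + e) * g"])
       (simp only: poly_pCons g pderiv_pCons poly_add, simp add: algebra_simps power2_eq_square)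
qed (rule exI[of _ 0], simp)

text \<open>
  \<open>lo\<close> and \<open>hi\<close> are the first two terms of a polynomial with power series coefficients:
  \<open>P = lo P + \<epsilon> hi P + \<dots>\<close>.
\<close>

definition lo :: "'a::comm_ring_1 fps poly \<Rightarrow> 'a poly" where
  "lo P = map_poly (\<lambda>f. fps_nth f 0) P"

definition hi :: "'a::comm_ring_1 fps poly \<Rightarrow> 'a poly" where
  "hi P = map_poly (\<lambda>f. fps_nth f 1) P"

lemma coeff_lo [simp]: "coeff (lo P) i = fps_nth (coeff P i) 0"
  by (simp add: lo_def coeff_map_poly)

lemma coeff_hi [simp]: "coeff (hi P) i = fps_nth (coeff P i) 1"
  by (simp add: hi_def coeff_map_poly)

lemma lo_simps: "lo (P + Q) = lo P + lo Q" "lo (P - Q) = lo P - lo Q" "lo (P * Q) = lo P * lo Q" "lo 0 = 0" "lo 1 = 1"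
    "lo (pCons c P) = pCons (fps_nth c 0) (lo P)" "lo (smult c P) = smult (fps_nth c 0) (lo P)"
  by (auto intro!: poly_eqI simp: coeff_mult fps_sum_nth coeff_1 coeff_pCons split: nat.splits)

lemma hi_simps: "hi (P + Q) = hi P + hi Q" "hi (P - Q) = hi P - hi Q" "hi (P * Q) = lo P * hi Q + hi P * lo Q" "hi 0 = 0" "hi 1 = 0"
    "hi (pCons c P) = pCons (fps_nth c 1) (hi P)" "hi (smult c P) = smult (fps_nth c 0) (hi P) + smult (fps_nth c 1) (lo P)"
  by (auto intro!: poly_eqI simp: coeff_mult fps_sum_nth coeff_1 coeff_pCons fps_mult_nth sum.distrib split: nat.splits)

lemma lo_power: "lo (P ^ k) = lo P ^ k"
  by (induction k) (simp_all add: lo_simps)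

lemma hi_power: "hi (P ^ k) = smult (of_nat k) (lo P ^ (k - 1) * hi P)"
proof (induction k)
  case (Suc k)
  show ?case
  proof (cases "k = 0")
    case False
    hence "lo P ^ k = lo P * lo P ^ (k - 1)" by (simp add: power_eq_if)
    then show ?thesis using Suc by (simp add: hi_simps lo_power smult_add_left algebra_simps)
  qed (simp add: hi_simps lo_power)
qed (simp add: hi_simps)

lemma lo_sum: "lo (sum f S) = (\<Sum>s\<in>S. lo (f s))"
  by (induction S rule: infinite_finite_induct) (simp_all add: lo_simps)

lemma hi_sum: "hi (sum f S) = (\<Sum>s\<in>S. hi (f s))"
  by (induction S rule: infinite_finite_induct) (simp_all add: hi_simps)

lemma pderiv_lo: "pderiv (lo P) = lo (pderiv P)" and pderiv_hi: "pderiv (hi P) = hi (pderiv P)"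
  for P :: "'a::idom fps poly"
  by (auto intro!: poly_eqI simp: coeff_pderiv fps_mult_nth simp flip: fps_of_nat simp del: of_nat_Suc)

lemma fps_nth_poly_0: "fps_nth (poly P x) 0 = poly (lo P) (fps_nth x 0)"
  by (induction P) (simp_all add: lo_simps)

lemma fps_nth_poly_1: "fps_nth (poly P x) 1 = poly (hi P) (fps_nth x 0) + poly (pderiv (lo P)) (fps_nth x 0) * fps_nth x 1"
  for P :: "'a::idom fps poly"
  by (induction P) (simp_all add: lo_simps hi_simps pderiv_pCons fps_mult_nth fps_nth_poly_0 algebra_simps)

text \<open>
  Newton's method, one coefficient at a time: \<open>s k\<close> is a root up to the order \<open>k\<close>, and it changes only
  beyond that order.
\<close>

theorem hensel:
  fixes f :: "'a::field fps poly"
  assumes root: "poly (lo f) z = 0" and simple: "poly (pderiv (lo f)) z \<noteq> 0"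
  obtains x where "poly f x = 0" "fps_nth x 0 = z"
proof -
  define P where "P k y \<longleftrightarrow> fps_nth y 0 = z \<and> (\<forall>i\<le>k. fps_nth (poly f y) i = 0)" for k :: nat and y
  define R where "R k y y' \<longleftrightarrow> (\<exists>c. y' = y + fps_X ^ Suc k * fps_const c)" for k :: nat and y y' :: "'a fps"
  have "\<exists>s. \<forall>k. P k (s k) \<and> R k (s k) (s (Suc k))"
  proof (rule dependent_nat_choice)
    show "\<exists>y. P 0 y"
      by (rule exI[of _ "fps_const z"]) (simp add: P_def fps_nth_poly_0 root)
    fix y k assume y: "P k y"
    \<comment> \<open>The Newton step at order \<open>k + 1\<close>, with the derivative replaced by its constant term.\<close>
    define c where "c = - fps_nth (poly f y) (Suc k) / poly (pderiv (lo f)) z"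
    define e where "e = fps_X ^ Suc k * fps_const c"
    obtain g where g: "poly f (y + e) = poly f y + poly (pderiv f) y * e + e ^ 2 * g"
      using poly_taylor1 by blast
    have e2: "e ^ 2 * g = fps_X ^ (Suc k + Suc k) * (fps_const c ^ 2 * g)"
      by (simp add: e_def power2_eq_square power_add mult_ac)
    have e1: "poly (pderiv f) y * e = fps_X ^ Suc k * (poly (pderiv f) y * fps_const c)"
      by (simp add: e_def mult_ac)
    have "fps_nth (poly f (y + e)) i = 0" if i: "i \<le> Suc k" for i
    proof (cases "i = Suc k")
      case True
      have "fps_nth (poly (pderiv f) y) 0 = poly (pderiv (lo f)) z"
        using y by (simp add: fps_nth_poly_0 pderiv_lo P_def)
      then show ?thesis
        unfolding g e2 e1 using simple True
        by (simp add: fps_X_power_mult_nth c_def del: power_Suc)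
    next
      case False
      then have "fps_nth (poly f y) i = 0" using y i by (simp add: P_def)
      then show ?thesis unfolding g e2 e1 using False i
        by (simp add: fps_X_power_mult_nth del: power_Suc)
    qed
    moreover have "fps_nth (y + e) 0 = z" using y by (simp add: P_def e_def fps_X_power_mult_nth del: power_Suc)
    ultimately show "\<exists>y'. P (Suc k) y' \<and> R k y y'"
      unfolding P_def R_def e_def by blast
  qed
  then obtain s where s: "\<And>k. P k (s k)" "\<And>k. R k (s k) (s (Suc k))" by blast
  define x where "x = Abs_fps (\<lambda>i. fps_nth (s i) i)"
  have stable: "fps_nth (s (k + m)) i = fps_nth (s k) i" if "i \<le> k" for i k m
  proof (induction m)
    case (Suc m)
    obtain c where "s (Suc (k + m)) = s (k + m) + fps_X ^ Suc (k + m) * fps_const c"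
      using s(2)[of "k + m"] by (auto simp: R_def)
    then show ?case using Suc that by (simp add: fps_X_power_mult_nth del: power_Suc)
  qed simp
  have agree: "fps_nth x i = fps_nth (s k) i" if "i \<le> k" for i k
    using stable[of i i "k - i"] that by (simp add: x_def)
  have "fps_nth (poly f x) k = 0" for k
  proof -
    define e where "e = x - s k"
    have "fps_nth e i = 0" if "i \<le> k" for i using agree[OF that] by (simp add: e_def)
    hence "e = fps_X ^ Suc k * fps_shift (Suc k) e"
      by (intro fps_ext) (auto simp: fps_X_power_mult_nth simp del: power_Suc)
    moreover obtain g where "poly f (s k + e) = poly f (s k) + poly (pderiv f) (s k) * e + e ^ 2 * g"
      using poly_taylor1 by blast
    hence "poly f x = poly f (s k) + e * (poly (pderiv f) (s k) + e * g)"
      by (simp add: e_def algebra_simps power2_eq_square)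
    ultimately have "poly f x = poly f (s k) + fps_X ^ Suc k * (fps_shift (Suc k) e * (poly (pderiv f) (s k) + e * g))"
      by (metis mult.assoc)
    then show ?thesis using s(1)[of k] by (simp add: P_def fps_X_power_mult_nth del: power_Suc)
  qed
  moreover have "fps_nth x 0 = z" using s(1)[of 0] by (simp add: x_def P_def)
  ultimately show ?thesis using that[of x] by (simp add: fps_ext)
qed

lemma split_distinct_roots:
  fixes f :: "'a::idom poly"
  assumes deg: "degree f \<le> m" and R: "finite R" "card R = m" "m \<ge> 1" and roots: "\<And>r. r \<in> R \<Longrightarrow> poly f r = 0"
  obtains w where "f = smult (coeff f m) (\<Prod>i<m. [:- w i, 1:])" "bij_betw w {..<m} R"
proof -
  obtain w where w: "bij_betw w {..<m} R" using ex_bij_betw_nat_finite[OF R(1)] R(2) lessThan_atLeast0 by metis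
  define g where "g = f - smult (coeff f m) (\<Prod>i<m. [:- w i, 1:])"
  have mon: "coeff (\<Prod>i<m. [:- w i, 1:]) m = 1" "\<forall>i>m. coeff (\<Prod>i<m. [:- w i, 1:]) i = 0"
    using newton_poly_monic[of w m] by (simp_all add: newton_poly_def)
  have "coeff g i = 0" if "i \<ge> m" for i
  proof (cases "i = m")
    case True
    then show ?thesis using mon by (simp add: g_def)
  next
    case False
    then show ?thesis using mon that deg by (simp add: g_def coeff_eq_0)
  qed
  hence dg: "degree g \<le> m - 1" using R(3) by (intro degree_le) auto
  have "g = 0"
  proof (rule ccontr)
    assume g0: "g \<noteq> 0"
    have "poly g r = 0" if r: "r \<in> R" for r
    proof -
      have "r \<in> w ` {..<m}" using w r by (simp add: bij_betw_def)
      hence "(\<Prod>i<m. r - w i) = 0" by (auto intro: prod_zero)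
      then show ?thesis using roots[OF r] by (simp add: g_def poly_prod)
    qed
    hence "R \<subseteq> {x. poly g x = 0}" by blast
    hence "m \<le> card {x. poly g x = 0}" using card_mono[OF poly_roots_finite[OF g0]] R(2) by metis
    also have "\<dots> \<le> degree g" by (rule card_poly_roots_bound[OF g0])
    finally show False using dg R(3) by simp
  qed
  then show ?thesis using that[of w] w by (simp add: g_def)
qed

section \<open>First order perturbation of the power map\<close>

text \<open>
  The indices of the free coordinates \<open>p\<^sub>1, \<dots>, p\<^bsub>d-1\<^esub>, q\<^sub>1, \<dots>, q\<^bsub>d-1\<^esub>\<close> among the homogeneous coordinates
  of a map. On the slice, \<open>p\<^sub>d = q\<^sub>0 = 1\<close> and \<open>p\<^sub>0 = q\<^sub>d = 0\<close>, so \<open>0\<close> and \<open>\<infinity>\<close> are fixed.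
\<close>

definition slice_vars :: "nat \<Rightarrow> nat set" where
  "slice_vars d = {1..<d} \<union> {Suc d + 1..<Suc d + d}"

definition slice :: "nat \<Rightarrow> (nat \<Rightarrow> 'a::comm_ring_1) \<Rightarrow> nat \<Rightarrow> 'a" where
  "slice d h i = (if i \<in> slice_vars d then h i else if i = d \<or> i = Suc d then 1 else 0)"

text \<open>
  Weights and exponents of the contribution of the coordinate \<open>i\<close> at the step \<open>l\<close> of the orbit, as they
  occur in \<open>multiplier_expansion\<close>. A numerator coordinate has the exponent \<open>- (d - i) d\<^sup>l\<close> and a
  denominator coordinate the exponent \<open>(i - (d + 1)) d\<^sup>l\<close>, represented modulo \<open>d\<^sup>n - 1\<close> by natural
  numbers.
\<close>

definition slice_weight :: "nat \<Rightarrow> nat \<Rightarrow> nat" where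
  "slice_weight d i = (if i < d then d - i else i - Suc d)"

definition slice_exp :: "nat \<Rightarrow> nat \<Rightarrow> nat \<Rightarrow> nat \<Rightarrow> nat" where
  "slice_exp d n i l = (if i < d then d ^ n - 1 - (d - i) * d ^ l else (i - Suc d) * d ^ l)"

lemma finite_slice_vars [simp]: "finite (slice_vars d)"
  by (simp add: slice_vars_def)

lemma sum_slice_vars: "(\<Sum>i\<in>slice_vars d. f i) = (\<Sum>i\<in>{1..<d}. f i) + (\<Sum>i\<in>{1..<d}. f (Suc d + i))"
proof -
  have "(\<Sum>i\<in>{Suc d + 1..<Suc d + d}. f i) = (\<Sum>i\<in>{1..<d}. f (Suc d + i))"
    by (rule sum.reindex_bij_witness[of _ "\<lambda>i. Suc d + i" "\<lambda>i. i - Suc d"]) auto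
  then show ?thesis unfolding slice_vars_def by (subst sum.union_disjoint) auto
qed

context
  fixes d :: nat and h :: "nat \<Rightarrow> 'a::field"
  assumes d: "d \<ge> 2"
begin

text \<open>
  The point at parameter \<open>\<epsilon>\<close> on the line through the power map in the direction \<open>h\<close>, and its
  iterates.
\<close>

abbreviation "pt \<equiv> slice d (\<lambda>i. fps_X * fps_const (h i))"
abbreviation "pt_num \<equiv> coord_num d pt"
abbreviation "pt_den \<equiv> coord_den d pt"
abbreviation "PN n \<equiv> iter_num d pt_num pt_den n"
abbreviation "QN n \<equiv> iter_den d pt_num pt_den n"

lemma coeff_pt:
  assumes "i \<le> d"
  shows "fps_nth (coeff pt_num i) 0 = (if i = d then 1 else 0)" "fps_nth (coeff pt_num i) 1 = (if i \<in> {1..<d} then h i else 0)"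
    "fps_nth (coeff pt_den i) 0 = (if i = 0 then 1 else 0)" "fps_nth (coeff pt_den i) 1 = (if i \<in> {1..<d} then h (Suc d + i) else 0)"
proof -
  have s0: "fps_nth (pt k) 0 = (if k \<in> slice_vars d then 0 else if k = d \<or> k = Suc d then 1 else 0)" for k
    by (simp add: slice_def)
  have s1: "fps_nth (pt k) 1 = (if k \<in> slice_vars d then h k else 0)" for k
    by (simp add: slice_def)
  have v: "i \<in> slice_vars d \<longleftrightarrow> i \<in> {1..<d}" "Suc d + i \<in> slice_vars d \<longleftrightarrow> i \<in> {1..<d}"
    using assms by (auto simp: slice_vars_def)
  show "fps_nth (coeff pt_num i) 0 = (if i = d then 1 else 0)" "fps_nth (coeff pt_num i) 1 = (if i \<in> {1..<d} then h i else 0)"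
    "fps_nth (coeff pt_den i) 0 = (if i = 0 then 1 else 0)" "fps_nth (coeff pt_den i) 1 = (if i \<in> {1..<d} then h (Suc d + i) else 0)"
    unfolding coeff_coord[OF assms] s0 s1 v using assms by auto
qed

lemma lo_iter: "lo (PN n) = monom 1 (d ^ n)" "lo (QN n) = 1"
proof -
  have "lo (PN n) = monom 1 (d ^ n) \<and> lo (QN n) = 1"
  proof (induction n)
    case 0
    then show ?case by (simp add: lo_simps monom_altdef)
  next
    case (Suc n)
    have sub: "lo (hom_subst d f (PN n) (QN n)) = (\<Sum>i\<le>d. smult (fps_nth (coeff f i) 0) (monom 1 (d ^ n) ^ i))" for f
      using Suc by (simp add: hom_subst_def lo_sum lo_simps lo_power)
    have "lo (PN (Suc n)) = (\<Sum>i\<le>d. if i = d then monom 1 (d ^ n) ^ d else 0)"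
      unfolding iter_pair.simps fst_conv sub by (intro sum.cong) (auto simp: coeff_pt)
    moreover have "lo (QN (Suc n)) = (\<Sum>i\<le>d. if i = 0 then 1 else 0)"
      unfolding iter_pair.simps snd_conv sub by (intro sum.cong) (auto simp: coeff_pt)
    ultimately show ?case by (simp add: monom_power mult.commute del: iter_pair.simps)
  qed
  then show "lo (PN n) = monom 1 (d ^ n)" "lo (QN n) = 1" by auto
qed

text \<open>
  The first order terms of numerator and denominator of the \<open>n\<close>-th iterate: a perturbation that
  enters at step \<open>l\<close> is raised to the power \<open>d\<close> in the remaining \<open>n - 1 - l\<close> steps, which multiplies its
  first order term by \<open>d\<close> each time.
\<close>

definition hi_num :: "nat \<Rightarrow> 'a poly" where
  "hi_num n = (\<Sum>l<n. \<Sum>i\<in>{1..<d}. monom (of_nat (d ^ (n - 1 - l)) * h i) (d ^ n - (d - i) * d ^ l))"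

definition hi_den :: "nat \<Rightarrow> 'a poly" where
  "hi_den n = (\<Sum>l<n. \<Sum>i\<in>{1..<d}. monom (of_nat (d ^ (n - 1 - l)) * h (Suc d + i)) (i * d ^ l))"

lemma sub_exp_le:
  assumes "l < n" "a \<le> d"
  shows "a * d ^ l \<le> d ^ n"
proof -
  have "a * d ^ l \<le> d ^ Suc l" using assms by simp
  also have "\<dots> \<le> d ^ n" using assms d by (intro power_increasing) auto
  finally show ?thesis .
qed

lemma hi_iter: "hi (PN n) = hi_num n" "hi (QN n) = hi_den n"
proof -
  have "hi (PN n) = hi_num n \<and> hi (QN n) = hi_den n"
  proof (induction n)
    case 0
    then show ?case by (simp add: hi_simps hi_num_def hi_den_def)
  next
    case (Suc n)
    let ?D = "d ^ n"
    have sub: "hi (hom_subst d f (PN n) (QN n)) =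
      (\<Sum>i\<le>d. smult (fps_nth (coeff f i) 0) (hi (PN n ^ i * QN n ^ (d - i)))) +
      (\<Sum>i\<le>d. smult (fps_nth (coeff f i) 1) (monom 1 (?D * i)))" for f
      by (simp add: hom_subst_def hi_sum hi_simps(7) sum.distrib lo_simps lo_power lo_iter monom_power)
    have rest: "(\<Sum>i\<le>d. smult (if i \<in> {1..<d} then g i else 0) (monom 1 (?D * i))) = (\<Sum>i\<in>{1..<d}. monom (g i) (?D * i))"
      for g :: "nat \<Rightarrow> 'a"
      by (rule sum.mono_neutral_cong_right) (auto simp: smult_monom)
    have "(\<Sum>i\<le>d. smult (fps_nth (coeff pt_num i) 0) (hi (PN n ^ i * QN n ^ (d - i)))) = (\<Sum>i\<le>d. if i = d then hi (PN n ^ d) else 0)"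
      by (intro sum.cong) (auto simp: coeff_pt)
    also have "\<dots> = smult (of_nat d) (monom 1 (?D * (d - 1)) * hi_num n)"
      using Suc by (simp add: hi_power lo_iter monom_power)
    also have "\<dots> = (\<Sum>l<n. \<Sum>i\<in>{1..<d}. monom (of_nat (d ^ (Suc n - 1 - l)) * h i) (d ^ Suc n - (d - i) * d ^ l))"
      unfolding hi_num_def sum_distrib_left smult_sum_right'
    proof (intro sum.cong refl)
      fix l i assume l: "l \<in> {..<n}" and i: "i \<in> {1..<d}"
      have "(d - i) * d ^ l \<le> ?D" using l by (intro sub_exp_le) auto
      moreover have "d ^ Suc n = ?D * (d - 1) + ?D" using d by (simp add: algebra_simps flip: mult_Suc_right)
      ultimately have e: "?D * (d - 1) + (?D - (d - i) * d ^ l) = d ^ Suc n - (d - i) * d ^ l" by simp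
      have "Suc n - 1 - l = Suc (n - 1 - l)" using l by simp
      then show "smult (of_nat d) (monom 1 (?D * (d - 1)) * monom (of_nat (d ^ (n - 1 - l)) * h i) (?D - (d - i) * d ^ l)) =
        monom (of_nat (d ^ (Suc n - 1 - l)) * h i) (d ^ Suc n - (d - i) * d ^ l)"
        by (simp only: mult_monom smult_monom e power_Suc of_nat_mult mult_1_left mult.assoc)
    qed
    finally have first: "(\<Sum>i\<le>d. smult (fps_nth (coeff pt_num i) 0) (hi (PN n ^ i * QN n ^ (d - i)))) =
        (\<Sum>l<n. \<Sum>i\<in>{1..<d}. monom (of_nat (d ^ (Suc n - 1 - l)) * h i) (d ^ Suc n - (d - i) * d ^ l))" .
    have "hi (PN (Suc n)) = (\<Sum>l<n. \<Sum>i\<in>{1..<d}. monom (of_nat (d ^ (Suc n - 1 - l)) * h i) (d ^ Suc n - (d - i) * d ^ l)) +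
        (\<Sum>i\<in>{1..<d}. monom (h i) (?D * i))"
      unfolding iter_pair.simps fst_conv sub first rest[symmetric]
      by (intro arg_cong2[where f = "(+)"] refl sum.cong) (simp only: coeff_pt(2) atMost_iff)
    also have "(\<Sum>i\<in>{1..<d}. monom (h i) (?D * i)) = (\<Sum>i\<in>{1..<d}. monom (of_nat (d ^ (Suc n - 1 - n)) * h i) (d ^ Suc n - (d - i) * d ^ n))"
    proof (intro sum.cong refl)
      fix i assume "i \<in> {1..<d}"
      hence "d ^ Suc n - (d - i) * d ^ n = ?D * i" by (simp add: diff_mult_distrib mult.commute)
      then show "monom (h i) (?D * i) = monom (of_nat (d ^ (Suc n - 1 - n)) * h i) (d ^ Suc n - (d - i) * d ^ n)" by simp
    qed
    finally have 1: "hi (PN (Suc n)) = hi_num (Suc n)" by (simp only: hi_num_def sum.lessThan_Suc)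
    have "(\<Sum>i\<le>d. smult (fps_nth (coeff pt_den i) 0) (hi (PN n ^ i * QN n ^ (d - i)))) = (\<Sum>i\<le>d. if i = 0 then hi (QN n ^ d) else 0)"
      by (intro sum.cong) (auto simp: coeff_pt)
    also have "\<dots> = smult (of_nat d) (hi_den n)"
      using Suc by (simp add: hi_power lo_iter)
    also have "\<dots> = (\<Sum>l<n. \<Sum>i\<in>{1..<d}. monom (of_nat (d ^ (Suc n - 1 - l)) * h (Suc d + i)) (i * d ^ l))"
      unfolding hi_den_def smult_sum_right'
    proof (intro sum.cong refl)
      fix l i assume l: "l \<in> {..<n}" and i: "i \<in> {1..<d}"
      have "Suc n - 1 - l = Suc (n - 1 - l)" using l by simp
      then show "smult (of_nat d) (monom (of_nat (d ^ (n - 1 - l)) * h (Suc d + i)) (i * d ^ l)) =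
        monom (of_nat (d ^ (Suc n - 1 - l)) * h (Suc d + i)) (i * d ^ l)"
        by (simp only: smult_monom power_Suc of_nat_mult mult.assoc)
    qed
    finally have second: "(\<Sum>i\<le>d. smult (fps_nth (coeff pt_den i) 0) (hi (PN n ^ i * QN n ^ (d - i)))) =
        (\<Sum>l<n. \<Sum>i\<in>{1..<d}. monom (of_nat (d ^ (Suc n - 1 - l)) * h (Suc d + i)) (i * d ^ l))" .
    have "hi (QN (Suc n)) = (\<Sum>l<n. \<Sum>i\<in>{1..<d}. monom (of_nat (d ^ (Suc n - 1 - l)) * h (Suc d + i)) (i * d ^ l)) +
        (\<Sum>i\<in>{1..<d}. monom (h (Suc d + i)) (?D * i))"
      unfolding iter_pair.simps snd_conv sub second rest[symmetric]
      by (intro arg_cong2[where f = "(+)"] refl sum.cong) (simp only: coeff_pt(4) atMost_iff)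
    then have 2: "hi (QN (Suc n)) = hi_den (Suc n)" by (simp add: hi_den_def mult.commute)
    show ?case using 1 2 by blast
  qed
  then show "hi (PN n) = hi_num n" "hi (QN n) = hi_den n" by auto
qed

text \<open>
  First order implicit differentiation. The equation of the fixed point gives
  \<open>(D - 1) \<xi> = z B - A\<close> for the first order term \<open>\<xi>\<close> of \<open>x\<close>, with \<open>D = d\<^sup>n\<close>; the first order term of
  the equation for \<open>lam\<close> contains \<open>\<xi>\<close> only in the combination \<open>(D - 1) \<xi>\<close>, so no division by \<open>D - 1\<close>
  is required. In \<open>z A' - D A\<close> and \<open>z B'\<close> a monomial of exponent \<open>E\<close> is multiplied by \<open>E - D\<close> and by \<open>E\<close>,
  respectively; this is where the weights come from.
\<close>

lemma multiplier_expansion: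
  assumes n: "n \<ge> 1" and z: "z ^ (d ^ n - 1) = 1"
    and x: "poly (PN n) x = x * poly (QN n) x" "fps_nth x 0 = z"
    and lam: "lam * poly (QN n) x = poly (pderiv (PN n)) x - x * poly (pderiv (QN n)) x"
  shows "fps_nth lam 0 = of_nat (d ^ n)"
    and "fps_nth lam 1 = - of_nat (d ^ (n - 1)) *
      (\<Sum>l<n. \<Sum>i\<in>slice_vars d. of_nat (slice_weight d i) * h i * z ^ slice_exp d n i l)"
proof -
  let ?D = "d ^ n"
  define D where "D = (of_nat ?D :: 'a)"
  have D2: "?D \<ge> 2" using d n power_ge_2 by blast
  have z0: "z \<noteq> 0" using z D2 by (auto simp: zero_power)
  have zD: "z ^ ?D = z" using z D2 by (metis Suc_diff_1 less_le_trans mult.right_neutral pos2 power_Suc)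
  have "?D - 1 = Suc (?D - 1 - 1)" using D2 by simp
  hence zD1: "z * z ^ (?D - 1 - 1) = 1" using z by (metis power_Suc)
  define A where "A = poly (hi_num n) z"
  define A' where "A' = poly (pderiv (hi_num n)) z"
  define B where "B = poly (hi_den n) z"
  define B' where "B' = poly (pderiv (hi_den n)) z"
  define \<xi> where "\<xi> = fps_nth x 1"
  have P0: "fps_nth (poly (PN n) x) 0 = z" and Q0: "fps_nth (poly (QN n) x) 0 = 1"
    using zD by (simp_all add: fps_nth_poly_0 lo_iter x(2) poly_monom)
  have P1: "fps_nth (poly (PN n) x) 1 = A + D * \<xi>"
    using z by (simp add: fps_nth_poly_1 hi_iter lo_iter x(2) pderiv_monom poly_monom A_def D_def \<xi>_def del: One_nat_def)
  have Q1: "fps_nth (poly (QN n) x) 1 = B"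
    by (simp add: fps_nth_poly_1 hi_iter lo_iter x(2) B_def del: One_nat_def)
  have P'0: "fps_nth (poly (pderiv (PN n)) x) 0 = D"
    using z by (simp add: fps_nth_poly_0 lo_iter x(2) pderiv_monom poly_monom D_def flip: pderiv_lo)
  have Q'0: "fps_nth (poly (pderiv (QN n)) x) 0 = 0"
    by (simp add: fps_nth_poly_0 lo_iter flip: pderiv_lo)
  have P'1: "fps_nth (poly (pderiv (PN n)) x) 1 = A' + D * (D - 1) * z ^ (?D - 1 - 1) * \<xi>"
    using D2 by (simp add: fps_nth_poly_1 hi_iter lo_iter x(2) pderiv_monom poly_monom A'_def D_def \<xi>_def of_nat_diff algebra_simps
        del: One_nat_def flip: pderiv_lo pderiv_hi)
  have Q'1: "fps_nth (poly (pderiv (QN n)) x) 1 = B'"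
    by (simp add: fps_nth_poly_1 hi_iter lo_iter x(2) B'_def del: One_nat_def flip: pderiv_lo pderiv_hi)
  have nth1: "fps_nth (f * g) 1 = fps_nth f 0 * fps_nth g 1 + fps_nth f 1 * fps_nth g 0" for f g :: "'a fps"
    by (simp add: fps_mult_nth)
  have xi: "(D - 1) * \<xi> = z * B - A"
    using arg_cong[OF x(1), of "\<lambda>f. fps_nth f 1"] unfolding nth1 P1 Q0 Q1 x(2) \<xi>_def[symmetric]
    by (simp add: algebra_simps)
  have l0: "fps_nth lam 0 = D"
    using arg_cong[OF lam, of "\<lambda>f. fps_nth f 0"] P'0 Q0 Q'0 by simp
  then show "fps_nth lam 0 = of_nat (d ^ n)" by (simp add: D_def)
  have "fps_nth lam 1 + D * B = A' + D * (D - 1) * z ^ (?D - 1 - 1) * \<xi> - z * B'"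
    using arg_cong[OF lam, of "\<lambda>f. fps_nth f 1"]
    unfolding nth1 fps_sub_nth P'1 Q0 Q1 Q'0 Q'1 l0 x(2) \<xi>_def[symmetric] by (simp add: algebra_simps)
  also have "D * (D - 1) * z ^ (?D - 1 - 1) * \<xi> = D * z ^ (?D - 1 - 1) * (z * B - A)"
    unfolding xi[symmetric] by (simp add: mult_ac)
  finally have eq: "fps_nth lam 1 + D * B = A' + D * z ^ (?D - 1 - 1) * (z * B - A) - z * B'" .
  have "z * (fps_nth lam 1 + D * B) = z * A' + D * (z * z ^ (?D - 1 - 1)) * (z * B - A) - z * (z * B')"
    unfolding eq by (simp add: algebra_simps)
  hence main: "z * fps_nth lam 1 = (z * A' - D * A) - z * (z * B')"
    unfolding zD1 by (simp add: algebra_simps)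
  have ez: "z * (of_nat e * z ^ (e - 1)) = of_nat e * z ^ e" for e
    by (cases e) auto
  have pw: "of_nat (d ^ (n - 1 - l)) * of_nat (d ^ l) = (of_nat (d ^ (n - 1)) :: 'a)" if "l < n" for l
    using that by (simp flip: power_add of_nat_mult of_nat_power)
  have "z * A' - D * A = (\<Sum>l<n. \<Sum>i\<in>{1..<d}. of_nat (d ^ (n - 1 - l)) * h i *
      (z * (of_nat (?D - (d - i) * d ^ l) * z ^ (?D - (d - i) * d ^ l - 1)) - D * z ^ (?D - (d - i) * d ^ l)))"
    unfolding A_def A'_def hi_num_def
    by (simp add: poly_sum poly_monom pderiv_sum pderiv_monom sum_distrib_left sum_subtractf[symmetric] algebra_simps)
  also have "\<dots> = (\<Sum>l<n. \<Sum>i\<in>{1..<d}. - (of_nat (d ^ (n - 1)) * z) * (of_nat (slice_weight d i) * h i * z ^ slice_exp d n i l))"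
  proof (intro sum.cong refl)
    fix l i assume l: "l \<in> {..<n}" and i: "i \<in> {1..<d}"
    let ?E = "?D - (d - i) * d ^ l"
    have lt: "(d - i) * d ^ l < ?D"
    proof -
      have "(d - i) * d ^ l < d * d ^ l" using i d by simp
      also have "\<dots> \<le> ?D" using l by (intro sub_exp_le) auto
      finally show ?thesis .
    qed
    have E: "of_nat ?E = D - of_nat (d - i) * of_nat (d ^ l)" using lt by (simp add: of_nat_diff D_def)
    have "?E = Suc (slice_exp d n i l)" using i lt by (simp add: slice_exp_def)
    hence zE: "z ^ ?E = z * z ^ slice_exp d n i l" by simp
    have "z * (of_nat ?E * z ^ (?E - 1)) - D * z ^ ?E = - (of_nat (d - i) * of_nat (d ^ l) * (z * z ^ slice_exp d n i l))"
      unfolding ez unfolding E zE by (simp add: algebra_simps)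
    moreover have "of_nat (d ^ (n - 1 - l)) * h i * - (of_nat (d - i) * of_nat (d ^ l) * (z * z ^ slice_exp d n i l)) =
      - (of_nat (d ^ (n - 1 - l)) * of_nat (d ^ l)) * z * (of_nat (d - i) * h i * z ^ slice_exp d n i l)" by (simp add: mult_ac)
    ultimately show "of_nat (d ^ (n - 1 - l)) * h i * (z * (of_nat ?E * z ^ (?E - 1)) - D * z ^ ?E) =
      - (of_nat (d ^ (n - 1)) * z) * (of_nat (slice_weight d i) * h i * z ^ slice_exp d n i l)"
      using l i by (simp only: pw lessThan_iff) (simp add: slice_weight_def)
  qed
  finally have 1: "z * A' - D * A = - (of_nat (d ^ (n - 1)) * z) * (\<Sum>l<n. \<Sum>i\<in>{1..<d}. of_nat (slice_weight d i) * h i * z ^ slice_exp d n i l)"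
    by (simp add: sum_distrib_left)
  have "z * B' = (\<Sum>l<n. \<Sum>i\<in>{1..<d}. of_nat (d ^ (n - 1 - l)) * h (Suc d + i) * (z * (of_nat (i * d ^ l) * z ^ (i * d ^ l - 1))))"
    unfolding B'_def hi_den_def
    by (simp add: poly_sum poly_monom pderiv_sum pderiv_monom sum_distrib_left mult_ac)
  also have "\<dots> = (\<Sum>l<n. \<Sum>i\<in>{1..<d}. of_nat (d ^ (n - 1)) * (of_nat (slice_weight d (Suc d + i)) * h (Suc d + i) * z ^ slice_exp d n (Suc d + i) l))"
  proof (intro sum.cong refl)
    fix l i assume l: "l \<in> {..<n}" and i: "i \<in> {1..<d}"
    have "of_nat (d ^ (n - 1 - l)) * h (Suc d + i) * (of_nat (i * d ^ l) * z ^ (i * d ^ l)) =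
      (of_nat (d ^ (n - 1 - l)) * of_nat (d ^ l)) * (of_nat i * h (Suc d + i) * z ^ (i * d ^ l))" by (simp add: mult_ac)
    then show "of_nat (d ^ (n - 1 - l)) * h (Suc d + i) * (z * (of_nat (i * d ^ l) * z ^ (i * d ^ l - 1))) =
      of_nat (d ^ (n - 1)) * (of_nat (slice_weight d (Suc d + i)) * h (Suc d + i) * z ^ slice_exp d n (Suc d + i) l)"
      unfolding ez using l i by (simp only: pw lessThan_iff) (simp add: slice_weight_def slice_exp_def)
  qed
  finally have 2: "z * B' = of_nat (d ^ (n - 1)) * (\<Sum>l<n. \<Sum>i\<in>{1..<d}. of_nat (slice_weight d (Suc d + i)) * h (Suc d + i) * z ^ slice_exp d n (Suc d + i) l)"
    by (simp add: sum_distrib_left)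
  have "z * fps_nth lam 1 = z * (- of_nat (d ^ (n - 1)) * (\<Sum>l<n. \<Sum>i\<in>slice_vars d. of_nat (slice_weight d i) * h i * z ^ slice_exp d n i l))"
    unfolding main 1 2 sum_slice_vars sum.distrib by (simp add: algebra_simps)
  then show "fps_nth lam 1 = - of_nat (d ^ (n - 1)) *
      (\<Sum>l<n. \<Sum>i\<in>slice_vars d. of_nat (slice_weight d i) * h i * z ^ slice_exp d n i l)"
    by (rule mult_left_cancel[THEN iffD1, OF z0])
qed

end

text \<open>
  The exponents are strictly between \<open>0\<close> and \<open>d\<^sup>n - 1\<close>, and \<open>e(j,0)\<close> is either less than \<open>d\<close> or
  greater than \<open>d\<^sup>n - 1 - d\<close>. For \<open>n \<ge> 3\<close> no other exponent can be equal to it: a numerator and a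
  denominator exponent could only meet if \<open>a d\<^sup>l + b = d\<^sup>n - 1\<close> for some \<open>a, b < d\<close>, but the left hand side
  is smaller, because \<open>b < d\<^bsup>n-1\<^esup> - 1\<close>.
\<close>

lemma slice_exp_bounds:
  assumes d: "d \<ge> 2" and n: "n \<ge> 3" and i: "i \<in> slice_vars d" and l: "l < n"
  shows "1 \<le> slice_exp d n i l" "slice_exp d n i l + 2 \<le> d ^ n"
    and "j \<in> slice_vars d \<Longrightarrow> slice_exp d n i l = slice_exp d n j 0 \<Longrightarrow> i = j \<and> l = 0"
proof -
  define E where "E = d ^ (n - 1)"
  have nE: "d ^ n = d * E" using n by (simp add: E_def power_eq_if)
  have "d ^ 2 \<le> E" unfolding E_def using d n by (intro power_increasing) auto
  moreover have "d ^ 2 \<ge> 2 * d" using d by (simp add: power2_eq_square)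
  ultimately have Ed: "2 * d \<le> E" by linarith
  have pl: "1 \<le> d ^ l" "d ^ l \<le> E" unfolding E_def using d l by (auto intro!: power_increasing)
  have bound: "a * d ^ l + E \<le> d ^ n" "1 \<le> a * d ^ l" if "1 \<le> a" "a < d" for a
  proof -
    have "a * d ^ l \<le> (d - 1) * E" using that pl by (intro mult_le_mono) auto
    moreover have "(d - 1) * E + E = d * E" using d by (metis Suc_diff_1 add.commute le_trans mult_Suc pos2 less_le_trans)
    ultimately show "a * d ^ l + E \<le> d ^ n" unfolding nE by linarith
    show "1 \<le> a * d ^ l" using that pl by (metis mult_le_mono mult_1)
  qed
  have big: "a * d ^ l = b \<Longrightarrow> 1 \<le> a \<Longrightarrow> b < d \<Longrightarrow> l = 0 \<and> a = b" for a b
  proof -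
    assume ab: "a * d ^ l = b" "1 \<le> a" "b < d"
    have "l = 0"
    proof (rule ccontr)
      assume "l \<noteq> 0"
      hence "d ^ 1 \<le> d ^ l" using d by (intro power_increasing) auto
      hence "d \<le> a * d ^ l" using ab(2) mult_le_mono[of 1 a d "d ^ l"] by simp
      with ab show False by simp
    qed
    then show ?thesis using ab by simp
  qed
  have a1: "1 \<le> d - i" "d - i < d" if "1 \<le> i \<and> i < d" using that by auto
  have a2: "1 \<le> i - Suc d" "i - Suc d < d" if "Suc d + 1 \<le> i \<and> i < Suc d + d" using that by auto
  have cases_i: "(1 \<le> i \<and> i < d) \<or> (Suc d + 1 \<le> i \<and> i < Suc d + d)" using i by (auto simp: slice_vars_def)
  then show "1 \<le> slice_exp d n i l"
  proof
    assume ij: "1 \<le> i \<and> i < d"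
    then show ?thesis using bound[OF a1[OF ij]] Ed d by (simp add: slice_exp_def)
  next
    assume ij: "Suc d + 1 \<le> i \<and> i < Suc d + d"
    then show ?thesis using bound[OF a2[OF ij]] Ed d by (simp add: slice_exp_def)
  qed
  from cases_i show "slice_exp d n i l + 2 \<le> d ^ n"
  proof
    assume ij: "1 \<le> i \<and> i < d"
    define Y where "Y = (d - i) * d ^ l"
    have "Y + E \<le> d ^ n" "1 \<le> Y" unfolding Y_def by (rule bound[OF a1[OF ij]])+
    moreover have "slice_exp d n i l = d ^ n - 1 - Y" using ij by (simp add: slice_exp_def Y_def)
    ultimately show ?thesis using Ed d by linarith
  next
    assume ij: "Suc d + 1 \<le> i \<and> i < Suc d + d"
    then show ?thesis using bound[OF a2[OF ij]] Ed d by (simp add: slice_exp_def)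
  qed
  assume j: "j \<in> slice_vars d" and eq: "slice_exp d n i l = slice_exp d n j 0"
  have cases_j: "(1 \<le> j \<and> j < d) \<or> (Suc d + 1 \<le> j \<and> j < Suc d + d)" using j by (auto simp: slice_vars_def)
  from cases_i cases_j show "i = j \<and> l = 0"
  proof (elim disjE)
    assume ij: "1 \<le> i \<and> i < d" "1 \<le> j \<and> j < d"
    have "(d - i) * d ^ l = d - j" using eq ij bound[OF a1[OF ij(1)]] Ed d by (simp add: slice_exp_def)
    then have "l = 0 \<and> d - i = d - j" using ij by (intro big) auto
    then show ?thesis using ij by auto
  next
    assume ij: "1 \<le> i \<and> i < d" "Suc d + 1 \<le> j \<and> j < Suc d + d"
    define Y where "Y = (d - i) * d ^ l"
    have "Y + E \<le> d ^ n" unfolding Y_def by (rule bound[OF a1[OF ij(1)]])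
    moreover have "d ^ n - 1 - Y = j - Suc d" using eq ij by (simp add: slice_exp_def Y_def)
    ultimately show ?thesis using Ed d ij by linarith
  next
    assume ij: "Suc d + 1 \<le> i \<and> i < Suc d + d" "1 \<le> j \<and> j < d"
    define Y where "Y = (i - Suc d) * d ^ l"
    have "Y + E \<le> d ^ n" unfolding Y_def by (rule bound[OF a2[OF ij(1)]])
    moreover have "Y = d ^ n - 1 - (d - j)" using eq ij by (simp add: slice_exp_def Y_def)
    ultimately show ?thesis using Ed d ij by linarith
  next
    assume ij: "Suc d + 1 \<le> i \<and> i < Suc d + d" "Suc d + 1 \<le> j \<and> j < Suc d + d"
    have "(i - Suc d) * d ^ l = j - Suc d" using eq ij by (simp add: slice_exp_def)
    then have "l = 0 \<and> i - Suc d = j - Suc d" using ij by (intro big) auto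
    then show ?thesis using ij by auto
  qed
qed

lemma poly_eq_infinite:
  fixes p q :: "'a::idom poly"
  assumes "infinite (UNIV :: 'a set)" "\<And>x. poly p x = poly q x"
  shows "p = q"
proof (rule ccontr)
  assume "p \<noteq> q"
  hence "finite {x. poly (p - q) x = 0}" by (intro poly_roots_finite) auto
  then show False using assms by simp
qed

lemma infinite_UNIV_fps:
  assumes "infinite (UNIV :: 'a::field set)"
  shows "infinite (UNIV :: 'a fps set)"
proof
  assume "finite (UNIV :: 'a fps set)"
  hence "finite (range (fps_const :: 'a \<Rightarrow> 'a fps))" by (rule finite_subset[OF subset_UNIV])
  moreover have "inj (fps_const :: 'a \<Rightarrow> 'a fps)" by (rule injI) simp
  ultimately show False using assms finite_imageD by blast
qed

text \<open>
  Over power series the fixed points of the \<open>n\<close>-th iterate are known explicitly: the lifts \<open>xs z\<close> of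
  the \<open>d\<^sup>n\<close> roots of \<open>z\<^bsup>D\<^esup> = z\<close>, \<open>D = d\<^sup>n\<close>, which are simple, and \<open>\<infinity>\<close>. After the conjugation with
  a constant \<open>\<tau>\<close> that is not among these roots, they become the roots \<open>g z = 1 / (\<tau> - xs z)\<close> and \<open>0\<close>
  of the moved fixed point polynomial, so that the multiplier form factors as \<open>A \<chi>(u)\<close> with
  \<open>\<chi> = \<Prod> (u + lr r)\<close>. No root is double, and hence \<open>1\<close> is not a multiplier.
\<close>

lemma slice_multipliers:
  fixes h :: "nat \<Rightarrow> 'a::alg_closed_field"
  assumes d: "d \<ge> 2" and n: "n \<ge> 1" and char: "of_nat (d ^ n - 1) \<noteq> (0::'a)"
  defines "x \<equiv> slice d (\<lambda>i. fps_X * fps_const (h i))"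
  obtains \<tau> A \<chi> lam where "A \<noteq> 0"
    "\<And>j. poly (coeff (generic_form d n x) j) (fps_const \<tau>) = A * coeff \<chi> j"
    "coeff \<chi> (Suc (d ^ n)) = 1" "degree \<chi> \<le> Suc (d ^ n)" "poly \<chi> (- 1) \<noteq> 0"
    "\<And>z. z \<in> unity_roots (d ^ n - 1) \<Longrightarrow> poly \<chi> (- lam z) = 0 \<and> fps_nth (lam z) 0 = of_nat (d ^ n) \<and>
       fps_nth (lam z) 1 = - of_nat (d ^ (n - 1)) *
         (\<Sum>l<n. \<Sum>i\<in>slice_vars d. of_nat (slice_weight d i) * h i * z ^ slice_exp d n i l)"
proof -
  let ?D = "d ^ n"
  have D2: "?D \<ge> 2" using d n power_ge_2 by blast
  define P where "P = iter_num d (coord_num d x) (coord_den d x) n"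
  define Q where "Q = iter_den d (coord_num d x) (coord_den d x) n"
  define f where "f = fix_poly P Q"
  have deg: "degree P \<le> ?D" "degree Q \<le> ?D" unfolding P_def Q_def by (rule degree_iter)+
  have loP: "lo P = monom 1 ?D" and loQ: "lo Q = 1" unfolding P_def Q_def x_def by (rule lo_iter[OF d])+
  have lof: "lo f = monom 1 ?D - [:0, 1:]"
    by (simp add: f_def fix_poly_def lo_simps loP loQ one_pCons)
  have lofx: "poly (lo f) z = z ^ ?D - z" for z by (simp add: lof poly_monom)
  have simple: "poly (pderiv (lo f)) z \<noteq> 0" if "poly (lo f) z = 0" for z
  proof -
    have zD: "z ^ ?D = z" using that by (simp add: lofx)
    have v: "poly (pderiv (lo f)) z = of_nat ?D * z ^ (?D - 1) - 1"
      unfolding lof pderiv_diff poly_diff by (simp add: pderiv_monom poly_monom pderiv_pCons)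
    show ?thesis
    proof (cases "z = 0")
      case True
      then show ?thesis unfolding v using D2 by (simp add: zero_power)
    next
      case False
      have "z * z ^ (?D - 1) = z * 1" using zD D2 by (metis Suc_diff_1 less_le_trans mult.right_neutral pos2 power_Suc)
      hence "z ^ (?D - 1) = 1" by (rule mult_left_cancel[THEN iffD1, OF False])
      then have "poly (pderiv (lo f)) z = of_nat (?D - 1)" unfolding v using D2 by (simp add: of_nat_diff)
      then show ?thesis using char by simp
    qed
  qed
  define Z where "Z = {z. poly (lo f) z = 0}"
  have Z: "card Z = ?D" unfolding Z_def
  proof (rule card_simple_roots[OF _ _ simple])
    show "degree (lo f) \<le> ?D" unfolding lof using D2 n d by (intro degree_diff_le order_trans[OF degree_monom_le]) auto
    show "coeff (lo f) ?D \<noteq> 0" unfolding lof using D2 n by (auto simp: coeff_pCons split: nat.splits)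
  qed
  have fZ: "finite Z" using Z d by (intro card_ge_0_finite) simp
  obtain \<tau> where \<tau>: "\<tau> \<notin> Z" using fZ infinite_UNIV_alg_closed ex_new_if_finite by blast
  define t where "t = fps_const \<tau>"
  have "\<forall>z\<in>Z. \<exists>y. poly f y = 0 \<and> fps_nth y 0 = z"
  proof
    fix z assume "z \<in> Z"
    hence r: "poly (lo f) z = 0" by (simp add: Z_def)
    show "\<exists>y. poly f y = 0 \<and> fps_nth y 0 = z" by (rule hensel[OF r simple[OF r]]) blast
  qed
  then obtain xs where xs: "\<And>z. z \<in> Z \<Longrightarrow> poly f (xs z) = 0" "\<And>z. z \<in> Z \<Longrightarrow> fps_nth (xs z) 0 = z" by metis
  define g where "g z = inverse (t - xs z)" for z
  have g0: "fps_nth (t - xs z) 0 \<noteq> 0" if "z \<in> Z" for z using xs(2)[OF that] \<tau> that by (auto simp: t_def)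
  have g1: "(t - xs z) * g z = 1" if "z \<in> Z" for z unfolding g_def by (rule inverse_mult_eq_1'[OF g0[OF that]])
  define q where "q = moved_den d n x t"
  define F where "F = moved_fix d n x t"
  have q: "q = conj_den 0 1 (- 1) t ?D P Q" unfolding q_def moved_den_def P_def Q_def ..
  have F: "F = fix_poly (conj_num 0 1 (- 1) t ?D P Q) (conj_den 0 1 (- 1) t ?D P Q)"
    unfolding F_def moved_fix_def moved_num_def moved_den_def P_def Q_def ..
  have det: "0 * t - 1 * (- 1) = 1" by simp
  define s where "s z = ((- 1) * xs z + t) * (0 - (- 1) * g z) ^ ?D" for z
  have at: "poly F (g z) = 0 \<and> poly q (g z) = s z * poly Q (xs z) \<and>
      poly (pderiv F) (g z) = s z * poly (pderiv f) (xs z) \<and> fps_nth (s z) 0 \<noteq> 0" if z: "z \<in> Z" for z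
  proof -
    have w: "((- 1) * xs z + t) * g z = 0 * xs z + 1" using g1[OF z] by (simp add: algebra_simps)
    note C = conj_at_fixed_point[OF deg det xs(1)[OF z, unfolded f_def] w]
    have "fps_nth (t - xs z) 0 * fps_nth (g z) 0 = 1" using arg_cong[OF g1[OF z], of "\<lambda>f. fps_nth f 0"] by simp
    hence "fps_nth (g z) 0 \<noteq> 0" by auto
    hence "fps_nth (s z) 0 \<noteq> 0" using g0[OF z] by (simp add: s_def fps_power_zeroth)
    with C show ?thesis unfolding F q f_def s_def by blast
  qed
  \<comment> \<open>\<open>\<infinity>\<close> is fixed along the whole line, and the conjugation moves it to \<open>0\<close>.\<close>
  have cQ: "coeff Q ?D = 0"
  proof -
    have "coeff (coord_den d x) d = 0" using d by (simp add: coeff_coord x_def slice_def slice_vars_def)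
    hence "coeff (iter_den d (coord_num d x) (coord_den d x) m) (d ^ m) = 0" for m
    proof (induction m)
      case (Suc m)
      have "coeff (iter_den d (coord_num d x) (coord_den d x) (Suc m)) (d * d ^ m) =
        hom_eval d (coord_den d x) (coeff (iter_num d (coord_num d x) (coord_den d x) m) (d ^ m)) 0"
        unfolding iter_pair.simps snd_conv coeff_hom_subst_top[OF degree_iter] using Suc by simp
      then show ?case using Suc.prems by (simp add: hom_eval_infinity)
    qed simp
    then show ?thesis by (simp add: Q_def)
  qed
  have F0: "poly F 0 = 0"
  proof -
    have "coeff f (Suc ?D) = 0" using cQ deg by (simp add: f_def fix_poly_def coeff_eq_0)
    then show ?thesis unfolding F fix_poly_conj[OF deg] poly_hom_subst f_def[symmetric] by (simp add: hom_eval_infinity)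
  qed
  have q0: "fps_nth (poly q 0) 0 \<noteq> 0"
  proof -
    have "poly q 0 = - (coeff P ?D * (- 1) ^ ?D)"
      unfolding q conj_den_def poly_add poly_smult poly_hom_subst using cQ by (simp add: hom_eval_infinity)
    moreover have "fps_nth (coeff P ?D) 0 = 1" using arg_cong[OF loP, of "\<lambda>p. coeff p ?D"] by simp
    ultimately show ?thesis by (simp add: fps_power_zeroth)
  qed
  define R where "R = insert 0 (g ` Z)"
  have gn0: "g z \<noteq> 0" if "z \<in> Z" for z using g1[OF that] by auto
  have injg: "inj_on g Z"
  proof (rule inj_onI)
    fix z z' assume z: "z \<in> Z" "z' \<in> Z" "g z = g z'"
    have "(t - xs z) * g z = (t - xs z') * g z" using g1[OF z(1)] g1[OF z(2)] z(3) by simp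
    hence "t - xs z = t - xs z'" by (rule mult_right_cancel[THEN iffD1, OF gn0[OF z(1)]])
    hence "xs z = xs z'" by simp
    then show "z = z'" using xs(2)[OF z(1)] xs(2)[OF z(2)] by metis
  qed
  have R: "finite R" "card R = Suc ?D"
    using fZ gn0 Z card_image[OF injg] by (auto simp: R_def card_insert_if)
  have rootsR: "poly F r = 0" if "r \<in> R" for r using that at F0 by (auto simp: R_def)
  have qR: "fps_nth (poly q r) 0 \<noteq> 0" if "r \<in> R" for r
  proof -
    have "fps_nth (poly Q (xs z)) 0 = 1" if "z \<in> Z" for z by (simp add: fps_nth_poly_0 loQ)
    then show ?thesis using that at q0 by (auto simp: R_def)
  qed
  have degF: "degree F \<le> Suc ?D" unfolding F_def by (rule degree_moved)
  obtain w where w: "F = smult (coeff F (Suc ?D)) (\<Prod>i<Suc ?D. [:- w i, 1:])" "bij_betw w {..<Suc ?D} R"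
    by (rule split_distinct_roots[OF degF R _ rootsR]) simp_all
  have wR: "w i \<in> R" if "i < Suc ?D" for i using w(2) that by (auto simp: bij_betw_def)
  define l where "l = coeff F (Suc ?D)"
  have l: "l \<noteq> 0"
  proof -
    have "l = poly f t" unfolding l_def F f_def by (rule coeff_moved_fix_poly[OF deg])
    moreover have "fps_nth (poly f t) 0 \<noteq> 0" using \<tau> by (simp add: fps_nth_poly_0 t_def Z_def)
    ultimately show ?thesis by auto
  qed
  \<comment> \<open>The multiplier at the root \<open>r\<close>.\<close>
  define lr where "lr r = (poly q r + poly (pderiv F) r) * inverse (poly q r)" for r
  have lr: "lr r * poly q r = poly q r + poly (pderiv F) r" if "r \<in> R" for r
    using inverse_mult_eq_1[OF qR[OF that]] by (simp add: lr_def mult.assoc)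
  define \<chi> where "\<chi> = (\<Prod>i<Suc ?D. [:- (- lr (w i)), 1:])"
  define A where "A = (l * l ^ (?D * Suc ?D)) ^ 2 * (\<Prod>i<Suc ?D. poly q (w i)) ^ 2"
  have mf: "mult_form d n x t u = A * poly \<chi> u" for u
  proof -
    have "(\<Prod>i<Suc ?D. u * poly q (w i) + (poly q (w i) + poly (pderiv F) (w i))) =
        (\<Prod>i<Suc ?D. poly q (w i) * (lr (w i) + u))"
    proof (rule prod.cong[OF refl])
      fix i assume "i \<in> {..<Suc ?D}"
      then have "lr (w i) * poly q (w i) = poly q (w i) + poly (pderiv F) (w i)" using lr wR by simp
      then show "u * poly q (w i) + (poly q (w i) + poly (pderiv F) (w i)) = poly q (w i) * (lr (w i) + u)"
        by (simp add: algebra_simps)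
    qed
    also have "\<dots> = (\<Prod>i<Suc ?D. poly q (w i)) * poly \<chi> u"
      unfolding prod.distrib by (simp add: \<chi>_def poly_prod del: prod.lessThan_Suc)
    finally have *: "(\<Prod>i<Suc ?D. u * poly q (w i) + (poly q (w i) + poly (pderiv F) (w i))) =
        (\<Prod>i<Suc ?D. poly q (w i)) * poly \<chi> u" .
    show ?thesis
      using mult_form_roots[OF w(1)[unfolded F_def], of u] unfolding F_def[symmetric] q_def[symmetric] * l_def[symmetric] A_def
      by (simp add: power2_eq_square mult_ac del: prod.lessThan_Suc)
  qed
  have "map_poly (\<lambda>c. poly c t) (generic_form d n x) = smult A \<chi>"
    by (rule poly_eq_infinite[OF infinite_UNIV_fps[OF infinite_UNIV_alg_closed]]) (simp add: generic_form_eval mf)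
  hence "coeff (map_poly (\<lambda>c. poly c t) (generic_form d n x)) j = A * coeff \<chi> j" for j by simp
  hence co: "poly (coeff (generic_form d n x) j) t = A * coeff \<chi> j" for j by (simp add: coeff_map_poly)
  have A0: "A \<noteq> 0"
  proof -
    have "poly q (w i) \<noteq> 0" if "i < Suc ?D" for i using qR[OF wR[OF that]] by auto
    then show ?thesis using l by (simp add: A_def del: prod.lessThan_Suc)
  qed
  have mon: "coeff \<chi> (Suc ?D) = 1" "degree \<chi> \<le> Suc ?D"
    using newton_poly_monic[of "\<lambda>i. - lr (w i)" "Suc ?D"] unfolding \<chi>_def newton_poly_def by (auto intro: degree_le)
  have chi1: "poly \<chi> (- 1) \<noteq> 0"
  proof
    assume "poly \<chi> (- 1) = 0"
    hence "(\<Prod>i<Suc ?D. lr (w i) - 1) = 0" by (simp add: \<chi>_def poly_prod del: prod.lessThan_Suc)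
    hence "\<exists>i\<in>{..<Suc ?D}. lr (w i) - 1 = 0" by (subst (asm) prod_zero_iff) auto
    then obtain i where i: "i < Suc ?D" "lr (w i) = 1" by (metis eq_iff_diff_eq_0 lessThan_iff)
    have F'0: "poly (pderiv F) (w i) = 0" using lr[OF wR[OF i(1)]] i(2) by simp
    define k where "k = smult l (\<Prod>j\<in>{..<Suc ?D} - {i}. [:- w j, 1:])"
    have "(\<Prod>j<Suc ?D. [:- w j, 1:]) = [:- w i, 1:] * (\<Prod>j\<in>{..<Suc ?D} - {i}. [:- w j, 1:])"
      using i by (intro prod.remove) auto
    hence "F = [:- w i, 1:] * k" using w(1) unfolding l_def[symmetric] k_def by (metis mult_smult_right)
    hence "poly (pderiv F) (w i) = poly k (w i)"
      by (simp only: pderiv_mult poly_add poly_mult) (simp add: pderiv_pCons)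
    also have "\<dots> = l * (\<Prod>j\<in>{..<Suc ?D} - {i}. w i - w j)" by (simp add: k_def poly_prod)
    also have "\<dots> \<noteq> 0" using l i w(2) by (auto simp: prod_zero_iff bij_betw_def inj_on_def)
    finally show False using F'0 by simp
  qed
  show ?thesis
  proof (rule that[OF A0 co[unfolded t_def] mon chi1, of "\<lambda>z. lr (g z)"])
    fix z :: 'a assume z: "z \<in> unity_roots (?D - 1)"
    have z1: "z ^ (?D - 1) = 1" using z by (simp add: unity_roots_def)
    hence "z ^ ?D = z" using D2 by (metis Suc_diff_1 less_le_trans mult.right_neutral pos2 power_Suc)
    hence zZ: "z \<in> Z" by (simp add: Z_def lofx)
    hence "g z \<in> R" by (simp add: R_def)
    then obtain i where i: "i < Suc ?D" "w i = g z" using w(2) by (auto simp: bij_betw_def)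
    have "poly \<chi> (- lr (g z)) = (\<Prod>i<Suc ?D. lr (w i) - lr (g z))"
      by (simp add: \<chi>_def poly_prod del: prod.lessThan_Suc)
    also have "\<dots> = 0" using i by (intro prod_zero bexI[of _ i]) auto
    finally have 1: "poly \<chi> (- lr (g z)) = 0" .
    have P: "poly P (xs z) = xs z * poly Q (xs z)" using xs(1)[OF zZ] by (simp add: f_def fix_poly_def)
    have s0: "s z \<noteq> 0" using at[OF zZ] by auto
    have "s z * (lr (g z) * poly Q (xs z)) = s z * (poly Q (xs z) + poly (pderiv f) (xs z))"
      using lr[OF \<open>g z \<in> R\<close>] at[OF zZ] by (simp add: algebra_simps)
    hence "lr (g z) * poly Q (xs z) = poly Q (xs z) + poly (pderiv f) (xs z)" by (rule mult_left_cancel[THEN iffD1, OF s0])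
    also have "\<dots> = poly (pderiv P) (xs z) - xs z * poly (pderiv Q) (xs z)"
      by (simp add: f_def fix_poly_def pderiv_diff pderiv_pCons)
    finally have lam: "lr (g z) * poly Q (xs z) = poly (pderiv P) (xs z) - xs z * poly (pderiv Q) (xs z)" .
    show "poly \<chi> (- lr (g z)) = 0 \<and> fps_nth (lr (g z)) 0 = of_nat ?D \<and>
       fps_nth (lr (g z)) 1 = - of_nat (d ^ (n - 1)) *
         (\<Sum>l<n. \<Sum>i\<in>slice_vars d. of_nat (slice_weight d i) * h i * z ^ slice_exp d n i l)"
      using 1 multiplier_expansion[OF d n z1 P[unfolded P_def Q_def x_def] xs(2)[OF zZ] lam[unfolded P_def Q_def x_def]] by blast
  qed
qed


section \<open>The multipliers separate points of the slice near the power map\<close>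

text \<open>
  Summing against \<open>z\<^bsup>-e(i,0)\<^esup>\<close> over the roots of unity removes all terms of the expansion except the
  one with \<open>j = i\<close> and \<open>l = 0\<close>; dividing by its coefficient and by the number of roots leaves \<open>h\<^sub>i\<close>. The constant
  term disappears because it is the same for all \<open>z\<close> and \<open>e(i,0)\<close> is not divisible by \<open>d\<^sup>n - 1\<close>.
\<close>

lemma slice_dual_basis:
  fixes h :: "nat \<Rightarrow> 'a::alg_closed_field"
  assumes d: "d \<ge> 2" and n: "n \<ge> 3" and char: "of_nat (d ^ n - 1) \<noteq> (0::'a)"
    and small: "\<And>j. 1 \<le> j \<Longrightarrow> j \<le> d \<Longrightarrow> of_nat j \<noteq> (0::'a)"
    and lam: "\<And>z. z \<in> unity_roots (d ^ n - 1) \<Longrightarrow> fps_nth (lam z) 0 = of_nat (d ^ n) \<and>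
       fps_nth (lam z) 1 = - of_nat (d ^ (n - 1)) *
         (\<Sum>l<n. \<Sum>i\<in>slice_vars d. of_nat (slice_weight d i) * h i * z ^ slice_exp d n i l)"
    and i: "i \<in> slice_vars d"
  defines "e \<equiv> \<lambda>z. z ^ (d ^ n - 1 - slice_exp d n i 0) / (- of_nat (d ^ (n - 1)) * of_nat (slice_weight d i) * of_nat (d ^ n - 1))"
  defines "\<nu> \<equiv> (\<Sum>z\<in>unity_roots (d ^ n - 1). fps_const (e z) * lam z)"
  shows "fps_nth \<nu> 0 = 0" and "fps_nth \<nu> 1 = h i"
proof -
  define N where "N = d ^ n - 1"
  define a where "a = N - slice_exp d n i 0"
  define C :: 'a where "C = - of_nat (d ^ (n - 1))"
  define w :: 'a where "w = of_nat (slice_weight d i)"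
  have C0: "C \<noteq> 0" using small[of d] d by (simp add: C_def)
  have w0: "w \<noteq> 0" unfolding w_def using i by (intro small) (auto simp: slice_weight_def slice_vars_def)
  have N0: "of_nat N \<noteq> (0::'a)" using char by (simp add: N_def)
  have n0: "0 < n" using n by simp
  have b0: "1 \<le> slice_exp d n i 0" "slice_exp d n i 0 + 2 \<le> d ^ n"
    using slice_exp_bounds[OF d n i n0] by auto
  have a: "1 \<le> a" "a < N" "a + slice_exp d n i 0 = N" using b0 by (auto simp: a_def N_def)
  have N1: "N \<ge> 1" using a by simp
  note US = unity_roots_sum[OF N1 N0]
  have e: "e z = z ^ a / (C * w * of_nat N)" for z by (simp add: e_def a_def C_def w_def N_def)
  have "fps_nth \<nu> 0 = (\<Sum>z\<in>unity_roots N. e z * of_nat (d ^ n))"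
    using lam unfolding \<nu>_def N_def by (simp add: fps_sum_nth)
  also have "\<dots> = (\<Sum>z\<in>unity_roots N. z ^ a) * (of_nat (d ^ n) / (C * w * of_nat N))"
    by (simp add: e sum_distrib_right sum_divide_distrib)
  also have "\<not> N dvd a" using a by (auto dest: dvd_imp_le)
  hence "(\<Sum>z\<in>unity_roots N. z ^ a) = (0::'a)" by (simp add: US)
  finally show "fps_nth \<nu> 0 = 0" by simp
  have "fps_nth \<nu> 1 = (\<Sum>z\<in>unity_roots N. e z * (C * (\<Sum>l<n. \<Sum>j\<in>slice_vars d. of_nat (slice_weight d j) * h j * z ^ slice_exp d n j l)))"
    using lam unfolding \<nu>_def N_def C_def by (simp add: fps_sum_nth)
  also have "\<dots> = (\<Sum>z\<in>unity_roots N. \<Sum>l<n. \<Sum>j\<in>slice_vars d. of_nat (slice_weight d j) * h j / (w * of_nat N) * z ^ (a + slice_exp d n j l))"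
    unfolding e using C0 by (simp add: sum_distrib_left power_add field_simps)
  also have "\<dots> = (\<Sum>l<n. \<Sum>j\<in>slice_vars d. of_nat (slice_weight d j) * h j / (w * of_nat N) * (\<Sum>z\<in>unity_roots N. z ^ (a + slice_exp d n j l)))"
    unfolding sum_distrib_left by (subst sum.swap, intro sum.cong refl, rule sum.swap)
  also have "\<dots> = (\<Sum>l<n. \<Sum>j\<in>slice_vars d. if j = i \<and> l = 0 then h i else 0)"
  proof (intro sum.cong refl)
    fix l j assume l: "l \<in> {..<n}" and j: "j \<in> slice_vars d"
    have l': "l < n" using l by simp
    note B = slice_exp_bounds[OF d n j l']
    \<comment> \<open>Both exponents are less than \<open>N\<close>, so the only possible multiple of \<open>N\<close> is \<open>N\<close> itself.\<close>
    have dvd: "N dvd a + slice_exp d n j l \<longleftrightarrow> slice_exp d n j l = slice_exp d n i 0"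
    proof
      assume "N dvd a + slice_exp d n j l"
      then obtain k where k: "a + slice_exp d n j l = N * k" by (elim dvdE)
      have "a + slice_exp d n j l < 2 * N" using a B(2) by (simp add: N_def)
      hence "N * k < N * 2" using k by simp
      hence "k < 2" using N1 by (simp only: mult_less_cancel1)
      moreover have "k \<noteq> 0"
      proof
        assume "k = 0"
        with k have "a = 0" by simp
        with a(1) show False by simp
      qed
      ultimately have "k = 1" by simp
      then show "slice_exp d n j l = slice_exp d n i 0" using k a(3) by simp
    next
      assume "slice_exp d n j l = slice_exp d n i 0"
      then show "N dvd a + slice_exp d n j l" using a(3) by simp
    qed
    have "slice_exp d n j l = slice_exp d n i 0 \<longleftrightarrow> j = i \<and> l = 0" using B(3)[OF i] by auto
    then show "of_nat (slice_weight d j) * h j / (w * of_nat N) * (\<Sum>z\<in>unity_roots N. z ^ (a + slice_exp d n j l)) =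
        (if j = i \<and> l = 0 then h i else 0)"
      unfolding US dvd using w0 N0 by (auto simp: w_def)
  qed
  also have "\<dots> = (\<Sum>l<n. if l = 0 then h i else 0)"
    using i by (intro sum.cong refl) (simp add: if_distrib cong: if_cong)
  also have "\<dots> = h i" using n0 by simp
  finally show "fps_nth \<nu> 1 = h i" .
qed

section \<open>Algebraic relations between slice coordinates and multipliers\<close>

lemma inj_comm_ring_hom_to_ac: "inj_comm_ring_hom (to_ac :: 'k::field \<Rightarrow> 'k alg_closure)"
  by unfold_locales simp_all

lemma slice_hom:
  assumes "comm_ring_hom g"
  shows "g (slice d h i) = slice d (\<lambda>i. g (h i)) i"
proof -
  interpret g: comm_ring_hom g by fact
  show ?thesis by (simp add: slice_def)
qed

lemma mpol_eval_mult_coeff: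
  fixes h :: "'a::idom \<Rightarrow> 'r::idom"
  assumes "comm_ring_hom h"
  shows "mpol_eval h x (mult_coeff d n y j r) = mult_coeff d n (\<lambda>i. mpol_eval h x (y i)) j r"
proof -
  interpret h: comm_ring_hom h by fact
  interpret e: idom_hom "mpol_eval h x" using h.mpol_eval_hom by (simp add: idom_hom_def)
  show ?thesis by (rule e.hom_mult_coeff)
qed

lemma mpol_eval_slice_coeff:
  fixes h :: "'a::idom \<Rightarrow> 'r::idom"
  assumes "comm_ring_hom h"
  shows "mpol_eval h x (mult_coeff d n (slice d mpol_var) j r) = mult_coeff d n (slice d x) j r"
proof -
  interpret h: comm_ring_hom h by fact
  show ?thesis
    unfolding mpol_eval_mult_coeff[OF assms] slice_hom[OF h.mpol_eval_hom] h.mpol_eval_var ..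
qed

text \<open>
  The identity holds at all points over an algebraically closed field, and hence for the generic
  point; from there it specialises to every domain over the field.
\<close>

lemma mult_coeff_cross_general:
  fixes h :: "'k::field \<Rightarrow> 'r::idom" and x :: "nat \<Rightarrow> 'r"
  assumes h: "comm_ring_hom h" and d: "d \<ge> 2" and n: "n \<ge> 1"
  shows "mult_coeff d n x j r * mult_coeff d n x (Suc (d ^ n)) s = mult_coeff d n x j s * mult_coeff d n x (Suc (d ^ n)) r"
proof -
  interpret h: comm_ring_hom h by fact
  interpret ac: inj_comm_ring_hom "to_ac :: 'k \<Rightarrow> 'k alg_closure" by (rule inj_comm_ring_hom_to_ac)
  let ?y = "mult_coeff d n (mpol_var :: nat \<Rightarrow> 'k mpol)"
  define f where "f = ?y j r * ?y (Suc (d ^ n)) s - ?y j s * ?y (Suc (d ^ n)) r"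
  have "f = 0"
  proof (rule mpol_eval_eq_0_imp[OF inj_comm_ring_hom_to_ac infinite_UNIV_alg_closed])
    fix x :: "nat \<Rightarrow> 'k alg_closure"
    interpret e: comm_ring_hom "mpol_eval to_ac x" by (rule ac.mpol_eval_hom)
    show "mpol_eval to_ac x f = 0"
      unfolding f_def e.hom_minus e.hom_mult mpol_eval_mult_coeff[OF ac.comm_ring_hom_axioms] ac.mpol_eval_var
      using mult_coeff_cross[OF d n, of x j r s] by simp
  qed
  moreover interpret e: comm_ring_hom "mpol_eval h x" by (rule h.mpol_eval_hom)
  have "mpol_eval h x f = mult_coeff d n x j r * mult_coeff d n x (Suc (d ^ n)) s - mult_coeff d n x j s * mult_coeff d n x (Suc (d ^ n)) r"
    unfolding f_def e.hom_minus e.hom_mult mpol_eval_mult_coeff[OF h] h.mpol_eval_var ..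
  ultimately show ?thesis by (simp add: h.mpol_eval_0)
qed

text \<open>
  The form \<open>mult_coeff d n x j r\<close> at the generic point of the slice.
\<close>

definition slice_coeff :: "nat \<Rightarrow> nat \<Rightarrow> nat \<Rightarrow> nat \<Rightarrow> 'k::field mpol" where
  "slice_coeff d n r j = mult_coeff d n (slice d mpol_var) j r"

context
  fixes d n r :: nat and K :: "'k::field itself"
  assumes d: "d \<ge> 2" and n: "n \<ge> 3"
    and small: "\<And>j. 1 \<le> j \<Longrightarrow> j \<le> d \<Longrightarrow> of_nat j \<noteq> (0::'k alg_closure)"
    and char: "of_nat (d ^ n - 1) \<noteq> (0::'k alg_closure)"
    and r: "mult_coeff d n (slice d (\<lambda>_. 0 :: 'k alg_closure)) (Suc (d ^ n)) r \<noteq> 0"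
begin

lemma n_ge_1: "n \<ge> 1" using n by simp

text \<open>
  The coefficients of \<open>\<chi>\<close> are the ratios of the slice forms along the line through the power map.
  The assumption on \<open>r\<close> says that the denominator of these ratios does not vanish at the power map.
\<close>

lemma slice_coeff_expansion:
  fixes h :: "nat \<Rightarrow> 'k alg_closure"
  defines "ev \<equiv> \<lambda>j. mpol_eval (\<lambda>a. fps_const (to_ac a)) (\<lambda>i. fps_X * fps_const (h i)) (slice_coeff d n r j)"
  shows "\<exists>\<chi> lam. fps_nth (ev (Suc (d ^ n))) 0 \<noteq> 0 \<and> (\<forall>j. ev j = ev (Suc (d ^ n)) * coeff \<chi> j) \<and>
    degree \<chi> \<le> Suc (d ^ n) \<and> poly \<chi> (- 1) \<noteq> 0 \<and>
    (\<forall>z\<in>unity_roots (d ^ n - 1). poly \<chi> (- lam z) = 0 \<and> fps_nth (lam z) 0 = of_nat (d ^ n) \<and>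
       fps_nth (lam z) 1 = - of_nat (d ^ (n - 1)) *
         (\<Sum>l<n. \<Sum>i\<in>slice_vars d. of_nat (slice_weight d i) * h i * z ^ slice_exp d n i l))"
proof -
  let ?M = "Suc (d ^ n)"
  interpret ac: inj_comm_ring_hom "to_ac :: 'k \<Rightarrow> 'k alg_closure" by (rule inj_comm_ring_hom_to_ac)
  interpret kk: comm_ring_hom "\<lambda>a. fps_const (to_ac a :: 'k alg_closure)"
    by unfold_locales simp_all
  interpret n0: comm_ring_hom "\<lambda>f :: 'k alg_closure fps. fps_nth f 0" by (rule comm_ring_hom_fps_nth_0)
  interpret i0: idom_hom "\<lambda>f :: 'k alg_closure fps. fps_nth f 0" using n0.comm_ring_hom_axioms by (simp add: idom_hom_def)
  define pt where "pt = slice d (\<lambda>i. fps_X * fps_const (h i))"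
  define y where "y j s = mult_coeff d n pt j s" for j s
  obtain \<tau> A \<chi> lam where A: "A \<noteq> 0"
    and gen: "\<And>j. poly (coeff (generic_form d n pt) j) (fps_const \<tau>) = A * coeff \<chi> j"
    and \<chi>: "coeff \<chi> ?M = 1" "degree \<chi> \<le> ?M" "poly \<chi> (- 1) \<noteq> 0"
    and lam: "\<And>z. z \<in> unity_roots (d ^ n - 1) \<Longrightarrow> poly \<chi> (- lam z) = 0 \<and> fps_nth (lam z) 0 = of_nat (d ^ n) \<and>
       fps_nth (lam z) 1 = - of_nat (d ^ (n - 1)) *
         (\<Sum>l<n. \<Sum>i\<in>slice_vars d. of_nat (slice_weight d i) * h i * z ^ slice_exp d n i l)"
    unfolding pt_def by (rule slice_multipliers[OF d n_ge_1 char, of h]) blast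
  have ev: "ev j = y j r" for j
    unfolding ev_def slice_coeff_def mpol_eval_slice_coeff[OF kk.comm_ring_hom_axioms] y_def pt_def ..
  have rel: "y j r = y ?M r * coeff \<chi> j" for j
  proof -
    have cross: "y j r * y ?M s = y j s * y ?M r" for s
      unfolding y_def by (rule mult_coeff_cross_general[OF kk.comm_ring_hom_axioms d n_ge_1])
    have "smult (y j r) (coeff (generic_form d n pt) ?M) = smult (y ?M r) (coeff (generic_form d n pt) j)"
      using cross by (intro poly_eqI) (simp add: y_def mult_coeff_def mult.commute)
    from arg_cong[OF this, of "\<lambda>p. poly p (fps_const \<tau>)"]
    have "A * y j r = A * (y ?M r * coeff \<chi> j)" by (simp add: gen \<chi>(1) mult_ac)
    then show ?thesis by (rule mult_left_cancel[THEN iffD1, OF A])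
  qed
  have "fps_nth (y ?M r) 0 = mult_coeff d n (\<lambda>i. fps_nth (pt i) 0) ?M r"
    unfolding y_def by (rule i0.hom_mult_coeff)
  also have "(\<lambda>i. fps_nth (pt i) 0) = slice d (\<lambda>_. 0)" by (auto simp: pt_def slice_def)
  finally have "fps_nth (y ?M r) 0 \<noteq> 0" using r by simp
  then show ?thesis unfolding ev using rel \<chi>(2,3) lam by (intro exI[of _ \<chi>] exI[of _ lam] conjI allI ballI) blast+
qed

text \<open>
  At the power map the sum is a nonzero multiple of \<open>\<chi>(- 1)\<close>, and \<open>1\<close> is not a multiplier there.
\<close>

lemma slice_coeff_alternating_sum:
  "(\<Sum>j\<le>Suc (d ^ n). (- 1) ^ j * (slice_coeff d n r j :: 'k mpol)) \<noteq> 0"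
proof
  assume z: "(\<Sum>j\<le>Suc (d ^ n). (- 1) ^ j * (slice_coeff d n r j :: 'k mpol)) = 0"
  interpret ac: inj_comm_ring_hom "to_ac :: 'k \<Rightarrow> 'k alg_closure" by (rule inj_comm_ring_hom_to_ac)
  interpret kk: comm_ring_hom "\<lambda>a. fps_const (to_ac a :: 'k alg_closure)"
    by unfold_locales simp_all
  define x where "x = (\<lambda>i :: nat. fps_X * fps_const (0 :: 'k alg_closure))"
  interpret e: comm_ring_hom "mpol_eval (\<lambda>a. fps_const (to_ac a :: 'k alg_closure)) x" by (rule kk.mpol_eval_hom)
  obtain \<chi> where nz: "fps_nth (mpol_eval (\<lambda>a. fps_const (to_ac a)) x (slice_coeff d n r (Suc (d ^ n)))) 0 \<noteq> (0 :: 'k alg_closure)"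
    and rel: "\<And>j. mpol_eval (\<lambda>a. fps_const (to_ac a :: 'k alg_closure)) x (slice_coeff d n r j) =
      mpol_eval (\<lambda>a. fps_const (to_ac a)) x (slice_coeff d n r (Suc (d ^ n))) * coeff \<chi> j"
    and \<chi>: "degree \<chi> \<le> Suc (d ^ n)" "poly \<chi> (- 1) \<noteq> 0"
    unfolding x_def using slice_coeff_expansion[of "\<lambda>_. 0"] by blast
  have "0 = mpol_eval (\<lambda>a. fps_const (to_ac a)) x (\<Sum>j\<le>Suc (d ^ n). (- 1) ^ j * slice_coeff d n r j)"
    unfolding z by (simp add: e.hom_zero)
  also have "\<dots> = (\<Sum>j\<le>Suc (d ^ n). (- 1) ^ j * (mpol_eval (\<lambda>a. fps_const (to_ac a)) x (slice_coeff d n r (Suc (d ^ n))) * coeff \<chi> j))"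
    unfolding e.hom_sum e.hom_mult e.hom_power e.hom_uminus e.hom_one by (intro sum.cong refl arg_cong2[where f = "(*)"] rel)
  also have "\<dots> = mpol_eval (\<lambda>a. fps_const (to_ac a)) x (slice_coeff d n r (Suc (d ^ n))) * poly \<chi> (- 1)"
    unfolding poly_eq_sum_of_degree_le[OF \<chi>(1)] by (simp only: sum_distrib_left mult_ac)
  finally show False using nz \<chi>(2) by auto
qed

lemma slice_coeff_growth:
  "(N + 1) ^ card (slice_vars d) \<le>
    Suc (d ^ n) ^ card (unity_roots (d ^ n - 1) :: 'k alg_closure set) *
    mpol.dim (form_space (Suc (d ^ n)) (slice_coeff d n r :: nat \<Rightarrow> 'k mpol) (card (slice_vars d) * N))"
proof -
  let ?M = "Suc (d ^ n)" and ?Z = "unity_roots (d ^ n - 1) :: 'k alg_closure set"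
  interpret ac: inj_comm_ring_hom "to_ac :: 'k \<Rightarrow> 'k alg_closure" by (rule inj_comm_ring_hom_to_ac)
  define ev where "ev h j = mpol_eval (\<lambda>a. fps_const (to_ac a)) (\<lambda>i. fps_X * fps_const (h i)) (slice_coeff d n r j)"
    for h :: "nat \<Rightarrow> 'k alg_closure" and j
  have D2: "d ^ n \<ge> 2" using power_ge_2[OF d n_ge_1] .
  define good where "good h \<chi> lam \<longleftrightarrow> fps_nth (ev h ?M) 0 \<noteq> 0 \<and> (\<forall>j. ev h j = ev h ?M * coeff \<chi> j) \<and>
    degree \<chi> \<le> ?M \<and> poly \<chi> (- 1) \<noteq> 0 \<and>
    (\<forall>z\<in>?Z. poly \<chi> (- lam z) = 0 \<and> fps_nth (lam z) 0 = of_nat (d ^ n) \<and>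
       fps_nth (lam z) 1 = - of_nat (d ^ (n - 1)) *
         (\<Sum>l<n. \<Sum>i\<in>slice_vars d. of_nat (slice_weight d i) * h i * z ^ slice_exp d n i l))" for h \<chi> lam
  have "\<exists>\<chi> lam. good h \<chi> lam" for h
    unfolding good_def ev_def by (rule slice_coeff_expansion)
  then obtain \<chi> lam where good: "\<And>h. good h (\<chi> h) (lam h)" by metis
  have sm: "fps_nth (ev h ?M) 0 \<noteq> 0" "ev h j = ev h ?M * coeff (\<chi> h) j" "degree (\<chi> h) \<le> ?M"
    "z \<in> ?Z \<Longrightarrow> poly (\<chi> h) (- lam h z) = 0"
    "z \<in> ?Z \<Longrightarrow> fps_nth (lam h z) 0 = of_nat (d ^ n) \<and> fps_nth (lam h z) 1 = - of_nat (d ^ (n - 1)) *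
         (\<Sum>l<n. \<Sum>i\<in>slice_vars d. of_nat (slice_weight d i) * h i * z ^ slice_exp d n i l)" for h j z
    using good[of h] unfolding good_def by blast+
  define e where "e i z = z ^ (d ^ n - 1 - slice_exp d n i 0) / (- of_nat (d ^ (n - 1)) * of_nat (slice_weight d i) * of_nat (d ^ n - 1))"
    for i and z :: "'k alg_closure"
  show ?thesis
  proof (rule growth_bound[where k = "to_ac :: 'k \<Rightarrow> 'k alg_closure" and c = "\<lambda>j h. coeff (\<chi> h) j" and lam = "\<lambda>z h. lam h z"
        and e = e and \<nu> = "\<lambda>i h. \<Sum>z\<in>?Z. fps_const (e i z) * lam h z"])
    show "comm_ring_hom (to_ac :: 'k \<Rightarrow> 'k alg_closure)" by (rule ac.comm_ring_hom_axioms)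
    show "infinite (UNIV :: 'k alg_closure set)" by (rule infinite_UNIV_alg_closed)
    show "finite ?Z" using D2 by (intro unity_roots char) simp
    show "fps_nth (mpol_eval (\<lambda>a. fps_const (to_ac a)) (\<lambda>i. fps_X * fps_const (h i)) (slice_coeff d n r ?M)) 0 \<noteq> 0" for h :: "nat \<Rightarrow> 'k alg_closure"
      using sm(1)[of h] unfolding ev_def .
    show "mpol_eval (\<lambda>a. fps_const (to_ac a)) (\<lambda>i. fps_X * fps_const (h i)) (slice_coeff d n r j) =
        mpol_eval (\<lambda>a. fps_const (to_ac a)) (\<lambda>i. fps_X * fps_const (h i)) (slice_coeff d n r ?M) * coeff (\<chi> h) j" for h :: "nat \<Rightarrow> 'k alg_closure" and j
      using sm(2)[of h j] unfolding ev_def .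
    show "(\<Sum>j\<le>?M. coeff (\<chi> h) j * (- lam h z) ^ j) = 0" if "z \<in> ?Z" for z h
      using sm(4)[OF that, of h] by (simp only: poly_eq_sum_of_degree_le[OF sm(3)])
    show "fps_nth (\<Sum>z\<in>?Z. fps_const (e i z) * lam h z) 0 = 0 \<and> fps_nth (\<Sum>z\<in>?Z. fps_const (e i z) * lam h z) 1 = h i"
      if "i \<in> slice_vars d" for i h
      using slice_dual_basis[OF d n char small sm(5)[of _ h] that] unfolding e_def by blast
  qed simp_all
qed

text \<open>
  The number \<open>M\<^bsup>card Z\<^esup>\<close> in the growth estimate is independent of \<open>N\<close>, so it can play the part of the
  constant \<open>C\<close>.
\<close>

lemma slice_coordinate_relation:
  assumes i: "i \<in> slice_vars d"
  obtains w S and W :: "nat \<Rightarrow> 'k mpol" where "\<And>s. s \<le> S \<Longrightarrow> mpoly_homogeneous w (W s)" "\<And>s. s \<le> S \<Longrightarrow> mpoly_vars (W s) \<subseteq> {..Suc (d ^ n)}"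
    "(\<Sum>s\<le>S. mpol_var i ^ s * mpol_eval mpol_const (slice_coeff d n r) (W s)) = 0"
    "\<exists>s\<le>S. mpol_eval mpol_const (slice_coeff d n r) (W s) \<noteq> 0"
proof -
  let ?M = "Suc (d ^ n)"
  have bx: "boxed (slice_vars d) 1 (slice d mpol_var i :: 'k mpol)" for i
  proof -
    have "boxed (slice_vars d) 1 (mpol_var i :: 'k mpol)" if "i \<in> slice_vars d" for i
      using that by (rule boxed_var)
    moreover have "boxed (slice_vars d) 1 (1 :: 'k mpol)" by (rule boxed_mono[OF boxed_one]) simp
    ultimately show ?thesis unfolding slice_def by (auto simp del: One_nat_def simp: boxed_zero)
  qed
  have "\<exists>E. boxed (slice_vars d) E (slice_coeff d n r j :: 'k mpol)" for j
  proof -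
    interpret mc: comm_ring_hom "mpol_const :: 'k \<Rightarrow> 'k mpol" by (rule comm_ring_hom_mpol_const)
    have "(slice_coeff d n r j :: 'k mpol) = mpol_eval mpol_const (slice d mpol_var) (mult_coeff d n mpol_var j r)"
      unfolding slice_coeff_def mpol_eval_mult_coeff[OF mc.comm_ring_hom_axioms] mc.mpol_eval_var ..
    then show ?thesis using ex_boxed_mpol_eval[of "slice_vars d" 1 "slice d mpol_var" "mult_coeff d n mpol_var j r", OF bx] by simp
  qed
  then obtain E where E: "\<And>j. boxed (slice_vars d) (E j) (slice_coeff d n r j :: 'k mpol)" by metis
  have "boxed (slice_vars d) (Max (E ` {..?M})) (slice_coeff d n r j :: 'k mpol)" if "j \<le> ?M" for j
    using that by (intro boxed_mono[OF E]) auto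
  note bG = this
  show ?thesis
  proof (rule algebraic_relation_from_growth[OF finite_slice_vars bG slice_coeff_growth i])
    fix w S and W :: "nat \<Rightarrow> 'k mpol"
    assume a: "\<And>s. s \<le> S \<Longrightarrow> mpoly_homogeneous w (W s)" "\<And>s. s \<le> S \<Longrightarrow> mpoly_vars (W s) \<subseteq> {..?M}"
      "(\<Sum>s\<le>S. mpol_var i ^ s * mpol_eval mpol_const (slice_coeff d n r) (W s)) = 0"
      "\<exists>s\<le>S. mpol_eval mpol_const (slice_coeff d n r) (W s) \<noteq> 0"
    show thesis by (rule that[OF a])
  qed
qed

end


section \<open>Conjugating a map into the slice\<close>

text \<open>
  Modulo \<open>p - X q\<close>, each iterate satisfies \<open>P \<equiv> X Q\<close>, and then
  \<open>p(P, Q) \<equiv> p(X Q, Q) = Q\<^sup>d p\<close>, likewise for \<open>q\<close>.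
\<close>

lemma fix_poly_dvd_iter:
  fixes p q :: "'a::idom poly"
  assumes deg: "degree p \<le> d" "degree q \<le> d" and n: "n \<ge> 1"
  shows "fix_poly p q dvd fix_poly (iter_num d p q n) (iter_den d p q n)"
  using n
proof (induction n rule: dec_induct)
  case base
  then show ?case using deg by (simp add: hom_subst_X_one)
next
  case (step n)
  define P where "P = iter_num d p q n"
  define Q where "Q = iter_den d p q n"
  have IH: "fix_poly p q dvd P - [:0, 1:] * Q" using step by (simp add: P_def Q_def fix_poly_def)
  \<comment> \<open>Differences of powers are divisible by the difference of the bases.\<close>
  have cong: "fix_poly p q dvd hom_subst d f P Q - hom_subst d f ([:0, 1:] * Q) Q" for f
  proof -
    have "hom_subst d f P Q - hom_subst d f ([:0, 1:] * Q) Q =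
      (\<Sum>i\<le>d. smult (coeff f i) ((P ^ i - ([:0, 1:] * Q) ^ i) * Q ^ (d - i)))"
      unfolding hom_subst_def sum_subtractf[symmetric] left_diff_distrib smult_diff_right ..
    moreover have "fix_poly p q dvd P ^ i - ([:0, 1:] * Q) ^ i" for i
      unfolding power_diff_sumr2[of P i "[:0, 1:] * Q"] by (rule dvd_mult2[OF IH])
    ultimately show ?thesis by (simp only:) (intro dvd_sum dvd_smult dvd_mult2)
  qed
  have hom: "hom_subst d f ([:0, 1:] * Q) Q = Q ^ d * f" if "degree f \<le> d" for f
  proof -
    have "hom_subst d f ([:0, 1:] * Q) Q = (\<Sum>i\<le>d. Q ^ d * monom (coeff f i) i)"
      unfolding hom_subst_def
    proof (intro sum.cong refl)
      fix i assume "i \<in> {..d}"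
      hence "Q ^ d = Q ^ i * Q ^ (d - i)" by (simp flip: power_add)
      then show "smult (coeff f i) (([:0, 1:] * Q) ^ i * Q ^ (d - i)) = Q ^ d * monom (coeff f i) i"
        by (simp add: power_mult_distrib monom_altdef mult_ac del: mult_pCons_left mult_pCons_right)
    qed
    also have "\<dots> = Q ^ d * f" using that by (simp only: sum_distrib_left[symmetric] poly_as_sum_of_monoms')
    finally show ?thesis .
  qed
  have "fix_poly (iter_num d p q (Suc n)) (iter_den d p q (Suc n)) = hom_subst d p P Q - [:0, 1:] * hom_subst d q P Q"
    by (simp add: fix_poly_def P_def Q_def)
  also have "\<dots> = (hom_subst d p P Q - hom_subst d p ([:0, 1:] * Q) Q) -
      [:0, 1:] * (hom_subst d q P Q - hom_subst d q ([:0, 1:] * Q) Q) + Q ^ d * fix_poly p q"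
    unfolding hom[OF deg(1)] hom[OF deg(2)] by (simp add: fix_poly_def algebra_simps)
  finally show ?case by (simp only:) (rule dvd_add[OF dvd_diff[OF cong dvd_mult[OF cong]] dvd_mult[OF dvd_refl]])
qed

lemma mult_poly_root:
  assumes "1 \<in># (A :: 'a::comm_ring_1 multiset)"
  shows "poly (mult_poly A) (- 1) = 0"
proof -
  obtain B where "A = add_mset 1 B" using assms by (metis insert_DiffM)
  then show ?thesis by (simp add: mult_poly_def)
qed

lemma conj_rel_Fract:
  fixes p q :: "'a::{alg_closed_field, field_gcd} poly"
  assumes "is_map d p q" "d \<ge> 1" "a * e - b * c \<noteq> 0"
  shows "(Fract p q, Fract (conj_num a b c e d p q) (conj_den a b c e d p q)) \<in> conj_rel d"
  unfolding conj_rel_def mem_Collect_eq prod.case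
  using assms(3) Fract_in_Rat[OF assms(1,2)] Fract_in_Rat[OF is_map_conj[OF assms(1,3)] assms(2)]
    rf_conj_Fract[OF assms, symmetric] by blast

text \<open>
  A double fixed point would be a double root of the fixed point polynomial of the iterate, hence a
  period-\<open>n\<close> point with multiplier \<open>1\<close>. So there are two distinct fixed points \<open>u\<close> and \<open>v\<close>. First a point
  \<open>t\<close> that is not periodic is moved to \<open>\<infinity>\<close>, which makes all fixed points finite; then
  \<open>(X - u) / (X - v)\<close> moves \<open>u\<close> to \<open>0\<close> and \<open>v\<close> to \<open>\<infinity>\<close>; finally the scaling by \<open>s\<close> equates the coefficients
  \<open>p\<^sub>d\<close> and \<open>q\<^sub>0\<close>.
\<close>

theorem slice_normal_form:
  fixes \<phi> :: "'a::{alg_closed_field, field_gcd} poly fract"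
  assumes \<phi>: "\<phi> \<in> Rat d" and d: "d \<ge> 2" and n: "n \<ge> 1"
    and nr: "poly (mult_poly (period_multipliers n \<phi>)) (- 1) \<noteq> 0"
  obtains h where "\<And>i. i \<notin> slice_vars d \<Longrightarrow> h i = 0"
    "is_map d (coord_num d (slice d h)) (coord_den d (slice d h))"
    "(\<phi>, Fract (coord_num d (slice d h)) (coord_den d (slice d h))) \<in> conj_rel d"
proof -
  have d1: "d \<ge> 1" using d by simp
  let ?D = "d ^ n"
  define p where "p = rf_num \<phi>"
  define q where "q = rf_den \<phi>"
  have pq: "is_map d p q" "\<phi> = Fract p q" unfolding p_def q_def by (rule is_map_rf[OF \<phi> d1])+
  have degpq: "degree p \<le> d" "degree q \<le> d" using pq(1) by (auto simp: is_map_def)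
  define P where "P = iter_num d p q n"
  define Q where "Q = iter_den d p q n"
  have PQ: "is_map ?D P Q" unfolding P_def Q_def by (rule is_map_iter[OF pq(1)])
  have degPQ: "degree P \<le> ?D" "degree Q \<le> ?D" using PQ by (auto simp: is_map_def)
  obtain t where t: "poly (fix_poly P Q) t \<noteq> 0" by (rule ex_not_fixed[OF PQ power_ge_2[OF d n]])
  have det1: "0 * t - 1 * (- 1) = (1::'a)" by simp
  have det1': "0 * t - 1 * (- 1) \<noteq> (0::'a)" by simp
  define p1 where "p1 = conj_num 0 1 (- 1) t d p q"
  define q1 where "q1 = conj_den 0 1 (- 1) t d p q"
  have map1: "is_map d p1 q1" unfolding p1_def q1_def by (rule is_map_conj[OF pq(1) det1'])
  have deg1: "degree p1 \<le> d" "degree q1 \<le> d" using map1 by (auto simp: is_map_def)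
  define f where "f = fix_poly p1 q1"
  define F where "F = fix_poly (iter_num d p1 q1 n) (iter_den d p1 q1 n)"
  have it1: "iter_pair d p1 q1 n = (conj_num 0 1 (- 1) t ?D P Q, conj_den 0 1 (- 1) t ?D P Q)"
    unfolding p1_def q1_def P_def Q_def by (rule iter_pair_conj[OF det1])
  have fF: "f dvd F" unfolding f_def F_def by (rule fix_poly_dvd_iter[OF deg1 n])
  have topF: "coeff F (Suc ?D) \<noteq> 0"
    unfolding F_def it1 fst_conv snd_conv coeff_moved_fix_poly[OF degPQ] by (rule t)
  have "fix_poly p q dvd fix_poly P Q" unfolding P_def Q_def by (rule fix_poly_dvd_iter[OF degpq n])
  hence "poly (fix_poly p q) t \<noteq> 0" using t by (auto elim!: dvdE)
  hence topf: "coeff f (Suc d) \<noteq> 0" unfolding f_def p1_def q1_def coeff_moved_fix_poly[OF degpq] .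
  have "degree f \<le> Suc d" unfolding f_def by (rule degree_fix_poly[OF deg1])
  from alg_closed_split_fun[OF this topf] obtain w where w: "f = smult (coeff f (Suc d)) (\<Prod>i<Suc d. [:- w i, 1:])" by metis
  have fw: "poly f (w i) = 0" if "i < Suc d" for i
  proof -
    have "poly f x = coeff f (Suc d) * (\<Prod>i<Suc d. x - w i)" for x
      by (subst w) (simp add: poly_prod del: prod.lessThan_Suc)
    moreover have "(\<Prod>j<Suc d. w i - w j) = 0" using that by (intro prod_zero bexI[of _ i]) auto
    ultimately show ?thesis by simp
  qed
  \<comment> \<open>A double root would produce the multiplier \<open>1\<close>.\<close>
  have "w 0 \<noteq> w 1"
  proof
    assume eq: "w 0 = w 1"
    have "(\<Prod>i<Suc d. [:- w i, 1:]) = [:- w 0, 1:] * ([:- w 1, 1:] * (\<Prod>i\<in>{..<Suc d} - {0} - {1}. [:- w i, 1:]))"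
      using d by (subst prod.remove[of _ 0], simp, simp, subst prod.remove[of _ 1]) auto
    hence "[:- w 0, 1:] * [:- w 0, 1:] dvd f"
      by (subst w) (simp only: eq[symmetric] mult.assoc[symmetric] dvd_smult dvd_triv_left)
    then obtain k where "F = [:- w 0, 1:] * [:- w 0, 1:] * k" using fF by (metis dvdE dvd_trans)
    hence F2: "F = [:- w 0, 1:] * ([:- w 0, 1:] * k)" by (simp only: mult.assoc)
    hence F'0: "poly (pderiv F) (w 0) = 0" by (simp only: F2 pderiv_mult poly_add poly_mult) simp
    have F0: "F \<noteq> 0" using topF by auto
    have "w 0 \<in># proots F" using F0 by (simp add: F2 del: mult_pCons_left)
    hence "1 + poly (pderiv F) (w 0) / poly (conj_den 0 1 (- 1) t ?D P Q) (w 0) \<in># spectrum (Fract P Q)"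
      using spectrum_conj[OF PQ _ det1] topF d unfolding F_def it1 fst_conv snd_conv by simp
    hence "1 \<in># period_multipliers n \<phi>"
      unfolding F'0 period_multipliers_eq_spectrum pq(2) rf_iter_Fract[OF pq(1) d1] P_def Q_def by simp
    with mult_poly_root nr show False by blast
  qed
  moreover define u where "u = w 0"
  moreover define v where "v = w 1"
  ultimately have uv: "u \<noteq> v" by simp
  have fu: "poly p1 u = u * poly q1 u" and fv: "poly p1 v = v * poly q1 v"
    using fw[of 0] fw[of 1] d unfolding u_def v_def f_def by (simp_all add: fix_poly_def)
  have qu: "poly q1 u \<noteq> 0" and qv: "poly q1 v \<noteq> 0"
    using map1 fu fv unfolding is_map_def by (metis mult_zero_right)+
  have det2: "1 * (- v) - (- u) * 1 \<noteq> 0" using uv by simp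
  define p2 where "p2 = conj_num 1 (- u) 1 (- v) d p1 q1"
  define q2 where "q2 = conj_den 1 (- u) 1 (- v) d p1 q1"
  have map2: "is_map d p2 q2" unfolding p2_def q2_def by (rule is_map_conj[OF map1 det2])
  have ev1: "hom_eval d g u 1 = poly g u" "hom_eval d g (- v) (- 1) = (- 1) ^ d * poly g v" if "degree g \<le> d" for g
    using hom_eval_unit[OF that, of u 1] hom_eval_unit[OF that, of v "- 1"] by simp_all
  have p20: "coeff p2 0 = 0" and q20: "coeff q2 0 = (u - v) * poly q1 u"
    unfolding p2_def q2_def conj_num_def conj_den_def poly_0_coeff_0[symmetric] poly_add poly_smult poly_hom_subst
    using ev1(1)[OF deg1(1)] ev1(1)[OF deg1(2)] by (simp_all add: fu algebra_simps)
  have top2: "coeff (hom_subst d g [:- (- u), - v:] [:1, - 1:]) d = hom_eval d g (- v) (- 1)" for g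
    using coeff_hom_subst_top[of "[:- (- u), - v:]" 1 "[:1, - 1:]" d g] by simp
  have p2d: "coeff p2 d = (- 1) ^ d * ((v - u) * poly q1 v)" and q2d: "coeff q2 d = 0"
    unfolding p2_def q2_def conj_num_def conj_den_def coeff_add coeff_smult top2 ev1(2)[OF deg1(1)] ev1(2)[OF deg1(2)]
    by (simp_all add: fv algebra_simps)
  have nz: "coeff q2 0 \<noteq> 0" "coeff p2 d \<noteq> 0" using uv qu qv by (simp_all add: q20 p2d)
  \<comment> \<open>Scaling by \<open>s\<close> multiplies \<open>q\<^sub>0 / p\<^sub>d\<close> by \<open>s\<^bsup>d-1\<^esup>\<close>.\<close>
  have "d - 1 > 0" using d by simp
  then obtain s where s: "s ^ (d - 1) = coeff p2 d / coeff q2 0" using nth_root_exists by blast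
  have s0: "s \<noteq> 0" using s nz \<open>d - 1 > 0\<close> by (auto simp: zero_power)
  have det3: "s * 1 - 0 * 0 \<noteq> 0" using s0 by simp
  define p3 where "p3 = conj_num s 0 0 1 d p2 q2"
  define q3 where "q3 = conj_den s 0 0 1 d p2 q2"
  have map3: "is_map d p3 q3" unfolding p3_def q3_def by (rule is_map_conj[OF map2 det3])
  have diag: "coeff (hom_subst d g [:- 0, 1:] [:s, - 0:]) i = coeff g i * s ^ (d - i)" if "i \<le> d" for g i
  proof -
    have "hom_subst d g [:- 0, 1:] [:s, - 0:] = (\<Sum>j\<le>d. monom (coeff g j * s ^ (d - j)) j)"
      unfolding hom_subst_def
      by (intro sum.cong refl) (simp add: monom_altdef mult_ac poly_const_pow)
    then show ?thesis using that by (simp add: coeff_sum)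
  qed
  have c3: "coeff p3 i = s * (coeff p2 i * s ^ (d - i))" "coeff q3 i = coeff q2 i * s ^ (d - i)" if "i \<le> d" for i
    using diag[OF that] unfolding p3_def q3_def conj_num_def conj_den_def by simp_all
  define \<kappa> where "\<kappa> = coeff q3 0"
  have \<kappa>: "\<kappa> \<noteq> 0" using nz s0 by (simp add: \<kappa>_def c3)
  have p30: "coeff p3 0 = 0" and q3d: "coeff q3 d = 0" using p20 q2d by (simp_all add: c3)
  have p3d: "coeff p3 d = \<kappa>"
  proof -
    have "\<kappa> = coeff q2 0 * (s * s ^ (d - 1))" using d by (simp add: \<kappa>_def c3 power_eq_if)
    also have "\<dots> = s * coeff p2 d" unfolding s using nz by simp
    finally show ?thesis by (simp add: c3)
  qed
  define h where "h i = (if i \<in> slice_vars d then (if i \<le> d then coeff p3 i else coeff q3 (i - Suc d)) / \<kappa> else 0)" for i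
  have deg3: "degree p3 \<le> d" "degree q3 \<le> d" using map3 by (auto simp: is_map_def)
  have num: "coord_num d (slice d h) = smult (1 / \<kappa>) p3"
  proof (rule poly_eqI)
    fix i
    show "coeff (coord_num d (slice d h)) i = coeff (smult (1 / \<kappa>) p3) i"
    proof (cases "i \<le> d")
      case True
      then consider "i = 0" | "i = d" | "i \<in> {1..<d}" by fastforce
      then show ?thesis
      proof cases
        case 3
        then show ?thesis by (simp add: coeff_coord slice_def h_def slice_vars_def)
      qed (use d p30 p3d \<kappa> in \<open>simp_all add: coeff_coord slice_def slice_vars_def\<close>)
    next
      case False
      then show ?thesis using degree_coord(1)[of d "slice d h"] deg3 by (simp add: coeff_eq_0)
    qed
  qed
  have den: "coord_den d (slice d h) = smult (1 / \<kappa>) q3"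
  proof (rule poly_eqI)
    fix i
    show "coeff (coord_den d (slice d h)) i = coeff (smult (1 / \<kappa>) q3) i"
    proof (cases "i \<le> d")
      case True
      then consider "i = 0" | "i = d" | "i \<in> {1..<d}" by fastforce
      then show ?thesis
      proof cases
        case 3
        then show ?thesis by (simp add: coeff_coord slice_def h_def slice_vars_def)
      qed (use d q3d \<kappa> in \<open>simp_all add: coeff_coord slice_def slice_vars_def \<kappa>_def\<close>)
    next
      case False
      then show ?thesis using degree_coord(2)[of d "slice d h"] deg3 by (simp add: coeff_eq_0)
    qed
  qed
  have map4: "is_map d (coord_num d (slice d h)) (coord_den d (slice d h))"
    unfolding num den using map3 \<kappa> by (intro is_map_smult) auto
  have "Fract (coord_num d (slice d h)) (coord_den d (slice d h)) = Fract p3 q3"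
    unfolding num den using is_map_den_nonzero[OF map3 d1] \<kappa> by (simp add: eq_fract)
  moreover have "(\<phi>, Fract p1 q1) \<in> conj_rel d"
    unfolding pq(2) p1_def q1_def by (rule conj_rel_Fract[OF pq(1) d1 det1'])
  moreover have "(Fract p1 q1, Fract p2 q2) \<in> conj_rel d"
    unfolding p2_def q2_def by (rule conj_rel_Fract[OF map1 d1 det2])
  moreover have "(Fract p2 q2, Fract p3 q3) \<in> conj_rel d"
    unfolding p3_def q3_def by (rule conj_rel_Fract[OF map2 d1 det3])
  ultimately have "(\<phi>, Fract (coord_num d (slice d h)) (coord_den d (slice d h))) \<in> conj_rel d"
    using equiv_conj_rel[OF d1] by (metis equiv_def transD)
  with map4 show ?thesis using that[of h] by (simp add: h_def)
qed

section \<open>The exceptional set\<close>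

abbreviation spec_coeff :: "nat \<Rightarrow> 'a::field_gcd poly fract \<Rightarrow> nat \<Rightarrow> 'a" where
  "spec_coeff n \<phi> \<equiv> coeff (mult_poly (period_multipliers n \<phi>))"

definition slice_map :: "nat \<Rightarrow> (nat \<Rightarrow> 'a::field_gcd) \<Rightarrow> 'a poly fract" where
  "slice_map d h = Fract (coord_num d (slice d h)) (coord_den d (slice d h))"

definition is_slice_map :: "nat \<Rightarrow> (nat \<Rightarrow> 'a::field_gcd) \<Rightarrow> bool" where
  "is_slice_map d h \<longleftrightarrow> is_map d (coord_num d (slice d h)) (coord_den d (slice d h))"

lemma mpol_eval_mult_coeff_regular:
  fixes f :: "'k::field mpol"
  assumes map: "is_map d (coord_num d x) (coord_den d x)" and d: "d \<ge> 2" and n: "n \<ge> 1"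
    and scale: "\<And>s x. mpol_eval to_ac (\<lambda>i. s * x i) f = s ^ w * mpol_eval to_ac x f"
  shows "mpol_eval to_ac (\<lambda>j. mult_coeff d n x j r) f =
    mult_coeff d n x (Suc (d ^ n)) r ^ w * mpol_eval to_ac (spec_coeff n (Fract (coord_num d x) (coord_den d x))) f"
proof -
  have eq: "(\<lambda>j. mult_coeff d n x j r) =
      (\<lambda>j. mult_coeff d n x (Suc (d ^ n)) r * spec_coeff n (Fract (coord_num d x) (coord_den d x)) j)"
    by (rule ext, rule trans[OF mult_coeff_regular(1)[OF d n map] mult.commute])
  show ?thesis by (subst eq) (rule scale)
qed

lemma mult_coeff_slice_zero:
  assumes d: "d \<ge> 2" and n: "n \<ge> 1"
  obtains r where "mult_coeff d n (slice d (\<lambda>_. 0 :: 'a::{alg_closed_field, field_gcd})) (Suc (d ^ n)) r \<noteq> 0"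
proof -
  have num: "coord_num d (slice d (\<lambda>_. 0 :: 'a)) = monom 1 d"
    by (rule poly_eqI, case_tac "n \<le> d")
      (use d degree_coord(1)[of d "slice d (\<lambda>_. 0 :: 'a)"] in \<open>auto simp: coeff_coord slice_def slice_vars_def coeff_eq_0\<close>)
  have den: "coord_den d (slice d (\<lambda>_. 0 :: 'a)) = 1"
    by (rule poly_eqI, case_tac "n \<le> d")
      (use d degree_coord(2)[of d "slice d (\<lambda>_. 0 :: 'a)"] in \<open>auto simp: coeff_coord slice_def slice_vars_def coeff_eq_0\<close>)
  have "is_map d (coord_num d (slice d (\<lambda>_. 0 :: 'a))) (coord_den d (slice d (\<lambda>_. 0)))"
    unfolding num den is_map_def by (auto simp: degree_monom_eq)
  from mult_coeff_regular(2)[OF d n this] show ?thesis using that by blast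
qed

text \<open>
  A relation for one power of \<open>t\<close> carries over to all others by the cross identity, since the
  coefficients \<open>W s\<close> are homogeneous of the same degree. At a given point of the slice one can thus use
  a power of \<open>t\<close> whose forms do not all vanish there.
\<close>

lemma slice_coeff_relation_any:
  fixes W :: "nat \<Rightarrow> 'k::field mpol"
  assumes d: "d \<ge> 2" and n: "n \<ge> 1"
    and r: "mult_coeff d n (slice d (\<lambda>_. 0 :: 'k alg_closure)) (Suc (d ^ n)) r \<noteq> 0"
    and hom: "\<And>s. s \<le> S \<Longrightarrow> mpoly_homogeneous w (W s)"
    and rel: "(\<Sum>s\<le>S. mpol_var i ^ s * mpol_eval mpol_const (slice_coeff d n r) (W s)) = 0"
  shows "(\<Sum>s\<le>S. mpol_var i ^ s * mpol_eval mpol_const (slice_coeff d n r') (W s)) = 0"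
proof -
  interpret mc: comm_ring_hom "mpol_const :: 'k \<Rightarrow> 'k mpol" by (rule comm_ring_hom_mpol_const)
  let ?M = "Suc (d ^ n)"
  define G where "G s j = (slice_coeff d n s j :: 'k mpol)" for s j
  have G0: "G r ?M \<noteq> 0"
  proof
    interpret ac: inj_comm_ring_hom "to_ac :: 'k \<Rightarrow> 'k alg_closure" by (rule inj_comm_ring_hom_to_ac)
    assume "G r ?M = 0"
    hence "mpol_eval to_ac (\<lambda>_. 0 :: 'k alg_closure) (G r ?M) = 0" by (simp add: ac.mpol_eval_0)
    then show False
      using r unfolding G_def slice_coeff_def mpol_eval_slice_coeff[OF ac.comm_ring_hom_axioms] by simp
  qed
  have cross: "G r ?M * G r' j = G r' ?M * G r j" for j
    using mult_coeff_cross_general[OF mc.comm_ring_hom_axioms d n, of "slice d mpol_var" j r' r]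
    unfolding G_def slice_coeff_def by (simp add: mult.commute)
  have W: "G r ?M ^ w * mpol_eval mpol_const (G r') (W s) = G r' ?M ^ w * mpol_eval mpol_const (G r) (W s)" if "s \<le> S" for s
    unfolding mc.mpol_eval_homogeneous[OF hom[OF that], symmetric] cross ..
  have "G r ?M ^ w * (\<Sum>s\<le>S. mpol_var i ^ s * mpol_eval mpol_const (G r') (W s)) =
      (\<Sum>s\<le>S. mpol_var i ^ s * (G r ?M ^ w * mpol_eval mpol_const (G r') (W s)))"
    by (simp only: sum_distrib_left mult_ac)
  also have "\<dots> = (\<Sum>s\<le>S. mpol_var i ^ s * (G r' ?M ^ w * mpol_eval mpol_const (G r) (W s)))"
    using W by (intro sum.cong refl) simp
  also have "\<dots> = G r' ?M ^ w * (\<Sum>s\<le>S. mpol_var i ^ s * mpol_eval mpol_const (G r) (W s))"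
    by (simp only: sum_distrib_left mult_ac)
  also have "\<dots> = 0" using rel unfolding G_def by simp
  finally show ?thesis using G0 unfolding G_def by simp
qed

lemma slice_coordinate_is_root:
  fixes W :: "nat \<Rightarrow> 'k::field mpol"
  assumes d: "d \<ge> 2" and n: "n \<ge> 1"
    and r: "mult_coeff d n (slice d (\<lambda>_. 0 :: 'k alg_closure)) (Suc (d ^ n)) r \<noteq> 0"
    and hom: "\<And>s. s \<le> S \<Longrightarrow> mpoly_homogeneous w (W s)"
    and rel: "(\<Sum>s\<le>S. mpol_var i ^ s * mpol_eval mpol_const (slice_coeff d n r) (W s)) = 0"
    and map: "is_slice_map d h"
  shows "(\<Sum>s\<le>S. h i ^ s * mpol_eval to_ac (spec_coeff n (slice_map d h)) (W s)) = 0"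
proof -
  interpret ac: inj_comm_ring_hom "to_ac :: 'k \<Rightarrow> 'k alg_closure" by (rule inj_comm_ring_hom_to_ac)
  interpret e: comm_ring_hom "mpol_eval to_ac h" by (rule ac.mpol_eval_hom)
  note map' = map[unfolded is_slice_map_def]
  obtain r' where r': "mult_coeff d n (slice d h) (Suc (d ^ n)) r' \<noteq> 0"
    using mult_coeff_regular(2)[OF d n map'] by blast
  let ?y = "mult_coeff d n (slice d h) (Suc (d ^ n)) r'"
  have W: "mpol_eval to_ac h (mpol_eval mpol_const (slice_coeff d n r') (W s)) =
      ?y ^ w * mpol_eval to_ac (spec_coeff n (slice_map d h)) (W s)" if "s \<le> S" for s
  proof -
    have "mpol_eval to_ac h (mpol_eval mpol_const (slice_coeff d n r') (W s)) =
        mpol_eval to_ac (\<lambda>j. mult_coeff d n (slice d h) j r') (W s)"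
      unfolding mpol_eval_hom_comp[OF e.comm_ring_hom_axioms] ac.mpol_eval_const slice_coeff_def
        mpol_eval_slice_coeff[OF ac.comm_ring_hom_axioms] ..
    also have "\<dots> = ?y ^ w * mpol_eval to_ac (spec_coeff n (slice_map d h)) (W s)"
      unfolding slice_map_def
      by (rule mpol_eval_mult_coeff_regular[OF map' d n]) (rule ac.mpol_eval_homogeneous[OF hom[OF that]])
    finally show ?thesis .
  qed
  have rel': "(\<Sum>s\<le>S. mpol_var i ^ s * mpol_eval mpol_const (slice_coeff d n r') (W s)) = 0"
    by (rule slice_coeff_relation_any[OF d n r _ rel]) (rule hom)
  have "0 = mpol_eval to_ac h (\<Sum>s\<le>S. mpol_var i ^ s * mpol_eval mpol_const (slice_coeff d n r') (W s))"
    unfolding rel' by (simp add: ac.mpol_eval_0)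
  also have "\<dots> = (\<Sum>s\<le>S. h i ^ s * mpol_eval to_ac h (mpol_eval mpol_const (slice_coeff d n r') (W s)))"
    unfolding e.hom_sum e.hom_mult e.hom_power ac.mpol_eval_var ..
  also have "\<dots> = (\<Sum>s\<le>S. h i ^ s * (?y ^ w * mpol_eval to_ac (spec_coeff n (slice_map d h)) (W s)))"
    using W by (intro sum.cong refl) simp
  also have "\<dots> = ?y ^ w * (\<Sum>s\<le>S. h i ^ s * mpol_eval to_ac (spec_coeff n (slice_map d h)) (W s))"
    by (simp only: sum_distrib_left mult_ac)
  finally show ?thesis using r' by simp
qed

lemma finite_functions_with_values_in:
  assumes "finite I" "\<And>i. i \<in> I \<Longrightarrow> finite (R i)"
  shows "finite {h. (\<forall>i. i \<notin> I \<longrightarrow> h i = c) \<and> (\<forall>i\<in>I. h i \<in> R i)}"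
proof (rule finite_subset)
  show "{h. (\<forall>i. i \<notin> I \<longrightarrow> h i = c) \<and> (\<forall>i\<in>I. h i \<in> R i)} \<subseteq> (\<lambda>g i. if i \<in> I then g i else c) ` PiE I R"
  proof
    fix h assume h: "h \<in> {h. (\<forall>i. i \<notin> I \<longrightarrow> h i = c) \<and> (\<forall>i\<in>I. h i \<in> R i)}"
    show "h \<in> (\<lambda>g i. if i \<in> I then g i else c) ` PiE I R"
    proof (rule image_eqI)
      show "h = (\<lambda>i. if i \<in> I then restrict h I i else c)" using h by auto
      show "restrict h I \<in> PiE I R" using h by auto
    qed
  qed
  show "finite ((\<lambda>g i. if i \<in> I then g i else c) ` PiE I R)" using assms by (intro finite_imageI finite_PiE)
qed

text \<open>
  For every slice coordinate \<open>i\<close> take a relation as in \<open>slice_coordinate_relation\<close> and a coefficient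
  \<open>W i (t i)\<close> of it that does not vanish identically on the slice. \<open>D\<close> is the product of these coefficients
  and of the value \<open>W0\<close> of the multiplier polynomial at \<open>- 1\<close>. Where \<open>D\<close> does not vanish, the relations
  are nontrivial equations for the coordinates, with coefficients determined by the symmetric functions.
  A product of nonzero polynomials does not vanish identically, which gives the existence of a point of the
  slice at which \<open>D\<close> is nonzero.
\<close>

theorem discriminant_exists:
  fixes K :: "'k::field itself"
  assumes d: "d \<ge> 2" and n: "n \<ge> 3"
    and small: "\<And>j. 1 \<le> j \<Longrightarrow> j \<le> d \<Longrightarrow> of_nat j \<noteq> (0::'k alg_closure)"
    and char: "of_nat (d ^ n - 1) \<noteq> (0::'k alg_closure)"
  obtains D :: "'k mpol" and w where
    "\<And>s x. mpol_eval to_ac (\<lambda>i. s * x i) D = s ^ w * mpol_eval to_ac x D"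
    "\<exists>h. is_slice_map d h \<and> mpol_eval to_ac (spec_coeff n (slice_map d h)) D \<noteq> 0"
    "\<And>\<phi>. \<phi> \<in> Rat d \<Longrightarrow> mpol_eval to_ac (spec_coeff n \<phi>) D \<noteq> 0 \<Longrightarrow> poly (mult_poly (period_multipliers n \<phi>)) (- 1) \<noteq> 0"
    "\<And>C. mpol_eval to_ac C D \<noteq> 0 \<Longrightarrow>
      finite {h. (\<forall>i. i \<notin> slice_vars d \<longrightarrow> h i = 0) \<and> is_slice_map d h \<and> spec_coeff n (slice_map d h) = C}"
proof -
  interpret ac: inj_comm_ring_hom "to_ac :: 'k \<Rightarrow> 'k alg_closure" by (rule inj_comm_ring_hom_to_ac)
  interpret mc: comm_ring_hom "mpol_const :: 'k \<Rightarrow> 'k mpol" by (rule comm_ring_hom_mpol_const)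
  have n1: "n \<ge> 1" using n by simp
  let ?M = "Suc (d ^ n)" and ?I = "slice_vars d"
  obtain r where r: "mult_coeff d n (slice d (\<lambda>_. 0 :: 'k alg_closure)) ?M r \<noteq> 0"
    by (rule mult_coeff_slice_zero[OF d n1])
  define G where "G j = (slice_coeff d n r j :: 'k mpol)" for j
  have Geq: "G = slice_coeff d n r" by (rule ext) (simp add: G_def)
  define good where "good i w S W \<longleftrightarrow> (\<forall>s\<le>S. mpoly_homogeneous w (W s)) \<and>
    (\<Sum>s\<le>S. mpol_var i ^ s * mpol_eval mpol_const G (W s)) = 0 \<and>
    (\<exists>s\<le>S. mpol_eval mpol_const G (W s) \<noteq> 0)" for i w S and W :: "nat \<Rightarrow> 'k mpol"
  have "\<exists>w S W. good i w S W" if i: "i \<in> ?I" for i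
  proof -
    show ?thesis
    proof (rule slice_coordinate_relation[OF d n small char r i])
      fix w S and W :: "nat \<Rightarrow> 'k mpol"
      assume "\<And>s. s \<le> S \<Longrightarrow> mpoly_homogeneous w (W s)"
        "(\<Sum>s\<le>S. mpol_var i ^ s * mpol_eval mpol_const (slice_coeff d n r) (W s)) = 0"
        "\<exists>s\<le>S. mpol_eval mpol_const (slice_coeff d n r) (W s) \<noteq> 0"
      then show ?thesis unfolding good_def G_def by blast
    qed
  qed
  then obtain w S W where good: "\<And>i. i \<in> ?I \<Longrightarrow> good i (w i) (S i) (W i)" by metis
  then have "\<exists>t. \<forall>i\<in>?I. t i \<le> S i \<and> mpol_eval mpol_const G (W i (t i)) \<noteq> 0"
    unfolding good_def by (intro bchoice) blast
  then obtain t where t: "\<And>i. i \<in> ?I \<Longrightarrow> t i \<le> S i" "\<And>i. i \<in> ?I \<Longrightarrow> mpol_eval mpol_const G (W i (t i)) \<noteq> 0" by blast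
  define W0 :: "'k mpol" where "W0 = (\<Sum>j\<le>?M. mpol_const ((- 1) ^ j) * mpol_var j)"
  define D where "D = W0 * (\<Prod>i\<in>?I. W i (t i))"
  have evD: "mpol_eval to_ac x D = (\<Sum>j\<le>?M. (- 1) ^ j * x j) * (\<Prod>i\<in>?I. mpol_eval to_ac x (W i (t i)))" for x
  proof -
    interpret e: comm_ring_hom "mpol_eval to_ac x" by (rule ac.mpol_eval_hom)
    show ?thesis
      unfolding D_def W0_def e.hom_mult e.hom_prod e.hom_sum ac.mpol_eval_var ac.mpol_eval_const
        ac.hom_power ac.hom_uminus ac.hom_one ..
  qed
  \<comment> \<open>The factors are nonzero polynomials on the slice, and polynomials over a field form a domain.\<close>
  have DG: "mpol_eval mpol_const G D \<noteq> 0"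
  proof -
    interpret e: comm_ring_hom "mpol_eval mpol_const G" by (rule mc.mpol_eval_hom)
    have "mpol_eval mpol_const G D = (\<Sum>j\<le>?M. (- 1) ^ j * G j) * (\<Prod>i\<in>?I. mpol_eval mpol_const G (W i (t i)))"
      unfolding D_def W0_def e.hom_mult e.hom_prod e.hom_sum mc.mpol_eval_var mc.mpol_eval_const
        mc.hom_power mc.hom_uminus mc.hom_one e.hom_power e.hom_uminus e.hom_one ..
    moreover have "(\<Sum>j\<le>?M. (- 1) ^ j * G j) \<noteq> 0"
      unfolding G_def by (rule slice_coeff_alternating_sum[OF d n small char r])
    ultimately show ?thesis using t(2) by (simp add: prod_zero_iff del: sum.atMost_Suc)
  qed
  show ?thesis
  proof (rule that[of D "1 + sum w ?I"])
    show scale: "mpol_eval to_ac (\<lambda>i. s * x i) D = s ^ (1 + sum w ?I) * mpol_eval to_ac x D" for s x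
    proof -
      have "mpol_eval to_ac (\<lambda>i. s * x i) (W i (t i)) = s ^ w i * mpol_eval to_ac x (W i (t i))" if "i \<in> ?I" for i
        using good[OF that] t(1)[OF that] unfolding good_def by (intro ac.mpol_eval_homogeneous) blast
      hence "(\<Prod>i\<in>?I. mpol_eval to_ac (\<lambda>i. s * x i) (W i (t i))) = s ^ sum w ?I * (\<Prod>i\<in>?I. mpol_eval to_ac x (W i (t i)))"
        by (simp add: prod.distrib power_sum)
      moreover have "(\<Sum>j\<le>?M. (- 1) ^ j * (s * x j)) = s * (\<Sum>j\<le>?M. (- 1) ^ j * x j)"
        by (simp only: sum_distrib_left mult_ac)
      ultimately show ?thesis unfolding evD by (simp only: power_add power_one_right mult_ac)
    qed
    show "\<exists>h. is_slice_map d h \<and> mpol_eval to_ac (spec_coeff n (slice_map d h)) D \<noteq> 0"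
    proof -
      \<comment> \<open>The factor \<open>G ?M\<close> ensures that the point found represents a map.\<close>
      obtain h :: "nat \<Rightarrow> 'k alg_closure" where nz: "mpol_eval to_ac h (mpol_eval mpol_const G D * G ?M) \<noteq> 0"
      proof -
        have "G ?M \<noteq> 0"
        proof
          assume "G ?M = 0"
          hence "mpol_eval to_ac (\<lambda>_. 0 :: 'k alg_closure) (G ?M) = 0" by (simp add: ac.mpol_eval_0)
          then show False
            using r unfolding G_def slice_coeff_def mpol_eval_slice_coeff[OF ac.comm_ring_hom_axioms] by simp
        qed
        with DG have "mpol_eval mpol_const G D * G ?M \<noteq> 0" by simp
        then show ?thesis using that mpol_eval_eq_0_imp[OF inj_comm_ring_hom_to_ac infinite_UNIV_alg_closed] by blast
      qed
      interpret e: comm_ring_hom "mpol_eval to_ac h" by (rule ac.mpol_eval_hom)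
      from nz have "mpol_eval to_ac h (mpol_eval mpol_const G D) \<noteq> 0" and "mpol_eval to_ac h (G ?M) \<noteq> 0"
        by (auto simp: e.hom_mult)
      then have 1: "mpol_eval to_ac (\<lambda>j. mult_coeff d n (slice d h) j r) D \<noteq> 0" and 2: "mult_coeff d n (slice d h) ?M r \<noteq> 0"
        unfolding mpol_eval_hom_comp[OF e.comm_ring_hom_axioms] ac.mpol_eval_const G_def slice_coeff_def
          mpol_eval_slice_coeff[OF ac.comm_ring_hom_axioms] by simp_all
      have map: "is_slice_map d h" using mult_coeff_degenerate[OF d n1] 2 unfolding is_slice_map_def by blast
      with 1 mpol_eval_mult_coeff_regular[OF map[unfolded is_slice_map_def] d n1 scale, of r] show ?thesis
        unfolding slice_map_def by (intro exI[of _ h]) auto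
    qed
    show "poly (mult_poly (period_multipliers n \<phi>)) (- 1) \<noteq> 0"
      if \<phi>: "\<phi> \<in> Rat d" and "mpol_eval to_ac (spec_coeff n \<phi>) D \<noteq> 0" for \<phi>
    proof -
      have "degree (mult_poly (period_multipliers n \<phi>)) \<le> ?M"
        using mult_poly_monic(2)[of "period_multipliers n \<phi>"] unfolding size_period_multipliers[OF \<phi> d n1] .
      from poly_eq_sum_of_degree_le[OF this, of "- 1"] that(2) show ?thesis
        unfolding evD by (simp add: mult.commute del: sum.atMost_Suc)
    qed
    show "finite {h. (\<forall>i. i \<notin> ?I \<longrightarrow> h i = 0) \<and> is_slice_map d h \<and> spec_coeff n (slice_map d h) = C}"
      if C: "mpol_eval to_ac C D \<noteq> 0" for C
    proof -
      \<comment> \<open>The equation for the coordinate \<open>i\<close> of the points of the slice with symmetric functions \<open>C\<close>.\<close>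
      define P where "P i = (\<Sum>s\<le>S i. monom (mpol_eval to_ac C (W i s)) s)" for i
      have P: "P i \<noteq> 0" if "i \<in> ?I" for i
      proof -
        have "coeff (P i) (t i) = mpol_eval to_ac C (W i (t i))"
          using t(1)[OF that] by (simp add: P_def coeff_sum)
        also have "\<dots> \<noteq> 0" using C that unfolding evD by auto
        finally show ?thesis by auto
      qed
      have "finite {h. (\<forall>i. i \<notin> ?I \<longrightarrow> h i = 0) \<and> (\<forall>i\<in>?I. h i \<in> {x. poly (P i) x = 0})}"
        by (rule finite_functions_with_values_in) (use P poly_roots_finite in auto)
      then show ?thesis
      proof (rule finite_subset[rotated], intro subsetI CollectI conjI ballI)
        fix h assume h: "h \<in> {h. (\<forall>i. i \<notin> ?I \<longrightarrow> h i = 0) \<and> is_slice_map d h \<and> spec_coeff n (slice_map d h) = C}"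
        then show "\<forall>i. i \<notin> ?I \<longrightarrow> h i = 0" by blast
        fix i assume i: "i \<in> ?I"
        have "(\<Sum>s\<le>S i. h i ^ s * mpol_eval to_ac (spec_coeff n (slice_map d h)) (W i s)) = 0"
          by (rule slice_coordinate_is_root[OF d n1 r, where w = "w i"])
            (use good[OF i] h in \<open>auto simp: good_def Geq\<close>)
        then show "poly (P i) (h i) = 0" using h by (simp add: P_def poly_sum poly_monom mult.commute)
      qed
    qed
  qed
qed


section \<open>Descent to the moduli space\<close>

lemma moduli_class:
  fixes c :: "'a::{alg_closed_field, field_gcd} poly fract set"
  assumes d: "d \<ge> 2" and c: "c \<in> Moduli d"
  shows "c \<noteq> {}" "c \<subseteq> Rat d" "\<And>\<phi>. \<phi> \<in> c \<Longrightarrow> c = conj_rel d `` {\<phi>}"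
    "\<And>\<phi> \<psi> m. \<phi> \<in> c \<Longrightarrow> \<psi> \<in> c \<Longrightarrow> m \<ge> 1 \<Longrightarrow> period_multipliers m \<phi> = period_multipliers m \<psi>"
proof -
  have d1: "d \<ge> 1" using d by simp
  note eq = equiv_conj_rel[OF d1]
  show "c \<noteq> {}" using in_quotient_imp_non_empty[OF eq] c unfolding Moduli_def by blast
  show sub: "c \<subseteq> Rat d" using in_quotient_imp_subset[OF eq] c unfolding Moduli_def by blast
  show cl: "c = conj_rel d `` {\<phi>}" if "\<phi> \<in> c" for \<phi>
  proof -
    obtain \<psi> where "c = conj_rel d `` {\<psi>}" using c unfolding Moduli_def by (elim quotientE)
    moreover from this that have "(\<psi>, \<phi>) \<in> conj_rel d" by simp
    ultimately show ?thesis using equiv_class_eq[OF eq] by simp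
  qed
  show "period_multipliers m \<phi> = period_multipliers m \<psi>" if "\<phi> \<in> c" "\<psi> \<in> c" "m \<ge> 1" for \<phi> \<psi> m
  proof -
    have "(\<phi>, \<psi>) \<in> conj_rel d" using cl[OF that(1)] that(2) by blast
    then obtain a b c' e where "\<phi> \<in> Rat d" "a * e - b * c' \<noteq> 0" "\<psi> = rf_conj a b c' e \<phi>"
      unfolding conj_rel_def by blast
    then show ?thesis using period_multipliers_conj[OF _ d that(3)] by metis
  qed
qed

lemma Lambda_eq:
  fixes c :: "'a::{alg_closed_field, field_gcd} poly fract set"
  assumes "d \<ge> 2" "c \<in> Moduli d" "\<phi> \<in> c" "m \<ge> 1"
  shows "Lambda d m c = Lambda_rf d m \<phi>"
proof -
  have "Lambda_rf d m \<psi> = Lambda_rf d m \<phi>" if "\<psi> \<in> c" for \<psi>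
    unfolding Lambda_rf_def moduli_class(4)[OF assms(1,2) that assms(3,4)] ..
  then have "Lambda_rf d m ` c = {Lambda_rf d m \<phi>}" using assms(3) by blast
  then show ?thesis by (simp add: Lambda_def)
qed

text \<open>
  The blocks of the concatenation have lengths that do not depend on the class.
\<close>

lemma Lambda_prod_eqD:
  fixes c c' :: "'a::{alg_closed_field, field_gcd} poly fract set"
  assumes d: "d \<ge> 2" and c: "c \<in> Moduli d" "c' \<in> Moduli d" and n: "1 \<le> n" "n \<le> N"
    and eq: "Lambda_prod d N c = Lambda_prod d N c'"
  shows "Lambda d n c = Lambda d n c'"
proof -
  have len: "length (Lambda d m b) = num_period_points d m" if b: "b \<in> Moduli d" and m: "m \<ge> 1"
    for m and b :: "'a poly fract set"
  proof -
    obtain \<phi> where "\<phi> \<in> b" using moduli_class(1)[OF d b] by blast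
    then show ?thesis using Lambda_eq[OF d b _ m] by (simp add: Lambda_rf_def)
  qed
  have "map (\<lambda>m. Lambda d m c) [1..<N + 1] = map (\<lambda>m. Lambda d m c') [1..<N + 1]"
    using eq unfolding Lambda_prod_def
  proof (subst (asm) concat_eq_concat_iff)
    show "\<forall>(x, y)\<in>set (zip (map (\<lambda>m. Lambda d m c) [1..<N + 1]) (map (\<lambda>m. Lambda d m c') [1..<N + 1])). length x = length y"
      using len c by (auto simp: set_zip simp del: upt_Suc)
  qed simp_all
  then show ?thesis using n unfolding map_eq_conv by (auto simp del: upt_Suc)
qed

lemma rf_coords_coord:
  fixes \<phi> :: "'a::field_gcd poly fract"
  assumes "\<phi> \<in> Rat d"
  shows "coord_num d (rf_coords d \<phi>) = rf_num \<phi>" "coord_den d (rf_coords d \<phi>) = rf_den \<phi>"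
    "\<And>i. i > 2 * d + 1 \<Longrightarrow> rf_coords d \<phi> i = 0"
proof -
  have deg: "degree (rf_num \<phi>) \<le> d" "degree (rf_den \<phi>) \<le> d" using assms by (auto simp: Rat_def rf_degree_def)
  show "coord_num d (rf_coords d \<phi>) = rf_num \<phi>"
    unfolding coord_num_def using poly_as_sum_of_monoms'[OF deg(1)] by (simp add: rf_coords_def)
  show "coord_den d (rf_coords d \<phi>) = rf_den \<phi>"
    unfolding coord_den_def using poly_as_sum_of_monoms'[OF deg(2)] by (simp add: rf_coords_def)
  show "rf_coords d \<phi> i = 0" if "i > 2 * d + 1" for i
    using that deg by (simp add: rf_coords_def coeff_eq_0)
qed

text \<open>
  At a map, \<open>D\<close> evaluated at the forms for the power \<open>r\<close> of \<open>t\<close> is the \<open>w\<close>-th power of the form for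
  the leading coefficient, times \<open>D\<close> evaluated at the symmetric functions. Letting \<open>r\<close> vary gives equations
  for the preimage, since at each map the leading form is nonzero for some \<open>r\<close>. The lemma
  \<open>homogeneous_part\<close> makes the equations homogeneous in the right variables.
\<close>

lemma Moduli_closed_discriminant:
  fixes D :: "'k::field mpol"
  assumes d: "d \<ge> 2" and n: "n \<ge> 1"
    and scale: "\<And>s x. mpol_eval to_ac (\<lambda>i. s * x i) D = s ^ w * mpol_eval to_ac x D"
  shows "Moduli_closed d {c \<in> Moduli d. \<exists>\<phi>\<in>c. mpol_eval to_ac (spec_coeff n \<phi>) D = 0}" (is "Moduli_closed d ?Z")
  unfolding Moduli_closed_def
proof
  interpret ac: inj_comm_ring_hom "to_ac :: 'k \<Rightarrow> 'k alg_closure" by (rule inj_comm_ring_hom_to_ac)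
  have d1: "d \<ge> 1" using d by simp
  show "?Z \<subseteq> Moduli d" by blast
  have UZ: "\<Union>?Z = {\<phi> \<in> Rat d. mpol_eval to_ac (spec_coeff n \<phi>) D = 0}"
  proof (intro equalityI subsetI)
    fix \<phi> assume "\<phi> \<in> \<Union>?Z"
    then obtain c \<psi> where c: "c \<in> Moduli d" "\<phi> \<in> c" "\<psi> \<in> c" "mpol_eval to_ac (spec_coeff n \<psi>) D = 0" by blast
    then show "\<phi> \<in> {\<phi> \<in> Rat d. mpol_eval to_ac (spec_coeff n \<phi>) D = 0}"
      using moduli_class(2)[OF d c(1)] moduli_class(4)[OF d c(1-3) n] by auto
  next
    fix \<phi> assume \<phi>: "\<phi> \<in> {\<phi> \<in> Rat d. mpol_eval to_ac (spec_coeff n \<phi>) D = 0}"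
    hence "conj_rel d `` {\<phi>} \<in> Moduli d" "\<phi> \<in> conj_rel d `` {\<phi>}"
      unfolding Moduli_def using equiv_class_self[OF equiv_conj_rel[OF d1]] by (auto intro: quotientI)
    then show "\<phi> \<in> \<Union>?Z" using \<phi> by blast
  qed
  obtain \<delta> where \<delta>: "\<And>x s j r. mult_coeff d n (\<lambda>i. (s :: 'k alg_closure) * x i) j r = s ^ \<delta> * mult_coeff d n x j r"
    using mult_coeff_scale[of d n, where 'a = "'k alg_closure"] by blast
  define f where "f r = mpol_eval mpol_const (\<lambda>j. mult_coeff d n mpol_var j r) D" for r
  have f: "mpol_eval to_ac x (f r) = mpol_eval to_ac (\<lambda>j. mult_coeff d n x j r) D" for x r
  proof -
    interpret e: comm_ring_hom "mpol_eval to_ac x" by (rule ac.mpol_eval_hom)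
    show ?thesis
      unfolding f_def mpol_eval_hom_comp[OF e.comm_ring_hom_axioms] ac.mpol_eval_const
        mpol_eval_mult_coeff[OF ac.comm_ring_hom_axioms] ac.mpol_eval_var ..
  qed
  have "\<exists>g. mpoly_vars g \<subseteq> {..2 * d + 1} \<and> mpoly_homogeneous (\<delta> * w) g \<and>
      (\<forall>x. (\<forall>i. i \<notin> {..2 * d + 1} \<longrightarrow> x i = 0) \<longrightarrow> mpol_eval to_ac x g = mpol_eval to_ac x (f r))" for r
  proof -
    have "mpol_eval to_ac (\<lambda>i. s * x i) (f r) = s ^ (\<delta> * w) * mpol_eval to_ac x (f r)" for s x
      unfolding f \<delta> scale power_mult ..
    from homogeneous_part[OF ac.comm_ring_hom_axioms infinite_UNIV_alg_closed this] show ?thesis by metis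
  qed
  then obtain g where g: "\<And>r. mpoly_vars (g r) \<subseteq> {..2 * d + 1}" "\<And>r. mpoly_homogeneous (\<delta> * w) (g r)"
    "\<And>r x. (\<forall>i. i \<notin> {..2 * d + 1} \<longrightarrow> x i = 0) \<Longrightarrow> mpol_eval to_ac x (g r) = mpol_eval to_ac x (f r)" by metis
  have "(\<forall>h\<in>range g. mpoly_eval h (rf_coords d \<phi>) = 0) \<longleftrightarrow> mpol_eval to_ac (spec_coeff n \<phi>) D = 0" if \<phi>: "\<phi> \<in> Rat d" for \<phi>
  proof -
    let ?x = "rf_coords d \<phi>"
    have map: "is_map d (coord_num d ?x) (coord_den d ?x)"
      unfolding rf_coords_coord[OF \<phi>] by (rule is_map_rf[OF \<phi> d1])
    have F: "Fract (coord_num d ?x) (coord_den d ?x) = \<phi>"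
      unfolding rf_coords_coord[OF \<phi>] by (rule is_map_rf(2)[OF \<phi> d1, symmetric])
    have "mpoly_eval (g r) ?x = mult_coeff d n ?x (Suc (d ^ n)) r ^ w * mpol_eval to_ac (spec_coeff n \<phi>) D" for r
    proof -
      have "mpoly_eval (g r) ?x = mpol_eval to_ac ?x (g r)" by (simp add: mpoly_eval_def mpol_eval_def monom_eval_def)
      also have "\<dots> = mpol_eval to_ac ?x (f r)" using rf_coords_coord(3)[OF \<phi>] by (intro g(3)) auto
      finally show ?thesis unfolding f mpol_eval_mult_coeff_regular[OF map d n scale] F .
    qed
    moreover obtain r where "mult_coeff d n ?x (Suc (d ^ n)) r \<noteq> 0" using mult_coeff_regular(2)[OF d n map] by blast
    ultimately show ?thesis by auto
  qed
  then show "Rat_closed d (\<Union>?Z)"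
    unfolding Rat_closed_def UZ using g(1,2) by (intro exI[of _ "range g"]) blast
qed

text \<open>
  All maps in the fibre have the same symmetric functions \<open>C\<close> of period-\<open>n\<close> multipliers, and each
  class contains a point of the slice.
\<close>

theorem finite_fibre:
  fixes D :: "'k::field mpol"
  assumes d: "d \<ge> 2" and n: "n \<ge> 1" and N: "n \<le> N"
    and rep: "\<And>\<phi>. \<phi> \<in> Rat d \<Longrightarrow> mpol_eval to_ac (spec_coeff n \<phi>) D \<noteq> 0 \<Longrightarrow> poly (mult_poly (period_multipliers n \<phi>)) (- 1) \<noteq> 0"
    and fin: "\<And>C. mpol_eval to_ac C D \<noteq> 0 \<Longrightarrow>
      finite {h. (\<forall>i. i \<notin> slice_vars d \<longrightarrow> h i = 0) \<and> is_slice_map d h \<and> spec_coeff n (slice_map d h) = C}"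
  shows "finite {c \<in> Moduli d - {c \<in> Moduli d. \<exists>\<phi>\<in>c. mpol_eval to_ac (spec_coeff n \<phi>) D = 0}. Lambda_prod d N c = y}"
    (is "finite ?F")
proof (cases "?F = {}")
  case False
  then obtain c0 where c0: "c0 \<in> ?F" by blast
  then obtain \<phi>0 where \<phi>0: "\<phi>0 \<in> c0" using moduli_class(1)[OF d] by blast
  define C where "C = spec_coeff n \<phi>0"
  have "mpol_eval to_ac C D \<noteq> 0" using c0 \<phi>0 by (auto simp: C_def)
  from fin[OF this] have "finite ((\<lambda>h. conj_rel d `` {slice_map d h}) `
      {h. (\<forall>i. i \<notin> slice_vars d \<longrightarrow> h i = 0) \<and> is_slice_map d h \<and> spec_coeff n (slice_map d h) = C})"
    by (rule finite_imageI)
  then show ?thesis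
  proof (rule finite_subset[rotated], intro subsetI)
    fix c assume c: "c \<in> ?F"
    hence cM: "c \<in> Moduli d" by blast
    obtain \<phi> where \<phi>: "\<phi> \<in> c" using moduli_class(1)[OF d cM] by blast
    have \<phi>R: "\<phi> \<in> Rat d" using moduli_class(2)[OF d cM] \<phi> by blast
    have \<phi>0R: "\<phi>0 \<in> Rat d" using moduli_class(2)[OF d] c0 \<phi>0 by blast
    have "mpol_eval to_ac (spec_coeff n \<phi>) D \<noteq> 0" using c \<phi> by blast
    from slice_normal_form[OF \<phi>R d n rep[OF \<phi>R this]] obtain h
      where h: "\<And>i. i \<notin> slice_vars d \<Longrightarrow> h i = 0" "is_slice_map d h" "(\<phi>, slice_map d h) \<in> conj_rel d"
      unfolding is_slice_map_def slice_map_def by metis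
    have hc: "slice_map d h \<in> c" using h(3) moduli_class(3)[OF d cM \<phi>] by blast
    have "Lambda d n c = Lambda d n c0" using c c0 by (intro Lambda_prod_eqD[OF d _ _ n N]) auto
    hence "Lambda_rf d n \<phi> = Lambda_rf d n \<phi>0" 
      using Lambda_eq[OF d cM \<phi> n] Lambda_eq[OF d _ \<phi>0 n] c0 by simp
    hence "spec_coeff n \<phi> = C" using Lambda_rf_eq_iff[OF \<phi>R \<phi>0R d n] by (simp add: C_def)
    hence "spec_coeff n (slice_map d h) = C" using moduli_class(4)[OF d cM hc \<phi> n] by simp
    moreover have "c = conj_rel d `` {slice_map d h}" by (rule moduli_class(3)[OF d cM hc])
    ultimately show "c \<in> (\<lambda>h. conj_rel d `` {slice_map d h}) `
        {h. (\<forall>i. i \<notin> slice_vars d \<longrightarrow> h i = 0) \<and> is_slice_map d h \<and> spec_coeff n (slice_map d h) = C}"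
      using h(1,2) by blast
  qed
next
  case True
  then show ?thesis by (simp only: finite.emptyI)
qed

text \<open>
  If \<open>d\<^sup>3 = d\<^sup>4 = 1\<close> in the ring, then \<open>d = 1\<close>.
\<close>

lemma period_choice:
  assumes d: "d \<ge> 2" and small: "of_nat (d - 1) \<noteq> (0 :: 'a::comm_ring_1)"
  obtains n where "n \<ge> 3" "of_nat (d ^ n - 1) \<noteq> (0 :: 'a)"
proof (cases "of_nat (d ^ 3 - 1) = (0 :: 'a) \<and> of_nat (d ^ 4 - 1) = (0 :: 'a)")
  case True
  have sub1: "of_nat (d ^ m - 1) = (of_nat d :: 'a) ^ m - 1" for m
    using d by (simp add: of_nat_diff)
  have "(of_nat d :: 'a) ^ 3 = 1" "(of_nat d :: 'a) ^ 4 = 1" using True unfolding sub1 by auto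
  moreover have "(of_nat d :: 'a) ^ 4 = of_nat d * of_nat d ^ 3" by (simp add: power_numeral_reduce)
  ultimately have "of_nat (d ^ 1 - 1) = (0 :: 'a)" unfolding sub1 by simp
  with small show ?thesis by simp
next
  case False
  then show ?thesis using that[of 3] that[of 4] by auto
qed

theorem theorem1p1:
  fixes d :: nat
  assumes "d \<ge> 2"
    and "CHAR('k::field) = 0 \<or> CHAR('k) > d"
  shows "\<forall>\<^sub>F n in sequentially. \<exists>Z :: 'k alg_closure poly fract set set.
    Moduli_closed d Z \<and> Z \<subset> Moduli d \<and>
    (\<forall>y. finite {c \<in> Moduli d - Z. Lambda_prod d n c = y})"
proof -
  have small: "of_nat j \<noteq> (0 :: 'k alg_closure)" if "1 \<le> j" "j \<le> d" for j
  proof -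
    have "\<not> CHAR('k) dvd j" using assms(2) that by (auto dest: dvd_imp_le)
    then have "of_nat j \<noteq> (0 :: 'k)" by (simp add: of_nat_eq_0_iff_char_dvd)
    then show ?thesis by (metis to_ac_of_nat to_ac_eq_0_iff)
  qed
  obtain n where n: "n \<ge> 3" and char: "of_nat (d ^ n - 1) \<noteq> (0 :: 'k alg_closure)"
    by (rule period_choice[OF assms(1) small[of "d - 1"]]) (use assms(1) in auto)
  have n1: "n \<ge> 1" using n by simp
  show ?thesis
  proof (rule discriminant_exists[OF assms(1) n small char])
    fix D :: "'k mpol" and w
    assume scale: "\<And>s x. mpol_eval to_ac (\<lambda>i. s * x i) D = s ^ w * mpol_eval to_ac x D"
      and proper: "\<exists>h. is_slice_map d h \<and> mpol_eval to_ac (spec_coeff n (slice_map d h)) D \<noteq> 0"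
      and rep: "\<And>\<phi>. \<phi> \<in> Rat d \<Longrightarrow> mpol_eval to_ac (spec_coeff n \<phi>) D \<noteq> 0 \<Longrightarrow> poly (mult_poly (period_multipliers n \<phi>)) (- 1) \<noteq> 0"
      and fin: "\<And>C. mpol_eval to_ac C D \<noteq> 0 \<Longrightarrow>
        finite {h. (\<forall>i. i \<notin> slice_vars d \<longrightarrow> h i = 0) \<and> is_slice_map d h \<and> spec_coeff n (slice_map d h) = C}"
    define Z where "Z = {c \<in> Moduli d. \<exists>\<phi>\<in>c. mpol_eval to_ac (spec_coeff n \<phi>) D = 0}"
    have closed: "Moduli_closed d Z"
      unfolding Z_def by (rule Moduli_closed_discriminant[OF assms(1) n1 scale])
    have "Z \<noteq> Moduli d"
    proof
      assume ZM: "Z = Moduli d"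
      have d1: "d \<ge> 1" using assms(1) by simp
      obtain h where h: "is_slice_map d h" "mpol_eval to_ac (spec_coeff n (slice_map d h)) D \<noteq> 0" using proper by blast
      have R: "slice_map d h \<in> Rat d"
        using h(1) unfolding is_slice_map_def slice_map_def by (rule Fract_in_Rat[OF _ d1])
      have c: "conj_rel d `` {slice_map d h} \<in> Moduli d" "slice_map d h \<in> conj_rel d `` {slice_map d h}"
        unfolding Moduli_def by (rule quotientI[OF R], rule equiv_class_self[OF equiv_conj_rel[OF d1] R])
      then obtain \<phi> where "\<phi> \<in> conj_rel d `` {slice_map d h}" "mpol_eval to_ac (spec_coeff n \<phi>) D = 0"
        unfolding ZM[symmetric] unfolding Z_def by blast
      with h(2) moduli_class(4)[OF assms(1) c(1) this(1) c(2) n1] show False by simp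
    qed
    moreover have "Z \<subseteq> Moduli d" unfolding Z_def by blast
    moreover have "finite {c \<in> Moduli d - Z. Lambda_prod d N c = y}" if "n \<le> N" for N y
      unfolding Z_def by (rule finite_fibre[OF assms(1) n1 that rep fin])
    ultimately show ?thesis
      using closed by (intro eventually_sequentiallyI[of n] exI[of _ Z]) blast
  qed
qed

end
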